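(* Let $d\ge1$, $1\le r\le\infty$ and $\sigma>-\frac d2-1$. Assume that $u_0\in\dot B^{-\frac d2-1}_{2,\infty}(\mathbb{R}^d)\cap\dot B^{\sigma}_{2,r}(\mathbb{R}^d)$, and let $u$ be the solution of the linear problem $$u_t-\Delta Pu=0\quad(x\in\mathbb{R}^d,\ t>0),\qquad u(x,0)=u_0(x).$$ Then there are positive constants $\lambda$ and $C$ (independent of $t$ and $u_0$) such that, for all $t\ge0$, $$\|u(t)\|_{\dot B^\sigma_{2,r}}\le C(1+t)^{-\frac{\sigma+d/2+1}{2}}\|u_0\|_{\dot B^{-\frac d2-1}_{2,\infty}}+Ce^{-\lambda t}\|u_0\|_{\dot B^\sigma_{2,r}} .$$
   Context: The operator $P$ is the Fourier multiplier $\widehat{Pu}(\xi)=\frac{1}{1+|\xi|^2}\hat u(\xi)$, so $-\Delta P$ has symbol $\frac{|\xi|^2}{1+|\xi|^2}$. Littlewood--Paley decomposition: let $\chi$ be a smooth function with values in $[0,1]$, supported in the ball $B(0,4/3)$ and equal to $1$ on $B(0,3/4)$; set $\varphi(\xi)=\chi(\xi/2)-\chi(\xi)$ and $\dot\Delta_k=\varphi(2^{-k}D)$ for $k\in\mathbb{Z}$. $\mathcal{S}_h'$ denotes the space of tempered distributions modulo polynomials, i.e. those for which $u=\sum_{k\in\mathbb{Z}}\dot\Delta_k u$. The homogeneous Besov space $\dot B^s_{2,q}$ is the set of $f\in\mathcal{S}_h'$ with finite norm $\|f\|_{\dot B^s_{2,q}}=\big(\sum_{k\in\mathbb{Z}}(2^{ks}\|\dot\Delta_kf\|_{L^2})^q\big)^{1/q}$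 if $q<\infty$, and $\|f\|_{\dot B^s_{2,\infty}}=\sup_{k\in\mathbb{Z}}2^{ks}\|\dot\Delta_kf\|_{L^2}$. *)

theory Defs
  imports "HOL-Analysis.Analysis"
begin

section \<open>Schwartz functions\<close>

definition partial_deriv :: "'a::euclidean_space \<Rightarrow> ('a \<Rightarrow> 'b::real_normed_vector) \<Rightarrow> 'a \<Rightarrow> 'b" where
  "partial_deriv i f x = frechet_derivative f (at x) i"

text \<open>Multi-indices are rendered as lists of basis vectors: \<open>[i\<^sub>1, \<dots>, i\<^sub>n]\<close> stands for
  \<open>\<partial>\<^bsub>i\<^sub>1\<^esub> \<dots> \<partial>\<^bsub>i\<^sub>n\<^esub>\<close>.\<close>

definition iter_deriv :: "'a::euclidean_space list \<Rightarrow> ('a \<Rightarrow> 'b::real_normed_vector) \<Rightarrow> 'a \<Rightarrow> 'b" where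
  "iter_deriv is f = foldr partial_deriv is f"

definition smooth :: "('a::euclidean_space \<Rightarrow> 'b::real_normed_vector) \<Rightarrow> bool" where
  "smooth f \<longleftrightarrow> (\<forall>is. set is \<subseteq> Basis \<longrightarrow> (\<forall>x. iter_deriv is f differentiable (at x)))"

definition schwartz :: "('a::euclidean_space \<Rightarrow> complex) set" where
  "schwartz = {\<phi>. smooth \<phi> \<and>
     (\<forall>is N. set is \<subseteq> Basis \<longrightarrow> bounded (range (\<lambda>x. (1 + norm x) ^ N *\<^sub>R iter_deriv is \<phi> x)))}"

definition schwartz_seminorm :: "nat \<Rightarrow> ('a::euclidean_space \<Rightarrow> complex) \<Rightarrow> real" where
  "schwartz_seminorm N \<phi> =
     (SUP (x, is) \<in> UNIV \<times> {is. set is \<subseteq> Basis \<and> length is \<le> N}.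
        (1 + norm x) ^ N * norm (iter_deriv is \<phi> x))"

definition fourier :: "('a::euclidean_space \<Rightarrow> complex) \<Rightarrow> 'a \<Rightarrow> complex" where
  "fourier \<phi> \<xi> = (LINT x|lborel. cis (- (x \<bullet> \<xi>)) * \<phi> x)"

definition inv_fourier :: "('a::euclidean_space \<Rightarrow> complex) \<Rightarrow> 'a \<Rightarrow> complex" where
  "inv_fourier \<phi> x = of_real (1 / (2 * pi) ^ DIM('a)) * (LINT \<xi>|lborel. cis (x \<bullet> \<xi>) * \<phi> \<xi>)"

section \<open>Tempered distributions\<close>

text \<open>A distribution is a functional on all functions, but only its values on \<^const>\<open>schwartz\<close>
  are meaningful; equality of distributions is equality on \<^const>\<open>schwartz\<close>. The pairing is
  bilinear (no complex conjugate).\<close>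

type_synonym 'a distribution = "('a \<Rightarrow> complex) \<Rightarrow> complex"

definition tempered :: "'a::euclidean_space distribution \<Rightarrow> bool" where
  "tempered u \<longleftrightarrow>
     (\<forall>\<phi>\<in>schwartz. \<forall>\<psi>\<in>schwartz. \<forall>a b. u (\<lambda>x. a * \<phi> x + b * \<psi> x) = a * u \<phi> + b * u \<psi>) \<and>
     (\<exists>N C. \<forall>\<phi>\<in>schwartz. norm (u \<phi>) \<le> C * schwartz_seminorm N \<phi>)"

definition dist_deriv :: "'a::euclidean_space \<Rightarrow> 'a distribution \<Rightarrow> 'a distribution" where
  "dist_deriv i u \<phi> = - u (partial_deriv i \<phi>)"

definition dist_laplacian :: "'a::euclidean_space distribution \<Rightarrow> 'a distribution" where
  "dist_laplacian u \<phi> = (\<Sum>i\<in>Basis. dist_deriv i (dist_deriv i u) \<phi>)"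

definition dist_fourier :: "'a::euclidean_space distribution \<Rightarrow> 'a distribution" where
  "dist_fourier u \<phi> = u (fourier \<phi>)"

definition dist_inv_fourier :: "'a::euclidean_space distribution \<Rightarrow> 'a distribution" where
  "dist_inv_fourier u \<phi> = u (inv_fourier \<phi>)"

definition dist_mult :: "('a::euclidean_space \<Rightarrow> real) \<Rightarrow> 'a distribution \<Rightarrow> 'a distribution" where
  "dist_mult m u \<phi> = u (\<lambda>x. of_real (m x) * \<phi> x)"

text \<open>The operator \<open>m(D)\<close>, used only for smooth symbols \<open>m\<close> of at most polynomial growth.\<close>

definition fourier_multiplier ::
  "('a::euclidean_space \<Rightarrow> real) \<Rightarrow> 'a distribution \<Rightarrow> 'a distribution" where
  "fourier_multiplier m u = dist_inv_fourier (dist_mult m (dist_fourier u))"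

definition P_op :: "'a::euclidean_space distribution \<Rightarrow> 'a distribution" where
  "P_op = fourier_multiplier (\<lambda>\<xi>. 1 / (1 + (norm \<xi>)\<^sup>2))"

text \<open>For \<open>0 < p < \<infinity>\<close> only.\<close>

definition ennreal_powr :: "ennreal \<Rightarrow> real \<Rightarrow> ennreal" where
  "ennreal_powr x p = (if x = \<infinity> then \<infinity> else ennreal (enn2real x powr p))"

definition represents :: "('a::euclidean_space \<Rightarrow> complex) \<Rightarrow> 'a distribution \<Rightarrow> bool" where
  "represents f u \<longleftrightarrow> f \<in> borel_measurable lborel \<and>
     (\<forall>\<phi>\<in>schwartz. integrable lborel (\<lambda>x. f x * \<phi> x) \<and> u \<phi> = (LINT x|lborel. f x * \<phi> x))"

text \<open>The infimum is over a set of functions that agree almost everywhere; if the distribution is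
  not a function, the set is empty and the infimum is \<open>\<infinity>\<close>.\<close>

definition L2_norm :: "'a::euclidean_space distribution \<Rightarrow> ennreal" where
  "L2_norm u =
     (INF f \<in> {f. represents f u}.
        ennreal_powr (\<integral>\<^sup>+ x. ennreal ((norm (f x))\<^sup>2) \<partial>lborel) (1 / 2))"

section \<open>Homogeneous Besov spaces\<close>

definition lp_cutoff :: "('a::euclidean_space \<Rightarrow> real) \<Rightarrow> bool" where
  "lp_cutoff chi \<longleftrightarrow> smooth chi \<and> range chi \<subseteq> {0..1} \<and>
     closure {\<xi>. chi \<xi> \<noteq> 0} \<subseteq> ball 0 (4 / 3) \<and> (\<forall>\<xi>\<in>ball 0 (3 / 4). chi \<xi> = 1)"

definition lp_phi :: "('a::euclidean_space \<Rightarrow> real) \<Rightarrow> 'a \<Rightarrow> real" where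
  "lp_phi chi \<xi> = chi ((1 / 2) *\<^sub>R \<xi>) - chi \<xi>"

definition lp_block ::
  "('a::euclidean_space \<Rightarrow> real) \<Rightarrow> int \<Rightarrow> 'a distribution \<Rightarrow> 'a distribution" where
  "lp_block chi k = fourier_multiplier (\<lambda>\<xi>. lp_phi chi ((2 powr (- of_int k)) *\<^sub>R \<xi>))"

text \<open>The identity \<open>u = \<Sum>\<^sub>k \<Delta>\<^sub>k u\<close> is read in the space of tempered distributions, without a
  polynomial correction. As the sum over \<open>k \<ge> 0\<close> converges for every tempered \<open>u\<close>, symmetric
  partial sums and independent limits at both ends give the same condition.\<close>

definition S_h :: "('a::euclidean_space \<Rightarrow> real) \<Rightarrow> 'a distribution set" where
  "S_h chi = {u. tempered u \<and>
     (\<forall>\<phi>\<in>schwartz. (\<lambda>N. \<Sum>k = - int N..int N. lp_block chi k u \<phi>) \<longlonglongrightarrow> u \<phi>)}"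

definition besov_norm ::
  "('a::euclidean_space \<Rightarrow> real) \<Rightarrow> real \<Rightarrow> ennreal \<Rightarrow> 'a distribution \<Rightarrow> ennreal" where
  "besov_norm chi s q u =
     (if q = \<infinity>
      then (SUP k. ennreal (2 powr (of_int k * s)) * L2_norm (lp_block chi k u))
      else ennreal_powr
        (\<Sum>\<^sub>\<infinity>k\<in>UNIV. ennreal_powr (ennreal (2 powr (of_int k * s)) * L2_norm (lp_block chi k u))
           (enn2real q))
        (1 / enn2real q))"

definition besov_space ::
  "('a::euclidean_space \<Rightarrow> real) \<Rightarrow> real \<Rightarrow> ennreal \<Rightarrow> 'a distribution set" where
  "besov_space chi s q = {u \<in> S_h chi. besov_norm chi s q u < \<infinity>}"

section \<open>The linear problem\<close>

text \<open>Solutions are weakly continuous curves of tempered distributions on \<open>[0, \<infinity>)\<close> that satisfy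
  \<open>u\<^sub>t - \<Delta>Pu = 0\<close> for \<open>t > 0\<close> when tested against each Schwartz function.\<close>

definition linear_solution ::
  "'a::euclidean_space distribution \<Rightarrow> (real \<Rightarrow> 'a distribution) \<Rightarrow> bool" where
  "linear_solution u0 u \<longleftrightarrow>
     (\<forall>t\<ge>0. tempered (u t)) \<and>
     (\<forall>\<phi>\<in>schwartz. u 0 \<phi> = u0 \<phi>) \<and>
     (\<forall>\<phi>\<in>schwartz. continuous_on {0..} (\<lambda>t. u t \<phi>)) \<and>
     (\<forall>\<phi>\<in>schwartz. \<forall>t>0. \<exists>u'. ((\<lambda>s. u s \<phi>) has_vector_derivative u') (at t) \<and>
        u' - dist_laplacian (P_op (u t)) \<phi> = 0)"

end

theory Submission
  imports Defs "HOL-Probability.Characteristic_Functions" "HOL-Probability.Sinc_Integral"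
    "HOL-Complex_Analysis.Cauchy_Integral_Formula"
begin

text \<open>
  On the Fourier side the equation reads \<open>v\<^sub>t = - m v\<close> with the symbol
  \<open>m \<xi> = |\<xi>|\<^sup>2 / (1 + |\<xi>|\<^sup>2)\<close>, so the solution is the multiplier \<open>exp (- t m)\<close> applied to the
  datum. On the frequencies of the block \<open>k\<close>, slightly fattened, \<open>m\<close> is at least \<open>c = 9 / 73\<close> when
  \<open>k \<ge> 0\<close> and at least \<open>c 4\<^sup>k\<close> when \<open>k < 0\<close> (\<open>block_rate_lower\<close>). The high frequencies
  therefore contribute at most \<open>exp (- c t)\<close> times the norm of the datum with index \<open>\<sigma>\<close>. A low block
  is bounded through the norm with index \<open>- d/2 - 1\<close>; with \<open>s = \<sigma> + d/2 + 1 > 0\<close> it remains to sum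
  \<open>2 powr (k s) * exp (- c t 4\<^sup>k)\<close> over \<open>k < 0\<close>. In terms of \<open>y = (1 + t) 4\<^sup>k\<close> the summand is, up to
  a constant, \<open>(1 + t) powr (- s/2)\<close> times \<open>y powr (s/2) * exp (- c y)\<close>, and the latter decays
  geometrically on both sides of \<open>y = 1\<close> (\<open>dyadic_heat_sum\<close>). Since an \<open>\<ell>\<^sup>r\<close> norm is at most the
  \<open>\<ell>\<^sup>1\<close> norm, this covers every \<open>r\<close>.

  The formula for the solution has to be derived for curves of tempered distributions that are merely
  weakly continuous. The order and the constant in the continuity estimate for \<open>u t\<close> may depend
  on \<open>t\<close> in an arbitrary way, so the pairing of \<open>u s\<close> with a test function that itself moves with \<open>s\<close>
  cannot simply be differentiated. Instead the scalar function \<open>s \<mapsto> v s \<psi>\<close>, where \<open>v s\<close> is the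
  Fourier transform of \<open>u s\<close>, is expanded at the final time: its derivatives are \<open>\<plusminus> v s (m\<^sup>n \<psi>)\<close>, and the
  Taylor remainder tends to 0 if \<open>v s (m\<^sup>n \<psi>)\<close> is at most \<open>B 2\<^sup>n\<close> with \<open>B\<close> independent of \<open>s\<close> in a compact
  interval (\<open>flow_formula\<close>). For one \<open>s\<close> this holds because the functions \<open>f(m) \<psi>\<close> stay bounded in the
  Schwartz space when \<open>f\<close> ranges over a bounded set of holomorphic functions on a disc of radius
  larger than 1 (\<open>slow_family_holomorphic\<close>). Uniformity in \<open>s\<close> is a uniform boundedness argument on the
  summable combinations of \<open>(m/2)\<^sup>n \<psi>\<close> (\<open>uniform_bound_of_summable_combinations\<close>).

  The Fourier transform is needed on Schwartz functions only. The \<open>L\<^sup>2\<close> norm of a distribution \<open>v\<close> is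
  the least \<open>B\<close> with \<open>|v \<phi>| \<le> B \<parallel>\<phi>\<parallel>\<^sub>2\<close> for all Schwartz functions \<open>\<phi>\<close> (\<open>L2_norm_dual_bound\<close>,
  and \<open>L2_norm_le_dual\<close> by the Riesz representation theorem), and the block \<open>k\<close> of \<open>u t\<close> tested against
  \<open>\<phi>\<close> is the block \<open>k\<close> of the datum tested against a Schwartz function \<open>\<theta>\<close> whose norm, by
  Plancherel, is smaller than that of \<open>\<phi>\<close> by the decay factor (\<open>lp_block_solution_localized\<close>).

  Continuity on the Schwartz space enters throughout in the form that bounded families are mapped to
  bounded sets. Estimates of single seminorms are thereby replaced by closure properties of bounded
  families (\<open>smooth_family\<close>).
\<close>

section \<open>Bounded families of smooth functions\<close>

text \<open>All iterated partial derivatives of the family satisfy \<open>P\<close>. With \<open>P\<close> a bound that is uniform in the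
  index \<open>j\<close>, this describes bounded sets of functions: bounded subsets of the Schwartz space for rapid
  decrease, bounded sets of multipliers for polynomial growth. In the coinductive form a proof exhibits
  a class of families that is closed under first derivatives, in place of a formula for iterated
  ones.\<close>

coinductive smooth_family ::
  "(('j \<Rightarrow> 'a::euclidean_space \<Rightarrow> 'b::real_normed_vector) \<Rightarrow> bool) \<Rightarrow> ('j \<Rightarrow> 'a \<Rightarrow> 'b) \<Rightarrow> bool"
  for P where
  "P \<Phi> \<Longrightarrow> (\<And>j x. \<Phi> j differentiable (at x)) \<Longrightarrow>
   (\<And>i. i \<in> Basis \<Longrightarrow> smooth_family P (\<lambda>j. partial_deriv i (\<Phi> j))) \<Longrightarrow> smooth_family P \<Phi>"

lemma smooth_familyD:
  assumes "smooth_family P \<Phi>"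
  shows "P \<Phi>" "\<Phi> j differentiable (at x)"
    "i \<in> Basis \<Longrightarrow> smooth_family P (\<lambda>j. partial_deriv i (\<Phi> j))"
  using assms by (auto elim: smooth_family.cases)

lemma smooth_family_coinduct:
  assumes "X \<Phi>" "\<And>\<Phi>. X \<Phi> \<Longrightarrow> P \<Phi>" "\<And>\<Phi> j x. X \<Phi> \<Longrightarrow> \<Phi> j differentiable (at x)"
    "\<And>\<Phi> i. X \<Phi> \<Longrightarrow> i \<in> Basis \<Longrightarrow> X (\<lambda>j. partial_deriv i (\<Phi> j))"
  shows "smooth_family P \<Phi>"
  by (rule smooth_family.coinduct[of X]) (use assms in auto)

lemma smooth_family_iter_deriv:
  assumes "smooth_family P \<Phi>" "set is \<subseteq> Basis"
  shows "smooth_family P (\<lambda>j. iter_deriv is (\<Phi> j))"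
  using assms(2) by (induction "is") (auto simp: iter_deriv_def assms(1) intro: smooth_familyD(3))

text \<open>The link to the multi-index form in which Schwartz functions are defined.\<close>

lemma smooth_family_iff:
  "smooth_family P \<Phi> \<longleftrightarrow> (\<forall>is. set is \<subseteq> Basis \<longrightarrow>
     P (\<lambda>j. iter_deriv is (\<Phi> j)) \<and> (\<forall>j x. iter_deriv is (\<Phi> j) differentiable (at x)))"
  (is "?L \<longleftrightarrow> ?R \<Phi>")
proof
  assume ?L
  then show "?R \<Phi>"
    by (auto dest: smooth_familyD(1)[OF smooth_family_iter_deriv] smooth_familyD(2)[OF smooth_family_iter_deriv])
next
  assume "?R \<Phi>"
  then show ?L
  proof (coinduction arbitrary: \<Phi>)
    case (smooth_family \<Phi>)
    have 1: "P \<Phi>" "\<Phi> j differentiable (at x)" for j x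
      using smooth_family[rule_format, of "[]"] by (auto simp: iter_deriv_def)
    moreover have "?R (\<lambda>j. partial_deriv i (\<Phi> j))" if "i \<in> Basis" for i
    proof (intro allI impI)
      fix "is" :: "'b list" assume "set is \<subseteq> Basis"
      then show "P (\<lambda>j. iter_deriv is (partial_deriv i (\<Phi> j))) \<and>
        (\<forall>j x. iter_deriv is (partial_deriv i (\<Phi> j)) differentiable (at x))"
        using smooth_family[rule_format, of "is @ [i]"] that by (auto simp: iter_deriv_def)
    qed
    ultimately show ?case by auto
  qed
qed

text \<open>The product rule leads out of most natural classes, but only into sums of their members.\<close>

inductive sum_closure :: "(('j \<Rightarrow> 'a \<Rightarrow> 'b::plus) \<Rightarrow> bool) \<Rightarrow> ('j \<Rightarrow> 'a \<Rightarrow> 'b) \<Rightarrow> bool"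
  for X where
  base: "X \<Phi> \<Longrightarrow> sum_closure X \<Phi>"
| add: "sum_closure X \<Phi> \<Longrightarrow> sum_closure X \<Psi> \<Longrightarrow> sum_closure X (\<lambda>j x. \<Phi> j x + \<Psi> j x)"

lemma partial_deriv_eq: "(f has_derivative f') (at x) \<Longrightarrow> partial_deriv i f x = f' i"
  unfolding partial_deriv_def using frechet_derivative_at by metis

lemma partial_deriv_add:
  assumes "\<And>x. f differentiable (at x)" "\<And>x. g differentiable (at x)"
  shows "partial_deriv i (\<lambda>x. f x + g x) = (\<lambda>x. partial_deriv i f x + partial_deriv i g x)"
proof
  fix x
  show "partial_deriv i (\<lambda>x. f x + g x) x = partial_deriv i f x + partial_deriv i g x"
    unfolding partial_deriv_def[of i f] partial_deriv_def[of i g]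
    using assms by (intro partial_deriv_eq has_derivative_add) (auto simp: frechet_derivative_works)
qed

lemma partial_deriv_mult:
  fixes f g :: "'a::euclidean_space \<Rightarrow> 'b::real_normed_algebra"
  assumes "\<And>x. f differentiable (at x)" "\<And>x. g differentiable (at x)"
  shows "partial_deriv i (\<lambda>x. f x * g x) = (\<lambda>x. partial_deriv i f x * g x + f x * partial_deriv i g x)"
proof
  fix x
  have "((\<lambda>x. f x * g x) has_derivative
     (\<lambda>h. f x * frechet_derivative g (at x) h + frechet_derivative f (at x) h * g x)) (at x)"
    using assms by (intro has_derivative_mult) (auto simp: frechet_derivative_works)
  from partial_deriv_eq[OF this, of i]
  show "partial_deriv i (\<lambda>x. f x * g x) x = partial_deriv i f x * g x + f x * partial_deriv i g x"
    by (simp add: partial_deriv_def)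
qed

text \<open>Coinduction up to sums: as \<open>P\<close> is preserved by sums, the sums of members of \<open>X\<close> form a class that is
  closed under partial derivatives as soon as the derivatives of members of \<open>X\<close> are such sums.\<close>

lemma smooth_family_up_to_sums:
  assumes "X \<Phi>"
    and P_add: "\<And>\<Phi> \<Psi>. P \<Phi> \<Longrightarrow> P \<Psi> \<Longrightarrow> P (\<lambda>j x. \<Phi> j x + \<Psi> j x)"
    and P: "\<And>\<Phi>. X \<Phi> \<Longrightarrow> P \<Phi>"
    and diff: "\<And>\<Phi> j x. X \<Phi> \<Longrightarrow> \<Phi> j differentiable (at x)"
    and step: "\<And>\<Phi> i. X \<Phi> \<Longrightarrow> i \<in> Basis \<Longrightarrow> sum_closure X (\<lambda>j. partial_deriv i (\<Phi> j))"
  shows "smooth_family P \<Phi>"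
proof -
  have *: "P \<Phi> \<and> (\<forall>j x. \<Phi> j differentiable (at x)) \<and>
      (\<forall>i\<in>Basis. sum_closure X (\<lambda>j. partial_deriv i (\<Phi> j)))" if "sum_closure X \<Phi>" for \<Phi>
    using that
  proof induction
    case (base \<Phi>)
    then show ?case using P diff step by blast
  next
    case (add \<Phi> \<Psi>)
    then show ?case
      using P_add by (auto simp: partial_deriv_add intro!: sum_closure.add)
  qed
  have "sum_closure X \<Phi>" using assms(1) by (rule sum_closure.base)
  then show ?thesis
    by (rule smooth_family_coinduct) (use * in auto)
qed

lemma smooth_family_add:
  assumes P_add: "\<And>\<Phi> \<Psi>. P \<Phi> \<Longrightarrow> P \<Psi> \<Longrightarrow> P (\<lambda>j x. \<Phi> j x + \<Psi> j x)"
    and "smooth_family P \<Phi>" "smooth_family P \<Psi>"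
  shows "smooth_family P (\<lambda>j x. \<Phi> j x + \<Psi> j x)"
proof (rule smooth_family_coinduct[where
      X = "\<lambda>\<Xi>. \<exists>\<Phi> \<Psi>. \<Xi> = (\<lambda>j x. \<Phi> j x + \<Psi> j x) \<and> smooth_family P \<Phi> \<and> smooth_family P \<Psi>"], goal_cases)
  case 1
  show ?case by (intro exI[of _ \<Phi>] exI[of _ \<Psi>] conjI refl assms)
next
  case (2 \<Xi>)
  then obtain \<Phi> \<Psi> where *: "\<Xi> = (\<lambda>j x. \<Phi> j x + \<Psi> j x)" "smooth_family P \<Phi>" "smooth_family P \<Psi>"
    by (elim exE conjE) (rule that)
  show ?case unfolding *(1) by (intro P_add smooth_familyD(1)[OF *(2)] smooth_familyD(1)[OF *(3)])
next
  case (3 \<Xi> j x)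
  then obtain \<Phi> \<Psi> where *: "\<Xi> = (\<lambda>j x. \<Phi> j x + \<Psi> j x)" "smooth_family P \<Phi>" "smooth_family P \<Psi>"
    by (elim exE conjE) (rule that)
  show ?case unfolding *(1) by (intro differentiable_add smooth_familyD(2)[OF *(2)] smooth_familyD(2)[OF *(3)])
next
  case (4 \<Xi> i)
  then obtain \<Phi> \<Psi> where *: "\<Xi> = (\<lambda>j x. \<Phi> j x + \<Psi> j x)" "smooth_family P \<Phi>" "smooth_family P \<Psi>"
    by (elim exE conjE) (rule that)
  show ?case
    unfolding *(1) partial_deriv_add[OF smooth_familyD(2)[OF *(2)] smooth_familyD(2)[OF *(3)]]
    by (intro exI[of _ "\<lambda>j. partial_deriv i (\<Phi> j)"] exI[of _ "\<lambda>j. partial_deriv i (\<Psi> j)"] conjI refl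
          smooth_familyD(3)[OF *(2)] smooth_familyD(3)[OF *(3)] \<open>i \<in> Basis\<close>)
qed

text \<open>The products themselves form a class to which coinduction up to sums applies.\<close>

lemma smooth_family_mult:
  fixes M \<Phi> :: "'j \<Rightarrow> 'a::euclidean_space \<Rightarrow> 'b::real_normed_algebra"
  assumes R_add: "\<And>\<Phi> \<Psi>. R \<Phi> \<Longrightarrow> R \<Psi> \<Longrightarrow> R (\<lambda>j x. \<Phi> j x + \<Psi> j x)"
    and R: "\<And>\<Phi> \<Psi>. P \<Phi> \<Longrightarrow> Q \<Psi> \<Longrightarrow> R (\<lambda>j x. \<Phi> j x * \<Psi> j x)"
    and "smooth_family P M" "smooth_family Q \<Phi>"
  shows "smooth_family R (\<lambda>j x. M j x * \<Phi> j x)"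
proof (rule smooth_family_up_to_sums[where
      X = "\<lambda>\<Xi>. \<exists>M \<Phi>. \<Xi> = (\<lambda>j x. M j x * \<Phi> j x) \<and> smooth_family P M \<and> smooth_family Q \<Phi>"], goal_cases)
  case 1
  show ?case by (intro exI[of _ M] exI[of _ \<Phi>] conjI refl assms)
next
  case 2 then show ?case by (rule R_add)
next
  case (3 \<Xi>)
  then obtain M \<Phi> where *: "\<Xi> = (\<lambda>j x. M j x * \<Phi> j x)" "smooth_family P M" "smooth_family Q \<Phi>"
    by (elim exE conjE) (rule that)
  show ?case unfolding *(1) by (intro R smooth_familyD(1)[OF *(2)] smooth_familyD(1)[OF *(3)])
next
  case (4 \<Xi> j x)
  then obtain M \<Phi> where *: "\<Xi> = (\<lambda>j x. M j x * \<Phi> j x)" "smooth_family P M" "smooth_family Q \<Phi>"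
    by (elim exE conjE) (rule that)
  show ?case unfolding *(1) by (intro differentiable_mult smooth_familyD(2)[OF *(2)] smooth_familyD(2)[OF *(3)])
next
  case (5 \<Xi> i)
  then obtain M \<Phi> where *: "\<Xi> = (\<lambda>j x. M j x * \<Phi> j x)" "smooth_family P M" "smooth_family Q \<Phi>"
    by (elim exE conjE) (rule that)
  show ?case
    unfolding *(1) partial_deriv_mult[OF smooth_familyD(2)[OF *(2)] smooth_familyD(2)[OF *(3)]]
  proof (intro sum_closure.add)
    show "sum_closure (\<lambda>\<Xi>. \<exists>M \<Phi>. \<Xi> = (\<lambda>j x. M j x * \<Phi> j x) \<and> smooth_family P M \<and> smooth_family Q \<Phi>)
        (\<lambda>j x. partial_deriv i (M j) x * \<Phi> j x)"
      by (intro sum_closure.base exI[of _ "\<lambda>j. partial_deriv i (M j)"] exI[of _ \<Phi>] conjI refl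
            smooth_familyD(3)[OF *(2)] *(3) \<open>i \<in> Basis\<close>)
    show "sum_closure (\<lambda>\<Xi>. \<exists>M \<Phi>. \<Xi> = (\<lambda>j x. M j x * \<Phi> j x) \<and> smooth_family P M \<and> smooth_family Q \<Phi>)
        (\<lambda>j x. M j x * partial_deriv i (\<Phi> j) x)"
      by (intro sum_closure.base exI[of _ M] exI[of _ "\<lambda>j. partial_deriv i (\<Phi> j)"] conjI refl
            smooth_familyD(3)[OF *(3)] *(2) \<open>i \<in> Basis\<close>)
  qed
qed

definition rapidly_decreasing :: "('j \<Rightarrow> 'a::real_normed_vector \<Rightarrow> 'b::real_normed_vector) \<Rightarrow> bool" where
  "rapidly_decreasing \<Phi> \<longleftrightarrow> (\<forall>N. \<exists>C. \<forall>j x. (1 + norm x) ^ N * norm (\<Phi> j x) \<le> C)"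

definition slowly_growing :: "('j \<Rightarrow> 'a::real_normed_vector \<Rightarrow> 'b::real_normed_vector) \<Rightarrow> bool" where
  "slowly_growing \<Phi> \<longleftrightarrow> (\<exists>N C. \<forall>j x. norm (\<Phi> j x) \<le> C * (1 + norm x) ^ N)"

abbreviation "schwartz_family \<equiv> smooth_family rapidly_decreasing"
abbreviation "slow_family \<equiv> smooth_family slowly_growing"

lemma rapidly_decreasing_add:
  assumes "rapidly_decreasing \<Phi>" "rapidly_decreasing \<Psi>"
  shows "rapidly_decreasing (\<lambda>j x. \<Phi> j x + \<Psi> j x)"
  unfolding rapidly_decreasing_def
proof
  fix N
  obtain C D where C: "\<And>j x. (1 + norm x) ^ N * norm (\<Phi> j x) \<le> C"
    and D: "\<And>j x. (1 + norm x) ^ N * norm (\<Psi> j x) \<le> D"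
    using assms unfolding rapidly_decreasing_def by metis
  have "(1 + norm x) ^ N * norm (\<Phi> j x + \<Psi> j x) \<le> C + D" for j x
  proof -
    have "(1 + norm x) ^ N * norm (\<Phi> j x + \<Psi> j x)
        \<le> (1 + norm x) ^ N * (norm (\<Phi> j x) + norm (\<Psi> j x))"
      by (intro mult_left_mono norm_triangle_ineq) auto
    then show ?thesis using C[of x j] D[of x j] by (simp add: distrib_left)
  qed
  then show "\<exists>C. \<forall>j x. (1 + norm x) ^ N * norm (\<Phi> j x + \<Psi> j x) \<le> C" by blast
qed

lemma slowly_growingE:
  assumes "slowly_growing \<Phi>"
  obtains C N where "C \<ge> 0" "\<And>j x. norm (\<Phi> j x) \<le> C * (1 + norm x) ^ N"
proof -
  obtain N C where *: "\<And>j x. norm (\<Phi> j x) \<le> C * (1 + norm x) ^ N"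
    using assms unfolding slowly_growing_def by blast
  have "norm (\<Phi> j x) \<le> \<bar>C\<bar> * (1 + norm x) ^ N" for j x
    by (rule order_trans[OF *]) (intro mult_right_mono, auto)
  then show ?thesis using that[of "\<bar>C\<bar>" N] by simp
qed

lemma slowly_growing_add:
  assumes "slowly_growing \<Phi>" "slowly_growing \<Psi>"
  shows "slowly_growing (\<lambda>j x. \<Phi> j x + \<Psi> j x)"
proof -
  obtain C N where C: "C \<ge> 0" "\<And>j x. norm (\<Phi> j x) \<le> C * (1 + norm x) ^ N"
    by (rule slowly_growingE[OF assms(1)]) (rule that, auto)
  obtain D M where D: "D \<ge> 0" "\<And>j x. norm (\<Psi> j x) \<le> D * (1 + norm x) ^ M"
    by (rule slowly_growingE[OF assms(2)]) (rule that, auto)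
  have "norm (\<Phi> j x + \<Psi> j x) \<le> (C + D) * (1 + norm x) ^ (N + M)" for j x
  proof -
    have "(1 + norm x) ^ N \<le> (1 + norm x) ^ (N + M)" "(1 + norm x) ^ M \<le> (1 + norm x) ^ (N + M)"
      by (auto intro: power_increasing)
    then have "C * (1 + norm x) ^ N \<le> C * (1 + norm x) ^ (N + M)"
      "D * (1 + norm x) ^ M \<le> D * (1 + norm x) ^ (N + M)"
      using C(1) D(1) by (auto intro: mult_left_mono)
    then show ?thesis
      using norm_triangle_ineq[of "\<Phi> j x" "\<Psi> j x"] C(2)[of j x] D(2)[of j x]
      by (simp add: distrib_right)
  qed
  then show ?thesis unfolding slowly_growing_def by blast
qed

lemma slowly_growing_mult:
  fixes \<Phi> \<Psi> :: "'j \<Rightarrow> 'a::real_normed_vector \<Rightarrow> 'b::real_normed_algebra"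
  assumes "slowly_growing \<Phi>" "slowly_growing \<Psi>"
  shows "slowly_growing (\<lambda>j x. \<Phi> j x * \<Psi> j x)"
proof -
  obtain C N where C: "C \<ge> 0" "\<And>j x. norm (\<Phi> j x) \<le> C * (1 + norm x) ^ N"
    by (rule slowly_growingE[OF assms(1)]) (rule that, auto)
  obtain D M where D: "D \<ge> 0" "\<And>j x. norm (\<Psi> j x) \<le> D * (1 + norm x) ^ M"
    by (rule slowly_growingE[OF assms(2)]) (rule that, auto)
  have "norm (\<Phi> j x * \<Psi> j x) \<le> (C * D) * (1 + norm x) ^ (N + M)" for j x
  proof -
    have "norm (\<Phi> j x * \<Psi> j x) \<le> (C * (1 + norm x) ^ N) * (D * (1 + norm x) ^ M)"
      using C D by (intro order_trans[OF norm_mult_ineq] mult_mono) auto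
    then show ?thesis by (simp add: power_add mult_ac)
  qed
  then show ?thesis unfolding slowly_growing_def by blast
qed

lemma slow_mult_rapid:
  fixes \<Phi> \<Psi> :: "'j \<Rightarrow> 'a::real_normed_vector \<Rightarrow> 'b::real_normed_algebra"
  assumes "slowly_growing \<Phi>" "rapidly_decreasing \<Psi>"
  shows "rapidly_decreasing (\<lambda>j x. \<Phi> j x * \<Psi> j x)"
  unfolding rapidly_decreasing_def
proof
  fix N
  obtain C M where C: "C \<ge> 0" "\<And>j x. norm (\<Phi> j x) \<le> C * (1 + norm x) ^ M"
    by (rule slowly_growingE[OF assms(1)]) (rule that, auto)
  obtain D where D: "\<And>j x. (1 + norm x) ^ (N + M) * norm (\<Psi> j x) \<le> D"
    using assms(2) unfolding rapidly_decreasing_def by metis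
  have "(1 + norm x) ^ N * norm (\<Phi> j x * \<Psi> j x) \<le> C * D" for j x
  proof -
    have "(1 + norm x) ^ N * norm (\<Phi> j x * \<Psi> j x)
        \<le> (1 + norm x) ^ N * ((C * (1 + norm x) ^ M) * norm (\<Psi> j x))"
      using C by (intro mult_left_mono order_trans[OF norm_mult_ineq] mult_right_mono) auto
    also have "\<dots> = C * ((1 + norm x) ^ (N + M) * norm (\<Psi> j x))"
      by (simp add: power_add mult_ac)
    also have "\<dots> \<le> C * D" using C(1) D by (intro mult_left_mono) auto
    finally show ?thesis .
  qed
  then show "\<exists>C. \<forall>j x. (1 + norm x) ^ N * norm (\<Phi> j x * \<Psi> j x) \<le> C" by blast
qed

lemma schwartz_family_add:
  "schwartz_family \<Phi> \<Longrightarrow> schwartz_family \<Psi> \<Longrightarrow> schwartz_family (\<lambda>j x. \<Phi> j x + \<Psi> j x)"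
  by (rule smooth_family_add) (auto intro: rapidly_decreasing_add)

lemma slow_family_add:
  "slow_family \<Phi> \<Longrightarrow> slow_family \<Psi> \<Longrightarrow> slow_family (\<lambda>j x. \<Phi> j x + \<Psi> j x)"
  by (rule smooth_family_add) (auto intro: slowly_growing_add)

lemma slow_family_mult:
  fixes \<Phi> \<Psi> :: "'j \<Rightarrow> 'a::euclidean_space \<Rightarrow> 'b::real_normed_algebra"
  shows "slow_family \<Phi> \<Longrightarrow> slow_family \<Psi> \<Longrightarrow> slow_family (\<lambda>j x. \<Phi> j x * \<Psi> j x)"
  by (rule smooth_family_mult) (auto intro: slowly_growing_add slowly_growing_mult)

lemma slow_mult_schwartz_family:
  fixes \<Phi> \<Psi> :: "'j \<Rightarrow> 'a::euclidean_space \<Rightarrow> 'b::real_normed_algebra"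
  shows "slow_family \<Phi> \<Longrightarrow> schwartz_family \<Psi> \<Longrightarrow> schwartz_family (\<lambda>j x. \<Phi> j x * \<Psi> j x)"
  by (rule smooth_family_mult) (auto intro: rapidly_decreasing_add slow_mult_rapid)

lemma smooth_family_reindex:
  assumes "smooth_family P \<Phi>" "\<And>\<Psi>. P \<Psi> \<Longrightarrow> Q (\<lambda>j. \<Psi> (h j))"
  shows "smooth_family Q (\<lambda>j. \<Phi> (h j))"
  using assms unfolding smooth_family_iff by blast

lemma schwartz_family_reindex: "schwartz_family \<Phi> \<Longrightarrow> schwartz_family (\<lambda>j. \<Phi> (h j))"
  by (erule smooth_family_reindex) (unfold rapidly_decreasing_def, metis)

lemma schwartz_iff: "\<phi> \<in> schwartz \<longleftrightarrow> schwartz_family (\<lambda>_::unit. \<phi>)"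
proof -
  have "(\<exists>C. \<forall>x. (1 + norm x) ^ N * norm (f x) \<le> C) \<longleftrightarrow>
      bounded (range (\<lambda>x. (1 + norm x) ^ N *\<^sub>R f x))" for f :: "'a \<Rightarrow> complex" and N
    by (auto simp: bounded_iff)
  then show ?thesis
    unfolding schwartz_def smooth_def smooth_family_iff rapidly_decreasing_def by auto
qed

lemma schwartz_family_schwartz: "schwartz_family \<Phi> \<Longrightarrow> \<Phi> j \<in> schwartz"
  unfolding schwartz_iff by (rule schwartz_family_reindex)

lemma schwartz_constant_family: "\<phi> \<in> schwartz \<Longrightarrow> schwartz_family (\<lambda>_. \<phi>)"
  unfolding schwartz_iff by (rule schwartz_family_reindex)

lemma slow_family_const:
  assumes "\<And>j. norm (c j) \<le> B"
  shows "slow_family (\<lambda>j x. c j)"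
proof (rule smooth_family_up_to_sums[where
      X = "\<lambda>\<Xi>. \<exists>c B. \<Xi> = (\<lambda>j x. c j) \<and> (\<forall>j. norm (c j) \<le> B)"], goal_cases)
  case 1
  then show ?case using assms by blast
next
  case 2 then show ?case by (rule slowly_growing_add)
next
  case (3 \<Xi>)
  then obtain c B where "\<Xi> = (\<lambda>j x. c j)" "\<forall>j. norm (c j) \<le> B" by blast
  then show ?case unfolding slowly_growing_def by (intro exI[of _ 0] exI[of _ B]) auto
next
  case (4 \<Xi> j x)
  then show ?case by auto
next
  case (5 \<Xi> i)
  then obtain c where "\<Xi> = (\<lambda>j x. c j)" by auto
  have "(\<lambda>j. partial_deriv i (\<Xi> j)) = (\<lambda>j x. 0)"
    unfolding \<open>\<Xi> = (\<lambda>j x. c j)\<close> by (intro ext) (rule partial_deriv_eq[OF has_derivative_const])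
  then show ?case by (intro sum_closure.base exI[of _ "\<lambda>_. 0"] exI[of _ 0]) auto
qed

lemma partial_deriv_bounded_linear:
  assumes "bounded_linear L" "\<And>x. f differentiable (at x)"
  shows "partial_deriv i (\<lambda>x. L (f x)) = (\<lambda>x. L (partial_deriv i f x))"
  unfolding partial_deriv_def[of i f]
  using assms by (intro ext partial_deriv_eq bounded_linear.has_derivative[OF assms(1)])
    (auto simp: frechet_derivative_works)

lemma differentiable_bounded_linear:
  "bounded_linear L \<Longrightarrow> f differentiable (at x) \<Longrightarrow> (\<lambda>x. L (f x)) differentiable (at x)"
  unfolding differentiable_def using bounded_linear.has_derivative by blast

lemma slow_family_of_real:
  fixes \<Phi> :: "'j \<Rightarrow> 'a::euclidean_space \<Rightarrow> real"
  assumes "slow_family \<Phi>"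
  shows "slow_family (\<lambda>j x. complex_of_real (\<Phi> j x))"
proof (rule smooth_family_coinduct[where
      X = "\<lambda>\<Xi>. \<exists>\<Phi>. \<Xi> = (\<lambda>j x. complex_of_real (\<Phi> j x)) \<and> slow_family \<Phi>"], goal_cases)
  case 1
  show ?case by (intro exI[of _ \<Phi>] conjI refl assms)
next
  case (2 \<Xi>)
  then obtain \<Phi> where *: "\<Xi> = (\<lambda>j x. complex_of_real (\<Phi> j x))" "slow_family \<Phi>"
    by (elim exE conjE) (rule that)
  have "slowly_growing \<Phi>" by (rule smooth_familyD(1)[OF *(2)])
  then show ?case unfolding *(1) slowly_growing_def by (simp only: norm_of_real real_norm_def)
next
  case (3 \<Xi> j x)
  then obtain \<Phi> where *: "\<Xi> = (\<lambda>j x. complex_of_real (\<Phi> j x))" "slow_family \<Phi>"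
    by (elim exE conjE) (rule that)
  show ?case
    unfolding *(1)
    by (rule differentiable_bounded_linear[OF bounded_linear_of_real smooth_familyD(2)[OF *(2)]])
next
  case (4 \<Xi> i)
  then obtain \<Phi> where *: "\<Xi> = (\<lambda>j x. complex_of_real (\<Phi> j x))" "slow_family \<Phi>"
    by (elim exE conjE) (rule that)
  show ?case
    unfolding *(1) partial_deriv_bounded_linear[OF bounded_linear_of_real smooth_familyD(2)[OF *(2)]]
    by (intro exI[of _ "\<lambda>j. partial_deriv i (\<Phi> j)"] conjI refl smooth_familyD(3)[OF *(2)] \<open>i \<in> Basis\<close>)
qed

lemma slow_family_inner:
  fixes v :: "'a::euclidean_space"
  shows "slow_family (\<lambda>_ x. x \<bullet> v)"
proof -
  have "slowly_growing (\<lambda>(_::'j) x. x \<bullet> v)"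
    unfolding slowly_growing_def
  proof (intro exI allI)
    fix x :: 'a
    have "\<bar>x \<bullet> v\<bar> \<le> norm x * norm v" by (rule Cauchy_Schwarz_ineq2)
    also have "\<dots> \<le> norm v * (1 + norm x) ^ 1" by (simp add: algebra_simps)
    finally show "norm (x \<bullet> v) \<le> norm v * (1 + norm x) ^ 1" by simp
  qed
  moreover have "partial_deriv i (\<lambda>x. x \<bullet> v) = (\<lambda>x. i \<bullet> v)" for i
    by (auto intro!: partial_deriv_eq derivative_eq_intros)
  moreover have "(\<lambda>x. x \<bullet> v) differentiable (at x)" for x :: 'a
    by (intro bounded_linear_imp_differentiable bounded_linear_inner_left)
  moreover have "slow_family (\<lambda>(_::'j) (x::'a). i \<bullet> v)" for i :: 'a
    by (rule slow_family_const[OF order_refl])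
  ultimately show ?thesis
    by (intro smooth_family.intros[of slowly_growing "\<lambda>_ x. x \<bullet> v"]) simp_all
qed

lemma partial_deriv_scaled:
  assumes "\<And>x. f differentiable (at x)"
  shows "partial_deriv i (\<lambda>x. f (c *\<^sub>R x)) = (\<lambda>x. c *\<^sub>R partial_deriv i f (c *\<^sub>R x))"
proof
  fix x
  have f: "(f has_derivative frechet_derivative f (at (c *\<^sub>R x))) (at (c *\<^sub>R x))"
    using assms by (simp add: frechet_derivative_works)
  have "((\<lambda>x. f (c *\<^sub>R x)) has_derivative (\<lambda>h. frechet_derivative f (at (c *\<^sub>R x)) (c *\<^sub>R h))) (at x)"
    by (rule has_derivative_compose[where f = "\<lambda>x. c *\<^sub>R x", OF _ f]) (auto intro!: derivative_eq_intros)
  then show "partial_deriv i (\<lambda>x. f (c *\<^sub>R x)) x = c *\<^sub>R partial_deriv i f (c *\<^sub>R x)"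
    by (subst partial_deriv_eq)
       (auto simp: partial_deriv_def linear_simps(5)[OF has_derivative_bounded_linear[OF f]])
qed

lemma differentiable_scaled:
  assumes "\<And>x. f differentiable (at x)"
  shows "(\<lambda>x. f (c *\<^sub>R x)) differentiable (at x)"
proof -
  have f: "(f has_derivative frechet_derivative f (at (c *\<^sub>R x))) (at (c *\<^sub>R x))"
    using assms by (simp add: frechet_derivative_works)
  have "((\<lambda>x. f (c *\<^sub>R x)) has_derivative (\<lambda>h. frechet_derivative f (at (c *\<^sub>R x)) (c *\<^sub>R h))) (at x)"
    by (rule has_derivative_compose[where f = "\<lambda>x. c *\<^sub>R x", OF _ f]) (auto intro!: derivative_eq_intros)
  then show ?thesis unfolding differentiable_def by blast
qed

lemma differentiable_const_scaled:
  assumes "\<And>x. f differentiable (at x)"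
  shows "(\<lambda>x. b *\<^sub>R f (c *\<^sub>R x)) differentiable (at x)"
  using differentiable_bounded_linear[OF bounded_linear_scaleR_right differentiable_scaled[OF assms]] .

lemma partial_deriv_const_scaled:
  assumes "\<And>x. f differentiable (at x)"
  shows "partial_deriv i (\<lambda>x. b *\<^sub>R f (c *\<^sub>R x)) = (\<lambda>x. (b * c) *\<^sub>R partial_deriv i f (c *\<^sub>R x))"
  by (subst partial_deriv_bounded_linear[OF bounded_linear_scaleR_right differentiable_scaled[OF assms]])
     (simp add: partial_deriv_scaled[OF assms])

lemma smooth_family_scaled:
  assumes P: "\<And>\<Psi> b. P \<Psi> \<Longrightarrow> P (\<lambda>j x. b *\<^sub>R \<Psi> j (c *\<^sub>R x))" and "smooth_family P \<Phi>"
  shows "smooth_family P (\<lambda>j x. \<Phi> j (c *\<^sub>R x))"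
proof (rule smooth_family_coinduct[where
      X = "\<lambda>\<Xi>. \<exists>b \<Phi>. \<Xi> = (\<lambda>j x. b *\<^sub>R \<Phi> j (c *\<^sub>R x)) \<and> smooth_family P \<Phi>"], goal_cases)
  case 1
  show ?case by (intro exI[of _ 1] exI[of _ \<Phi>] conjI assms) simp
next
  case (2 \<Xi>)
  then obtain b \<Phi> where *: "\<Xi> = (\<lambda>j x. b *\<^sub>R \<Phi> j (c *\<^sub>R x))" "smooth_family P \<Phi>"
    by (elim exE conjE) (rule that)
  show ?case unfolding *(1) by (intro P smooth_familyD(1)[OF *(2)])
next
  case (3 \<Xi> j x)
  then obtain b \<Phi> where *: "\<Xi> = (\<lambda>j x. b *\<^sub>R \<Phi> j (c *\<^sub>R x))" "smooth_family P \<Phi>"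
    by (elim exE conjE) (rule that)
  show ?case unfolding *(1) by (intro differentiable_const_scaled smooth_familyD(2)[OF *(2)])
next
  case (4 \<Xi> i)
  then obtain b \<Phi> where *: "\<Xi> = (\<lambda>j x. b *\<^sub>R \<Phi> j (c *\<^sub>R x))" "smooth_family P \<Phi>"
    by (elim exE conjE) (rule that)
  show ?case
    unfolding *(1) partial_deriv_const_scaled[OF smooth_familyD(2)[OF *(2)]]
    by (intro exI[of _ "b * c"] exI[of _ "\<lambda>j. partial_deriv i (\<Phi> j)"] conjI refl
        smooth_familyD(3)[OF *(2)] \<open>i \<in> Basis\<close>)
qed

lemma slow_family_scaled:
  assumes "slow_family \<Phi>" shows "slow_family (\<lambda>j x. \<Phi> j (c *\<^sub>R x))"
proof (rule smooth_family_scaled[OF _ assms])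
  fix \<Psi> :: "'a \<Rightarrow> 'b \<Rightarrow> 'c" and b :: real
  assume "slowly_growing \<Psi>"
  then obtain C N where C: "C \<ge> 0" "\<And>j x. norm (\<Psi> j x) \<le> C * (1 + norm x) ^ N"
    by (rule slowly_growingE) (rule that, auto)
  have "norm (b *\<^sub>R \<Psi> j (c *\<^sub>R x)) \<le> (\<bar>b\<bar> * C * (1 + \<bar>c\<bar>) ^ N) * (1 + norm x) ^ N" for j x
  proof -
    have "1 + norm (c *\<^sub>R x) \<le> (1 + \<bar>c\<bar>) * (1 + norm x)" by (simp add: algebra_simps)
    then have "(1 + norm (c *\<^sub>R x)) ^ N \<le> ((1 + \<bar>c\<bar>) * (1 + norm x)) ^ N"
      by (intro power_mono) auto
    then have "\<bar>b\<bar> * (C * (1 + norm (c *\<^sub>R x)) ^ N) \<le> \<bar>b\<bar> * (C * ((1 + \<bar>c\<bar>) * (1 + norm x)) ^ N)"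
      using C(1) by (intro mult_left_mono) auto
    moreover have "norm (b *\<^sub>R \<Psi> j (c *\<^sub>R x)) \<le> \<bar>b\<bar> * (C * (1 + norm (c *\<^sub>R x)) ^ N)"
      using C(2)[of j "c *\<^sub>R x"] by (simp add: mult_left_mono)
    ultimately show ?thesis by (simp add: power_mult_distrib mult_ac)
  qed
  then show "slowly_growing (\<lambda>j x. b *\<^sub>R \<Psi> j (c *\<^sub>R x))" unfolding slowly_growing_def by blast
qed

lemma schwartz_reflect:
  assumes "\<phi> \<in> schwartz" shows "(\<lambda>x. \<phi> (- x)) \<in> schwartz"
proof -
  have "schwartz_family (\<lambda>(_::unit) x. \<phi> ((-1) *\<^sub>R x))"
  proof (rule smooth_family_scaled)
    fix \<Psi> :: "unit \<Rightarrow> 'a \<Rightarrow> complex" and b :: real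
    assume P: "rapidly_decreasing \<Psi>"
    show "rapidly_decreasing (\<lambda>j x. b *\<^sub>R \<Psi> j ((-1) *\<^sub>R x))"
      unfolding rapidly_decreasing_def
    proof
      fix N
      obtain C where "\<And>j x. (1 + norm x) ^ N * norm (\<Psi> j x) \<le> C"
        using P unfolding rapidly_decreasing_def by blast
      from this[of "- _"] have "\<bar>b\<bar> * ((1 + norm x) ^ N * norm (\<Psi> j (- x))) \<le> \<bar>b\<bar> * C" for j x
        by (intro mult_left_mono) auto
      then show "\<exists>C. \<forall>j x. (1 + norm x) ^ N * norm (b *\<^sub>R \<Psi> j ((-1) *\<^sub>R x)) \<le> C"
        by (auto simp: mult_ac)
    qed
  qed (use assms in \<open>simp add: schwartz_iff\<close>)
  then show ?thesis by (simp add: schwartz_iff)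
qed

section \<open>Smooth symbols of slow growth\<close>

lemma bessel_symbol_bounds:
  fixes x :: "'a::real_inner"
  shows "0 \<le> inverse (1 + x \<bullet> x)" "inverse (1 + x \<bullet> x) \<le> 1"
  by (auto simp: inverse_le_1_iff)

lemma bessel_power_has_derivative:
  fixes x :: "'a::euclidean_space"
  shows "((\<lambda>x. inverse (1 + x \<bullet> x) ^ k) has_derivative
     (\<lambda>h. inverse (1 + x \<bullet> x) ^ Suc k * (- 2 * real k * (x \<bullet> h)))) (at x)"
proof -
  have pos: "1 + x \<bullet> x \<noteq> 0" using inner_ge_zero[of x] by linarith
  have "((\<lambda>x. inverse (1 + x \<bullet> x) ^ k) has_derivative
     (\<lambda>h. of_nat k * (- (inverse (1 + x \<bullet> x) * (x \<bullet> h + h \<bullet> x) * inverse (1 + x \<bullet> x))) * inverse (1 + x \<bullet> x) ^ (k - 1)))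
     (at x)"
    by (auto intro!: derivative_eq_intros simp: pos algebra_simps)
  moreover have "of_nat k * (- (inverse (1 + x \<bullet> x) * (x \<bullet> h + h \<bullet> x) * inverse (1 + x \<bullet> x))) * inverse (1 + x \<bullet> x) ^ (k - 1)
      = inverse (1 + x \<bullet> x) ^ Suc k * (- 2 * real k * (x \<bullet> h))" for h
    by (cases k) (auto simp: inner_commute algebra_simps)
  ultimately show ?thesis by (simp only:)
qed

text \<open>With \<open>p = 1 / (1 + |x|\<^sup>2)\<close> one has \<open>\<partial>\<^sub>i p\<^sup>k = - 2 k x\<^sub>i p\<^bsup>k+1\<^esup>\<close>, so the products \<open>p\<^sup>k h\<close> with \<open>h\<close> of slow
  growth are closed under partial derivatives up to sums.\<close>

lemma slow_bessel_symbol: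
  "slow_family (\<lambda>_ x. inverse (1 + x \<bullet> x) :: real)" (is "slow_family ?p")
proof (rule smooth_family_up_to_sums[where
      X = "\<lambda>\<Xi>. \<exists>k h. \<Xi> = (\<lambda>j x. inverse (1 + x \<bullet> x) ^ k * h j x) \<and> slow_family h"], goal_cases)
  case 1
  show ?case
    by (intro exI[of _ 1] exI[of _ "\<lambda>_ _. 1"] conjI slow_family_const[where B = 1]) simp_all
next
  case 2 then show ?case by (rule slowly_growing_add)
next
  case (3 \<Xi>)
  then obtain k h where *: "\<Xi> = (\<lambda>j x. inverse (1 + x \<bullet> x) ^ k * h j x)" "slow_family h"
    by (elim exE conjE) (rule that)
  obtain C N where C: "C \<ge> 0" "\<And>j x. norm (h j x) \<le> C * (1 + norm x) ^ N"
    by (rule slowly_growingE[OF smooth_familyD(1)[OF *(2)]]) (rule that, auto)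
  have "norm (inverse (1 + x \<bullet> x) ^ k * h j x) \<le> C * (1 + norm x) ^ N" for j x
  proof -
    have "norm (inverse (1 + x \<bullet> x) ^ k * h j x) = inverse (1 + x \<bullet> x) ^ k * norm (h j x)"
      by (simp add: abs_mult)
    also have "\<dots> \<le> 1 * norm (h j x)"
      using bessel_symbol_bounds[of x] by (intro mult_right_mono power_le_one) auto
    finally show ?thesis using C(2)[of j x] by simp
  qed
  then show ?case unfolding *(1) slowly_growing_def by blast
next
  case (4 \<Xi> j x)
  then obtain k h where *: "\<Xi> = (\<lambda>j x. inverse (1 + x \<bullet> x) ^ k * h j x)" "slow_family h"
    by (elim exE conjE) (rule that)
  show ?case unfolding *(1)
    by (intro differentiable_mult differentiableI[OF bessel_power_has_derivative] smooth_familyD(2)[OF *(2)])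
next
  case (5 \<Xi> i)
  then obtain k h where *: "\<Xi> = (\<lambda>j x. inverse (1 + x \<bullet> x) ^ k * h j x)" "slow_family h"
    by (elim exE conjE) (rule that)
  define g where "g = (\<lambda>j x. - 2 * real k * (x \<bullet> i) * h j x)"
  have 1: "partial_deriv i (\<lambda>x. inverse (1 + x \<bullet> x) ^ k) = (\<lambda>x. inverse (1 + x \<bullet> x) ^ Suc k * (- 2 * real k * (x \<bullet> i)))"
    by (intro ext partial_deriv_eq[OF bessel_power_has_derivative])
  have "slow_family (\<lambda>j x. ((\<lambda>_. - 2 * real k) x * (x \<bullet> i)) * h j x)"
    by (intro slow_family_mult[OF slow_family_mult[OF slow_family_const slow_family_inner] *(2)])
       (rule order_refl)
  then have g: "slow_family g" by (simp add: g_def)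
  have eq: "(\<lambda>j. partial_deriv i (\<Xi> j)) =
      (\<lambda>j x. inverse (1 + x \<bullet> x) ^ Suc k * g j x + inverse (1 + x \<bullet> x) ^ k * partial_deriv i (h j) x)"
    unfolding *(1)
      partial_deriv_mult[OF differentiableI[OF bessel_power_has_derivative] smooth_familyD(2)[OF *(2)]]
      1 g_def by (simp add: mult.assoc)
  show ?case unfolding eq
  proof (rule sum_closure.add; rule sum_closure.base)
    show "\<exists>k' h. (\<lambda>j x. inverse (1 + x \<bullet> x) ^ Suc k * g j x) = (\<lambda>j x. inverse (1 + x \<bullet> x) ^ k' * h j x) \<and> slow_family h"
      by (intro exI[of _ "Suc k"] exI[of _ g] conjI refl g)
    show "\<exists>k' h'. (\<lambda>j x. inverse (1 + x \<bullet> x) ^ k * partial_deriv i (h j) x) = (\<lambda>j x. inverse (1 + x \<bullet> x) ^ k' * h' j x) \<and> slow_family h'"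
      by (intro exI[of _ k] exI[of _ "\<lambda>j. partial_deriv i (h j)"] conjI refl smooth_familyD(3)[OF *(2)] \<open>i \<in> Basis\<close>)
  qed
qed

definition bounded_holomorphic :: "real \<Rightarrow> ('j \<Rightarrow> complex \<Rightarrow> complex) \<Rightarrow> bool" where
  "bounded_holomorphic R f \<longleftrightarrow>
     (\<forall>j. f j holomorphic_on ball 0 R) \<and> (\<exists>B. \<forall>j. \<forall>z\<in>ball 0 R. norm (f j z) \<le> B)"

text \<open>Cauchy's estimate on discs of radius \<open>(R - R') / 2\<close>.\<close>

lemma bounded_holomorphic_deriv:
  assumes "bounded_holomorphic R f" "R' < R"
  shows "bounded_holomorphic R' (\<lambda>j. deriv (f j))"
proof -
  obtain B where B: "\<And>j z. z \<in> ball 0 R \<Longrightarrow> norm (f j z) \<le> B" and hol: "\<And>j. f j holomorphic_on ball 0 R"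
    using assms(1) unfolding bounded_holomorphic_def by blast
  define r where "r = (R - R') / 2"
  have r: "r > 0" using assms(2) by (simp add: r_def)
  have "norm (deriv (f j) z) \<le> B / r" if z: "z \<in> ball 0 R'" for j z
  proof -
    have sub: "cball z r \<subseteq> ball 0 R"
    proof
      fix w assume "w \<in> cball z r"
      then have "norm (w - z) \<le> r" by (simp add: dist_norm norm_minus_commute)
      moreover have "norm w \<le> norm (w - z) + norm z" by (metis diff_add_cancel norm_triangle_ineq)
      ultimately show "w \<in> ball 0 R" using z r unfolding r_def by (simp add: field_simps)
    qed
    have "norm ((deriv ^^ 1) (f j) z) \<le> fact 1 * B / r ^ 1"
    proof (rule Cauchy_inequality[OF _ _ r])
      show "f j holomorphic_on ball z r"
        using sub ball_subset_cball by (intro holomorphic_on_subset[OF hol]) blast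
      show "continuous_on (cball z r) (f j)"
        by (intro holomorphic_on_imp_continuous_on holomorphic_on_subset[OF hol] sub)
      fix x assume "norm (z - x) = r"
      then have "x \<in> cball z r" by (simp add: dist_norm)
      then show "norm (f j x) \<le> B" using sub B by blast
    qed
    then show ?thesis by simp
  qed
  moreover have "deriv (f j) holomorphic_on ball 0 R'" for j
    using assms(2) by (intro holomorphic_deriv holomorphic_on_subset[OF hol]) auto
  ultimately show ?thesis unfolding bounded_holomorphic_def by blast
qed

text \<open>The functional calculus behind the flow. The derivative of \<open>f\<^sub>j(\<mu>) h\<close> is
  \<open>f\<^sub>j'(\<mu>) (\<partial>\<mu> h) + f\<^sub>j(\<mu>) \<partial>h\<close>, and the \<open>f\<^sub>j'\<close> are again uniformly bounded on a slightly smaller disc,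
  which still contains \<open>[-1, 1]\<close>. Hence one bound for the \<open>f\<^sub>j\<close> on a complex disc controls all
  derivatives of the composed functions at once.\<close>

lemma slow_family_holomorphic:
  fixes \<mu> :: "'a::euclidean_space \<Rightarrow> real"
  assumes \<mu>: "slow_family (\<lambda>_::'j. \<mu>)" "\<And>x. \<bar>\<mu> x\<bar> \<le> 1"
    and f: "bounded_holomorphic R f" "R > 1"
  shows "slow_family (\<lambda>(j::'j) x. f j (of_real (\<mu> x)))"
proof -
  have in_ball: "complex_of_real (\<mu> x) \<in> ball 0 R" if "R > 1" for x R
    using \<mu>(2)[of x] that by simp
  have deriv: "((\<lambda>x. f j (of_real (\<mu> x))) has_derivative
      (\<lambda>h. deriv (f j) (of_real (\<mu> x)) * of_real (frechet_derivative \<mu> (at x) h))) (at x)"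
    if "bounded_holomorphic R f" "R > 1" for f :: "'j \<Rightarrow> complex \<Rightarrow> complex" and R j x
  proof -
    have "(f j has_field_derivative deriv (f j) (of_real (\<mu> x))) (at (of_real (\<mu> x)))"
      using that in_ball by (intro holomorphic_derivI[of _ "ball 0 R"]) (auto simp: bounded_holomorphic_def)
    moreover have "((\<lambda>x. complex_of_real (\<mu> x)) has_derivative
        (\<lambda>h. of_real (frechet_derivative \<mu> (at x) h))) (at x)"
      using smooth_familyD(2)[OF \<mu>(1)]
      by (intro bounded_linear.has_derivative[OF bounded_linear_of_real]) (simp add: frechet_derivative_works)
    ultimately show ?thesis
      using has_derivative_compose[of "\<lambda>x. complex_of_real (\<mu> x)" _ x UNIV "f j"]
      unfolding has_field_derivative_def by blast
  qed
  let ?X = "\<lambda>\<Xi>. \<exists>R f h. \<Xi> = (\<lambda>j x. f j (of_real (\<mu> x)) * h j x) \<and> R > 1 \<and> bounded_holomorphic R f \<and> slow_family h"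
  show ?thesis
  proof (rule smooth_family_up_to_sums[where X = ?X], goal_cases)
    case 1
    show ?case
      by (intro exI[of _ R] exI[of _ f] exI[of _ "\<lambda>_ _. 1"] conjI f slow_family_const[where B = 1]) simp_all
  next
    case 2 then show ?case by (rule slowly_growing_add)
  next
    case (3 \<Xi>)
    then obtain R f h where *: "\<Xi> = (\<lambda>j x. f j (of_real (\<mu> x)) * h j x)" "R > 1" "bounded_holomorphic R f" "slow_family h"
      by (elim exE conjE) (rule that)
    obtain B where B: "\<And>j z. z \<in> ball 0 R \<Longrightarrow> norm (f j z) \<le> B"
      using *(3) unfolding bounded_holomorphic_def by blast
    have "slowly_growing (\<lambda>j x. f j (of_real (\<mu> x)))"
      unfolding slowly_growing_def using B[OF in_ball[OF *(2)]] by (intro exI[of _ 0] exI[of _ B]) simp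
    then show ?case unfolding *(1) by (intro slowly_growing_mult smooth_familyD(1)[OF *(4)])
  next
    case (4 \<Xi> j x)
    then obtain R f h where *: "\<Xi> = (\<lambda>j x. f j (of_real (\<mu> x)) * h j x)" "R > 1" "bounded_holomorphic R f" "slow_family h"
      by (elim exE conjE) (rule that)
    show ?case unfolding *(1)
      by (intro differentiable_mult differentiableI[OF deriv[OF *(3,2)]] smooth_familyD(2)[OF *(4)])
  next
    case (5 \<Xi> i)
    then obtain R f h where *: "\<Xi> = (\<lambda>j x. f j (of_real (\<mu> x)) * h j x)" "R > 1" "bounded_holomorphic R f" "slow_family h"
      by (elim exE conjE) (rule that)
    define g where "g = (\<lambda>j x. complex_of_real (partial_deriv i \<mu> x) * h j x)"
    have g: "slow_family g"
      unfolding g_def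
      by (intro slow_family_mult[OF slow_family_of_real[OF smooth_familyD(3)[OF \<mu>(1)]] *(4)] \<open>i \<in> Basis\<close>)
    have 1: "partial_deriv i (\<lambda>x. f j (of_real (\<mu> x))) =
        (\<lambda>x. deriv (f j) (of_real (\<mu> x)) * of_real (partial_deriv i \<mu> x))" for j
      using partial_deriv_eq[OF deriv[OF *(3,2)]] by (auto simp: partial_deriv_def[of i \<mu>])
    have eq: "(\<lambda>j. partial_deriv i (\<Xi> j)) =
        (\<lambda>j x. deriv (f j) (of_real (\<mu> x)) * g j x + f j (of_real (\<mu> x)) * partial_deriv i (h j) x)"
      unfolding *(1)
        partial_deriv_mult[OF differentiableI[OF deriv[OF *(3,2)]] smooth_familyD(2)[OF *(4)]]
        1 g_def by (simp add: mult.assoc)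
    have R': "(1 + R) / 2 < R" "1 < (1 + R) / 2" using *(2) by auto
    show ?case unfolding eq
    proof (rule sum_closure.add; rule sum_closure.base)
      show "?X (\<lambda>j x. deriv (f j) (of_real (\<mu> x)) * g j x)"
        by (intro exI[of _ "(1 + R) / 2"] exI[of _ "\<lambda>j. deriv (f j)"] exI[of _ g] conjI refl g R'
             bounded_holomorphic_deriv[OF *(3) R'(1)])
      show "?X (\<lambda>j x. f j (of_real (\<mu> x)) * partial_deriv i (h j) x)"
        by (intro exI[of _ R] exI[of _ f] exI[of _ "\<lambda>j. partial_deriv i (h j)"] conjI refl *
             smooth_familyD(3)[OF *(4)] \<open>i \<in> Basis\<close>)
    qed
  qed
qed

text \<open>Every derivative is continuous and vanishes off the compact support, hence it is bounded.\<close>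

lemma slow_compact_support:
  fixes g :: "'a::euclidean_space \<Rightarrow> real"
  assumes "smooth g" "closure {\<xi>. g \<xi> \<noteq> 0} \<subseteq> ball 0 r"
  shows "slow_family (\<lambda>_. g)"
  unfolding smooth_family_iff
proof (intro allI impI conjI)
  fix "is" :: "'a list" assume "is": "set is \<subseteq> Basis"
  show "iter_deriv is g differentiable (at x)" for x
    using assms(1) "is" unfolding smooth_def by blast
  let ?U = "- closure {\<xi>. g \<xi> \<noteq> 0}"
  have "iter_deriv js g x = 0" if "x \<in> ?U" for x js
    using that
  proof (induction js arbitrary: x)
    case Nil
    then show ?case using closure_subset[of "{\<xi>. g \<xi> \<noteq> 0}"] by (auto simp: iter_deriv_def)
  next
    case (Cons i js)
    have "(iter_deriv js g has_derivative (\<lambda>_. 0)) (at x)"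
      by (rule has_derivative_transform_within_open[where f = "\<lambda>_. 0" and s = ?U])
         (use Cons in auto)
    then show ?case by (simp add: iter_deriv_def) (metis partial_deriv_eq)
  qed
  then have zero: "iter_deriv is g x = 0" if "x \<notin> cball 0 r" for x
    using assms(2) that by fastforce
  have "continuous_on (cball 0 r) (iter_deriv is g)"
    using assms(1) "is" unfolding smooth_def
    by (intro continuous_at_imp_continuous_on ballI differentiable_imp_continuous_within) blast
  then have "bounded (iter_deriv is g ` cball 0 r)"
    by (intro compact_imp_bounded compact_continuous_image compact_cball)
  then obtain B where B: "\<And>x. x \<in> cball 0 r \<Longrightarrow> norm (iter_deriv is g x) \<le> B"
    unfolding bounded_iff by blast
  have "norm (iter_deriv is g x) \<le> \<bar>B\<bar>" for x
    using B[of x] zero[of x] by (cases "x \<in> cball 0 r") auto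
  then show "slowly_growing (\<lambda>_. iter_deriv is g)"
    unfolding slowly_growing_def by (intro exI[of _ 0] exI[of _ "\<bar>B\<bar>"]) simp
qed

lemma slow_family_cmult: "slow_family \<Phi> \<Longrightarrow> slow_family (\<lambda>j x. c * \<Phi> j x)"
  for c :: "'b::real_normed_algebra"
  by (rule slow_family_mult[OF slow_family_const[OF order_refl]])

lemma schwartz_family_cmult: "schwartz_family \<Phi> \<Longrightarrow> schwartz_family (\<lambda>j x. c * \<Phi> j x)"
  for c :: "'b::real_normed_algebra"
  by (rule slow_mult_schwartz_family[OF slow_family_const[OF order_refl]])

lemma slow_lp_phi:
  assumes "lp_cutoff chi"
  shows "slow_family (\<lambda>_ \<xi>. lp_phi chi (c *\<^sub>R \<xi>))"
proof -
  have s: "slow_family (\<lambda>_. chi)"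
    using assms slow_compact_support unfolding lp_cutoff_def by blast
  have "slow_family (\<lambda>_ \<xi>. chi ((c / 2) *\<^sub>R \<xi>) + (-1) * chi (c *\<^sub>R \<xi>))"
    by (intro slow_family_add slow_family_cmult slow_family_scaled s)
  then show ?thesis by (simp add: lp_phi_def)
qed

section \<open>Tempered distributions on bounded families\<close>

lemma schwartz_lincomb:
  assumes "\<phi> \<in> schwartz" "\<psi> \<in> schwartz"
  shows "(\<lambda>x. a * \<phi> x + b * \<psi> x) \<in> schwartz"
  using assms unfolding schwartz_iff by (intro schwartz_family_add schwartz_family_cmult)

lemma schwartz_slow_mult:
  assumes "slow_family (\<lambda>_::unit. m)" "\<psi> \<in> schwartz"
  shows "(\<lambda>x. m x * \<psi> x) \<in> schwartz"
  using assms unfolding schwartz_iff by (rule slow_mult_schwartz_family)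

lemma schwartz_seminorm_bounded:
  assumes "schwartz_family \<Phi>"
  obtains C where "\<And>j. \<bar>schwartz_seminorm N (\<Phi> j)\<bar> \<le> C"
proof -
  let ?L = "{is::'b list. set is \<subseteq> Basis \<and> length is \<le> N}"
  have "\<exists>C. \<forall>j x. (1 + norm x) ^ N * norm (iter_deriv is (\<Phi> j) x) \<le> C" if "is \<in> ?L" for "is"
    using smooth_familyD(1)[OF smooth_family_iter_deriv[OF assms]] that
    unfolding rapidly_decreasing_def by blast
  then obtain C where C: "\<And>is j x. is \<in> ?L \<Longrightarrow> (1 + norm x) ^ N * norm (iter_deriv is (\<Phi> j) x) \<le> C is"
    by metis
  have fin: "finite ?L" by (rule finite_lists_length_le) simp
  have C0: "0 \<le> C is" if "is \<in> ?L" for "is"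
    using C[OF that, of 0] by (rule order_trans[rotated]) simp
  have le: "(1 + norm x) ^ N * norm (iter_deriv is (\<Phi> j) x) \<le> sum C ?L" if "is \<in> ?L" for "is" j x
    using C[OF that, of x j] member_le_sum[OF that, of C] C0 fin by fastforce
  have "\<bar>schwartz_seminorm N (\<Phi> j)\<bar> \<le> sum C ?L" for j
    unfolding schwartz_seminorm_def
    by (rule cSup_abs_le) (use le in \<open>auto simp: abs_mult intro: exI[of _ "[]"]\<close>)
  then show ?thesis by (rule that)
qed

text \<open>This is the form in which the continuity of a tempered distribution is used.\<close>

lemma tempered_bounded_on_family:
  assumes "tempered u" "schwartz_family \<Phi>"
  obtains C where "\<And>j. norm (u (\<Phi> j)) \<le> C"
proof -
  obtain N C where C: "\<And>\<phi>. \<phi> \<in> schwartz \<Longrightarrow> norm (u \<phi>) \<le> C * schwartz_seminorm N \<phi>"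
    using assms(1) unfolding tempered_def by blast
  obtain D where D: "\<And>j. \<bar>schwartz_seminorm N (\<Phi> j)\<bar> \<le> D"
    using schwartz_seminorm_bounded[OF assms(2)] by blast
  have "norm (u (\<Phi> j)) \<le> \<bar>C\<bar> * D" for j
  proof -
    have "norm (u (\<Phi> j)) \<le> \<bar>C * schwartz_seminorm N (\<Phi> j)\<bar>"
      using C[OF schwartz_family_schwartz[OF assms(2)]] abs_ge_self order_trans by blast
    also have "\<dots> \<le> \<bar>C\<bar> * D" unfolding abs_mult using D by (intro mult_left_mono) auto
    finally show ?thesis .
  qed
  then show ?thesis by (rule that)
qed

lemma tempered_lincomb:
  assumes "tempered u" "\<phi> \<in> schwartz" "\<psi> \<in> schwartz"
  shows "u (\<lambda>x. a * \<phi> x + b * \<psi> x) = a * u \<phi> + b * u \<psi>"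
  using assms unfolding tempered_def by blast

section \<open>Integrals of Schwartz functions\<close>

text \<open>The exponent is twice the dimension because then the weight is dominated by the product of the
  one-dimensional functions \<open>1 / (1 + (x\<^sub>b)\<^sup>2)\<close>, which makes its integrability a one-dimensional fact.\<close>

definition decay_weight :: "'a::euclidean_space \<Rightarrow> real" where
  "decay_weight x = 1 / (1 + norm x) ^ (2 * DIM('a))"

lemma decay_weight_pos: "decay_weight x > 0"
proof -
  have "0 < 1 + norm x" by (rule add_pos_nonneg) auto
  then show ?thesis
    unfolding decay_weight_def by (intro divide_pos_pos zero_less_one zero_less_power)
qed

lemma decay_weight_le_1: "decay_weight x \<le> 1"
proof -
  have "1 \<le> (1 + norm x) ^ (2 * DIM('a))" by (intro one_le_power) simp
  then show ?thesis unfolding decay_weight_def by (intro divide_le_eq_1_pos[THEN iffD2]) linarith+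
qed

lemma borel_measurable_decay_weight[measurable]: "decay_weight \<in> borel_measurable borel"
  unfolding decay_weight_def[abs_def] by measurable

lemma integrable_decay_weight: "integrable lborel (decay_weight :: 'a::euclidean_space \<Rightarrow> real)"
proof (rule integrableI_bounded)
  have int1: "integrable lborel (\<lambda>x::real. inverse (1 + x\<^sup>2))"
    using integrable_inverse_1_plus_square by (simp add: set_integrable_def einterval_def)
  have le: "norm (decay_weight x) \<le> (\<Prod>b\<in>Basis. inverse (1 + (x \<bullet> b)\<^sup>2))" for x :: 'a
  proof -
    have "(\<Prod>b\<in>(Basis::'a set). 1 + (x \<bullet> b)\<^sup>2) \<le> (\<Prod>b\<in>(Basis::'a set). (1 + norm x)\<^sup>2)"
    proof (rule prod_mono)
      fix b :: 'a assume "b \<in> Basis"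
      then have "(x \<bullet> b)\<^sup>2 \<le> (norm x)\<^sup>2"
        using Basis_le_norm[of b x] by (metis abs_le_square_iff abs_norm_cancel)
      then show "0 \<le> 1 + (x \<bullet> b)\<^sup>2 \<and> 1 + (x \<bullet> b)\<^sup>2 \<le> (1 + norm x)\<^sup>2"
        by (auto simp: power2_sum intro: add_increasing2)
    qed
    then have *: "(\<Prod>b\<in>(Basis::'a set). 1 + (x \<bullet> b)\<^sup>2) \<le> (1 + norm x) ^ (2 * DIM('a))"
      by (simp add: power_mult)
    have pos: "0 < (\<Prod>b\<in>(Basis::'a set). 1 + (x \<bullet> b)\<^sup>2)"
      by (intro prod_pos) (auto intro: add_pos_nonneg)
    have "decay_weight x \<le> inverse (\<Prod>b\<in>(Basis::'a set). 1 + (x \<bullet> b)\<^sup>2)"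
      unfolding decay_weight_def using le_imp_inverse_le[OF * pos] by (simp add: inverse_eq_divide)
    then show ?thesis using decay_weight_pos[of x] by (simp add: prod_inversef[symmetric] o_def)
  qed
  have "(\<integral>\<^sup>+ (x::'a). ennreal (norm (decay_weight x)) \<partial>lborel)
      \<le> (\<integral>\<^sup>+ (x::'a). (\<Prod>b\<in>Basis. ennreal (inverse (1 + (x \<bullet> b)\<^sup>2))) \<partial>lborel)"
    using le by (intro nn_integral_mono) (simp add: prod_ennreal ennreal_leI)
  also have "\<dots> = (\<Prod>b\<in>(Basis::'a set). \<integral>\<^sup>+ x. ennreal (inverse (1 + x\<^sup>2)) \<partial>lborel)"
    by (rule nn_integral_lborel_prod) auto
  also have "\<dots> < \<infinity>"
  proof -
    have "(\<integral>\<^sup>+ x. ennreal (inverse (1 + x\<^sup>2)) \<partial>lborel) < \<infinity>"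
      using int1 by (simp add: integrable_iff_bounded)
    then show ?thesis by (simp add: power_less_top_ennreal)
  qed
  finally show "(\<integral>\<^sup>+ (x::'a). ennreal (norm (decay_weight x)) \<partial>lborel) < \<infinity>" .
qed simp

lemma rapidly_decreasing_decay:
  fixes \<Phi> :: "'j \<Rightarrow> 'a::euclidean_space \<Rightarrow> 'b::real_normed_vector"
  assumes "rapidly_decreasing \<Phi>"
  obtains C where "C \<ge> 0" "\<And>j x. norm (\<Phi> j x) \<le> C * decay_weight x"
proof -
  obtain C where C: "\<And>j x. (1 + norm x) ^ (2 * DIM('a)) * norm (\<Phi> j x) \<le> C"
    using assms unfolding rapidly_decreasing_def by metis
  have "norm (\<Phi> j x) \<le> \<bar>C\<bar> * decay_weight x" for j x
  proof -
    have pos: "(1 + norm x) ^ (2 * DIM('a)) > 0" by (intro zero_less_power) (auto intro: add_pos_nonneg)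
    have "(1 + norm x) ^ (2 * DIM('a)) * norm (\<Phi> j x) \<le> \<bar>C\<bar>" using C[of x j] by linarith
    then show ?thesis using pos unfolding decay_weight_def by (simp add: pos_le_divide_eq mult.commute)
  qed
  then show ?thesis using that[of "\<bar>C\<bar>"] by auto
qed

lemma schwartz_decay:
  fixes \<phi> :: "'a::euclidean_space \<Rightarrow> complex"
  assumes "\<phi> \<in> schwartz"
  obtains C where "C \<ge> 0" "\<And>x. norm (\<phi> x) \<le> C * decay_weight x"
  using rapidly_decreasing_decay[OF smooth_familyD(1)[OF assms[unfolded schwartz_iff]]] by metis

lemma schwartz_differentiable: "\<phi> \<in> schwartz \<Longrightarrow> \<phi> differentiable (at x)"
  unfolding schwartz_iff by (rule smooth_familyD(2))

lemma schwartz_partial_deriv: "\<phi> \<in> schwartz \<Longrightarrow> i \<in> Basis \<Longrightarrow> partial_deriv i \<phi> \<in> schwartz"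
  unfolding schwartz_iff by (rule smooth_familyD(3))

lemma schwartz_continuous: "\<phi> \<in> schwartz \<Longrightarrow> continuous_on UNIV \<phi>"
  by (intro continuous_at_imp_continuous_on ballI differentiable_imp_continuous_within schwartz_differentiable)

lemma schwartz_measurable: "\<phi> \<in> schwartz \<Longrightarrow> \<phi> \<in> borel_measurable borel"
  by (intro borel_measurable_continuous_onI schwartz_continuous)

lemma integrable_decay:
  fixes f :: "'a::euclidean_space \<Rightarrow> complex"
  assumes "f \<in> borel_measurable borel" "\<And>x. norm (f x) \<le> C * decay_weight x"
  shows "integrable lborel f"
proof (rule Bochner_Integration.integrable_bound)
  show "integrable lborel (\<lambda>x::'a. C * decay_weight x)" by (simp add: integrable_decay_weight)
  show "AE x in lborel. norm (f x) \<le> norm (C * decay_weight x)"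
    using assms(2) by (intro AE_I2) (metis abs_ge_self order_trans real_norm_def)
qed (use assms(1) in simp)

lemma schwartz_integrable: "\<phi> \<in> schwartz \<Longrightarrow> integrable lborel \<phi>"
  by (rule schwartz_decay) (auto intro: integrable_decay schwartz_measurable)

lemma norm_integral_decay:
  fixes f :: "'a::euclidean_space \<Rightarrow> complex"
  assumes "f \<in> borel_measurable borel" "\<And>x. norm (f x) \<le> C * decay_weight x"
  shows "norm (LINT x|lborel. f x) \<le> C * (LINT x|lborel. decay_weight (x::'a))"
proof -
  have "norm (LINT x|lborel. f x) \<le> (LINT x|lborel. norm (f x))" by (rule integral_norm_bound)
  also have "\<dots> \<le> (LINT x|lborel. C * decay_weight (x::'a))"
    using integrable_decay[OF assms] integrable_decay_weight assms(2) by (intro integral_mono) auto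
  finally show ?thesis by simp
qed

lemma slow_character: "slow_family (\<lambda>_ x. cis (- (x \<bullet> \<xi>)))"
proof (rule smooth_family_coinduct[where X = "\<lambda>\<Xi>. \<exists>c. \<Xi> = (\<lambda>_ x. c * cis (- (x \<bullet> \<xi>)))"], goal_cases)
  case 1
  show ?case by (rule exI[of _ 1]) simp
next
  case (2 \<Xi>)
  then obtain c where *: "\<Xi> = (\<lambda>_ x. c * cis (- (x \<bullet> \<xi>)))" by (elim exE) (rule that)
  show ?case unfolding * slowly_growing_def
    by (intro exI[of _ 0] exI[of _ "norm c"]) (simp add: norm_mult)
next
  case (3 \<Xi> j x)
  then obtain c where *: "\<Xi> = (\<lambda>_ x. c * cis (- (x \<bullet> \<xi>)))" by (elim exE) (rule that)
  show ?case unfolding * differentiable_def by (rule exI) (auto intro!: derivative_eq_intros)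
next
  case (4 \<Xi> i)
  then obtain c where *: "\<Xi> = (\<lambda>_ x. c * cis (- (x \<bullet> \<xi>)))" by (elim exE) (rule that)
  have "((\<lambda>x. c * cis (- (x \<bullet> \<xi>))) has_derivative
      (\<lambda>h. (c * (- \<i> * of_real (h \<bullet> \<xi>))) * cis (- (x \<bullet> \<xi>)))) (at x)" for x
    by (auto intro!: derivative_eq_intros simp: scaleR_conv_of_real)
  then have "partial_deriv i (\<lambda>x. c * cis (- (x \<bullet> \<xi>))) = (\<lambda>x. (c * (- \<i> * of_real (i \<bullet> \<xi>))) * cis (- (x \<bullet> \<xi>)))"
    by (intro ext partial_deriv_eq)
  then show ?case unfolding * by (intro exI[of _ "c * (- \<i> * of_real (i \<bullet> \<xi>))"]) (simp only:)
qed

lemma partial_deriv_character: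
  "partial_deriv i (\<lambda>x. cis (- (x \<bullet> \<xi>))) x = - \<i> * of_real (i \<bullet> \<xi>) * cis (- (x \<bullet> \<xi>))"
  by (intro partial_deriv_eq) (auto intro!: derivative_eq_intros simp: scaleR_conv_of_real)

lemma lborel_integral_affine:
  fixes f :: "'a::euclidean_space \<Rightarrow> 'b::{banach, second_countable_topology}"
  assumes [measurable]: "f \<in> borel_measurable borel" and "c \<noteq> 0"
  shows "(LINT x|lborel. f x) = \<bar>c\<bar> ^ DIM('a) *\<^sub>R (LINT x|lborel. f (t + c *\<^sub>R x))"
  apply (subst lborel_affine[OF assms(2), of t])
  apply (subst integral_density)
     apply (auto simp: integral_distr)
  done

lemma decay_weight_shift:
  fixes x y :: "'a::euclidean_space"
  assumes "norm (x - y) \<le> 1"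
  shows "decay_weight y \<le> 2 ^ (2 * DIM('a)) * decay_weight x"
proof -
  have "norm x \<le> norm (x - y) + norm y" by (metis diff_add_cancel norm_triangle_ineq)
  then have "norm x \<le> 1 + norm y" using assms by linarith
  moreover have "0 \<le> norm y" by simp
  ultimately have "1 + norm x \<le> 2 * (1 + norm y)" unfolding distrib_left by linarith
  then have *: "(1 + norm x) ^ (2 * DIM('a)) \<le> 2 ^ (2 * DIM('a)) * (1 + norm y) ^ (2 * DIM('a))"
    unfolding power_mult_distrib[symmetric] by (intro power_mono) auto
  have "(1 + norm x) ^ (2 * DIM('a)) > 0" "(1 + norm y) ^ (2 * DIM('a)) > 0"
    by (auto intro!: zero_less_power intro: add_pos_nonneg)
  then show ?thesis using * unfolding decay_weight_def by (simp add: divide_simps mult.commute)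
qed

text \<open>The difference quotients in direction \<open>i\<close> have integral zero by translation invariance, and they are
  dominated by a multiple of the integrable weight by the mean value theorem.\<close>

lemma integral_partial_deriv:
  fixes \<psi> :: "'a::euclidean_space \<Rightarrow> complex"
  assumes \<psi>: "\<psi> \<in> schwartz" and i: "i \<in> Basis"
  shows "(LINT x|lborel. partial_deriv i \<psi> x) = 0"
proof -
  note [measurable] = schwartz_measurable[OF \<psi>] schwartz_measurable[OF schwartz_partial_deriv[OF \<psi> i]]
  define t where "t n = inverse (real (Suc n))" for n
  have t: "t n > 0" "t n \<le> 1" for n by (auto simp: t_def inverse_le_1_iff)
  define s where "s n x = (\<psi> (x + t n *\<^sub>R i) - \<psi> x) / of_real (t n)" for n x
  obtain C where C: "C \<ge> 0" "\<And>x. norm (partial_deriv i \<psi> x) \<le> C * decay_weight x"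
    using schwartz_decay[OF schwartz_partial_deriv[OF \<psi> i]] by metis
  have der: "(\<psi> has_derivative frechet_derivative \<psi> (at x)) (at x)" for x
    using schwartz_differentiable[OF \<psi>] by (simp add: frechet_derivative_works)
  have "(\<lambda>n. LINT x|lborel. s n x) \<longlonglongrightarrow> (LINT x|lborel. partial_deriv i \<psi> x)"
  proof (rule integral_dominated_convergence)
    show "integrable lborel (\<lambda>x. C * (2 ^ (2 * DIM('a)) * decay_weight (x::'a)))"
      by (simp add: integrable_decay_weight)
    show "AE x in lborel. (\<lambda>n. s n x) \<longlonglongrightarrow> partial_deriv i \<psi> x"
    proof (rule AE_I2)
      fix x
      let ?D = "frechet_derivative \<psi> (at x)"
      have lin: "bounded_linear ?D" using der by (rule has_derivative_bounded_linear)
      have "(\<lambda>h. norm (\<psi> (x + h) - \<psi> x - ?D h) / norm h) \<midarrow>0\<rightarrow> 0"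
        using der[of x] by (simp add: has_derivative_at)
      moreover have "filterlim (\<lambda>n. t n *\<^sub>R i) (at 0) sequentially"
      proof -
        have "(\<lambda>n. t n *\<^sub>R i) \<longlonglongrightarrow> 0 *\<^sub>R i"
          unfolding t_def by (intro tendsto_scaleR LIMSEQ_inverse_real_of_nat tendsto_const)
        then show ?thesis using t(1) i
          by (auto simp: filterlim_at less_imp_neq[symmetric] intro!: always_eventually)
      qed
      ultimately have "(\<lambda>n. norm (\<psi> (x + t n *\<^sub>R i) - \<psi> x - ?D (t n *\<^sub>R i)) / norm (t n *\<^sub>R i)) \<longlonglongrightarrow> 0"
        by (rule filterlim_compose)
      moreover have "norm (\<psi> (x + t n *\<^sub>R i) - \<psi> x - ?D (t n *\<^sub>R i)) / norm (t n *\<^sub>R i)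
          = norm (s n x - partial_deriv i \<psi> x)" for n
      proof -
        have "\<psi> (x + t n *\<^sub>R i) - \<psi> x - ?D (t n *\<^sub>R i) = of_real (t n) * (s n x - partial_deriv i \<psi> x)"
          using less_imp_neq[OF t(1)[of n]] linear_simps(5)[OF lin]
          by (simp add: s_def partial_deriv_def scaleR_conv_of_real right_diff_distrib diff_divide_distrib)
        then show ?thesis using t(1)[of n] i by (simp add: norm_mult)
      qed
      ultimately show "(\<lambda>n. s n x) \<longlonglongrightarrow> partial_deriv i \<psi> x"
        by (simp add: tendsto_norm_zero_iff LIM_zero_iff)
    qed
    show "AE x in lborel. norm (s n x) \<le> C * (2 ^ (2 * DIM('a)) * decay_weight (x::'a))" for n
    proof (rule AE_I2)
      fix x
      have d: "((\<lambda>r. \<psi> (x + r *\<^sub>R i)) has_derivative (\<lambda>h. frechet_derivative \<psi> (at (x + r *\<^sub>R i)) (h *\<^sub>R i))) (at r)" for r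
        by (rule has_derivative_compose[where f = "\<lambda>r. x + r *\<^sub>R i", OF _ der]) (auto intro!: derivative_eq_intros)
      have "\<exists>r\<in>{0<..<t n}. norm (\<psi> (x + t n *\<^sub>R i) - \<psi> (x + 0 *\<^sub>R i))
          \<le> norm (frechet_derivative \<psi> (at (x + r *\<^sub>R i)) ((t n - 0) *\<^sub>R i))"
        by (rule mvt_general[where f = "\<lambda>r. \<psi> (x + r *\<^sub>R i)", OF t(1)])
           (auto intro: d continuous_at_imp_continuous_on has_derivative_continuous)
      then obtain r where r: "0 < r" "r < t n" and le: "norm (\<psi> (x + t n *\<^sub>R i) - \<psi> x)
          \<le> norm (frechet_derivative \<psi> (at (x + r *\<^sub>R i)) (t n *\<^sub>R i))" by auto
      note le
      also have "frechet_derivative \<psi> (at (x + r *\<^sub>R i)) (t n *\<^sub>R i) = t n *\<^sub>R partial_deriv i \<psi> (x + r *\<^sub>R i)"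
        using linear_simps(5)[OF has_derivative_bounded_linear[OF der]] by (simp add: partial_deriv_def)
      finally have "norm (s n x) \<le> norm (partial_deriv i \<psi> (x + r *\<^sub>R i))"
        using t(1)[of n] by (simp add: s_def norm_divide divide_simps mult.commute)
      also have "\<dots> \<le> C * decay_weight (x + r *\<^sub>R i)" by (rule C)
      also have "\<dots> \<le> C * (2 ^ (2 * DIM('a)) * decay_weight x)"
        using r t(2)[of n] i by (intro mult_left_mono decay_weight_shift C(1)) auto
      finally show "norm (s n x) \<le> C * (2 ^ (2 * DIM('a)) * decay_weight x)" .
    qed
  qed (auto simp: s_def)
  moreover have "(LINT x|lborel. s n x) = 0" for n
  proof -
    have "(LINT x|lborel. \<psi> (x + t n *\<^sub>R i)) = (LINT x|lborel. \<psi> x)"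
      using lborel_integral_affine[of \<psi> 1 "t n *\<^sub>R i"] by (simp add: add.commute)
    moreover have "integrable lborel (\<lambda>x. \<psi> (x + t n *\<^sub>R i))"
    proof -
      obtain D where D: "D \<ge> 0" "\<And>x. norm (\<psi> x) \<le> D * decay_weight x"
        using schwartz_decay[OF \<psi>] by metis
      have "norm (\<psi> (x + t n *\<^sub>R i)) \<le> (D * 2 ^ (2 * DIM('a))) * decay_weight x" for x
      proof -
        have "norm (\<psi> (x + t n *\<^sub>R i)) \<le> D * decay_weight (x + t n *\<^sub>R i)" by (rule D)
        also have "\<dots> \<le> D * (2 ^ (2 * DIM('a)) * decay_weight x)"
          using t[of n] i by (intro mult_left_mono decay_weight_shift D(1)) auto
        finally show ?thesis by (simp add: mult.assoc)
      qed
      then show ?thesis by (intro integrable_decay[of _ "D * 2 ^ (2 * DIM('a))"]) auto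
    qed
    ultimately show ?thesis
      unfolding s_def using schwartz_integrable[OF \<psi>] by simp
  qed
  ultimately show ?thesis by (simp add: LIMSEQ_const_iff)
qed

section \<open>The Fourier transform on Schwartz functions\<close>

lemma norm_fourier_le:
  fixes \<phi> :: "'a::euclidean_space \<Rightarrow> complex"
  assumes "\<phi> \<in> schwartz" "\<And>x. norm (\<phi> x) \<le> C * decay_weight x"
  shows "norm (fourier \<phi> \<xi>) \<le> C * (LINT x|lborel. decay_weight (x::'a))"
  unfolding fourier_def
proof (rule norm_integral_decay)
  note [measurable] = schwartz_measurable[OF assms(1)]
  show "(\<lambda>x. cis (- (x \<bullet> \<xi>)) * \<phi> x) \<in> borel_measurable borel"
    unfolding cis_conv_exp by measurable
  show "norm (cis (- (x \<bullet> \<xi>)) * \<phi> x) \<le> C * decay_weight x" for x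
    using assms(2)[of x] by (simp add: norm_mult)
qed

lemma schwartz_mult_character:
  "\<phi> \<in> schwartz \<Longrightarrow> (\<lambda>x. cis (- (x \<bullet> \<xi>)) * \<phi> x) \<in> schwartz"
  by (rule schwartz_slow_mult[OF slow_character])

lemma slow_inner: "slow_family (\<lambda>_ x. complex_of_real (x \<bullet> v))"
  by (rule slow_family_of_real[OF slow_family_inner])

lemma schwartz_mult_inner:
  "\<phi> \<in> schwartz \<Longrightarrow> (\<lambda>x. of_real (x \<bullet> v) * \<phi> x) \<in> schwartz"
  by (rule schwartz_slow_mult[OF slow_inner])

lemma norm_cis_linear_approx: "norm (cis a - 1 - \<i> * of_real a) \<le> a\<^sup>2"
proof -
  have "norm (iexp a - (\<Sum>k\<le>1. (\<i> * of_real a) ^ k / fact k)) \<le> \<bar>a\<bar> ^ Suc 1 / fact (Suc 1)"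
    by (rule iexp_approx1)
  also have "\<dots> \<le> a\<^sup>2" by (simp add: power2_eq_square)
  finally show ?thesis by (simp add: cis_conv_exp algebra_simps)
qed

text \<open>Linearizing the character leaves a remainder of at most \<open>|x|\<^sup>2 |h|\<^sup>2 |\<phi> x|\<close>, whose integral is
  quadratic in \<open>h\<close>.\<close>

lemma fourier_has_derivative:
  fixes \<phi> :: "'a::euclidean_space \<Rightarrow> complex"
  assumes "\<phi> \<in> schwartz"
  shows "(fourier \<phi> has_derivative
     (\<lambda>h. \<Sum>b\<in>Basis. (h \<bullet> b) *\<^sub>R fourier (\<lambda>x. (- \<i>) * (of_real (x \<bullet> b) * \<phi> x)) \<xi>)) (at \<xi>)"
proof -
  let ?e = "\<lambda>x \<xi>. cis (- (x \<bullet> \<xi>))"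
  let ?L = "\<lambda>h. \<Sum>b\<in>Basis. (h \<bullet> b) *\<^sub>R fourier (\<lambda>x. (- \<i>) * (of_real (x \<bullet> b) * \<phi> x)) \<xi>"
  note [measurable] = schwartz_measurable[OF assms]
  have xb: "(\<lambda>x. (- \<i>) * (of_real (x \<bullet> b) * \<phi> x)) \<in> schwartz" for b
    using schwartz_lincomb[OF schwartz_mult_inner[OF assms] assms, of "- \<i>" _ 0] by simp
  have int_b: "integrable lborel (\<lambda>x. ?e x \<xi> * ((- \<i>) * (of_real (x \<bullet> b) * \<phi> x)))" for b
    by (rule schwartz_integrable[OF schwartz_mult_character[OF xb]])
  have L: "?L h = (LINT x|lborel. ?e x \<xi> * ((- \<i>) * (of_real (x \<bullet> h) * \<phi> x)))" for h
  proof -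
    have "?L h = (LINT x|lborel. (\<Sum>b\<in>Basis. (h \<bullet> b) *\<^sub>R (?e x \<xi> * ((- \<i>) * (of_real (x \<bullet> b) * \<phi> x)))))"
      unfolding fourier_def using int_b by (subst Bochner_Integration.integral_sum) auto
    also have "\<dots> = (LINT x|lborel. ?e x \<xi> * ((- \<i>) * (of_real (x \<bullet> h) * \<phi> x)))"
      by (intro Bochner_Integration.integral_cong refl)
         (simp add: euclidean_inner[of _ h] sum_distrib_left sum_distrib_right scaleR_conv_of_real mult_ac)
    finally show ?thesis .
  qed
  have sq: "(\<lambda>x. of_real (x \<bullet> b) * (of_real (x \<bullet> b) * \<phi> x)) \<in> schwartz" for b
    by (intro schwartz_mult_inner assms)
  have int2: "integrable lborel (\<lambda>x. (norm x)\<^sup>2 * norm (\<phi> x))"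
  proof -
    have "integrable lborel (\<lambda>x. \<Sum>b\<in>Basis. norm (of_real (x \<bullet> b) * (of_real (x \<bullet> b) * \<phi> x)))"
      using schwartz_integrable[OF sq] by (intro Bochner_Integration.integrable_sum integrable_norm)
    moreover have "(\<Sum>b\<in>Basis. norm (of_real (x \<bullet> b) * (of_real (x \<bullet> b) * \<phi> x))) = (norm x)\<^sup>2 * norm (\<phi> x)" for x :: 'a
      unfolding power2_norm_eq_inner euclidean_inner[of x x]
      by (simp add: norm_mult sum_distrib_right abs_mult_self_eq mult.assoc[symmetric])
    ultimately show ?thesis by simp
  qed
  define K where "K = (LINT x|lborel. (norm x)\<^sup>2 * norm (\<phi> x))"
  show ?thesis
  proof (rule has_derivativeI_sandwich[where e = 1 and H = "\<lambda>\<zeta>. K * norm (\<zeta> - \<xi>)"])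
    show "bounded_linear ?L"
      by (intro bounded_linear_sum bounded_linear_scaleR_const bounded_linear_inner_left)
    have "((\<lambda>\<zeta>. K * norm (\<zeta> - \<xi>)) \<longlongrightarrow> K * norm (\<xi> - \<xi>)) (at \<xi>)"
      by (intro tendsto_intros)
    then show "((\<lambda>\<zeta>. K * norm (\<zeta> - \<xi>)) \<longlongrightarrow> 0) (at \<xi>)" by simp
    fix \<zeta> :: 'a assume "\<zeta> \<noteq> \<xi>"
    define h where "h = \<zeta> - \<xi>"
    have \<zeta>: "\<zeta> = \<xi> + h" and h: "norm h > 0" using \<open>\<zeta> \<noteq> \<xi>\<close> by (auto simp: h_def)
    let ?r = "\<lambda>x. ?e x \<zeta> * \<phi> x - ?e x \<xi> * \<phi> x - ?e x \<xi> * ((- \<i>) * (of_real (x \<bullet> h) * \<phi> x))"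
    have i1: "integrable lborel (\<lambda>x. ?e x \<eta> * \<phi> x)" for \<eta>
      by (rule schwartz_integrable[OF schwartz_mult_character[OF assms]])
    have i2: "integrable lborel (\<lambda>x. ?e x \<xi> * ((- \<i>) * (of_real (x \<bullet> h) * \<phi> x)))"
      by (intro schwartz_integrable schwartz_mult_character)
         (use schwartz_lincomb[OF schwartz_mult_inner[OF assms] assms, of "- \<i>" _ 0] in simp)
    have rem: "fourier \<phi> \<zeta> - fourier \<phi> \<xi> - ?L (\<zeta> - \<xi>) = (LINT x|lborel. ?r x)"
      unfolding L h_def[symmetric] unfolding fourier_def using i1 i2 by simp
    have "norm (fourier \<phi> \<zeta> - fourier \<phi> \<xi> - ?L (\<zeta> - \<xi>)) \<le> (LINT x|lborel. norm (?r x))"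
      unfolding rem by (rule integral_norm_bound)
    also have "\<dots> \<le> (LINT x|lborel. (norm h)\<^sup>2 * ((norm x)\<^sup>2 * norm (\<phi> x)))"
    proof (rule integral_mono)
      show "integrable lborel (\<lambda>x. norm (?r x))"
        by (intro integrable_norm Bochner_Integration.integrable_diff i1 i2)
      show "integrable lborel (\<lambda>x. (norm h)\<^sup>2 * ((norm x)\<^sup>2 * norm (\<phi> x)))" using int2 by simp
      fix x
      have "?r x = ?e x \<xi> * \<phi> x * (cis (- (x \<bullet> h)) - 1 - \<i> * of_real (- (x \<bullet> h)))"
      proof -
        have "?e x \<zeta> = ?e x \<xi> * cis (- (x \<bullet> h))" by (simp add: \<zeta> inner_add_right cis_mult)
        then show ?thesis by (simp add: algebra_simps)
      qed
      then have "norm (?r x) = norm (\<phi> x) * norm (cis (- (x \<bullet> h)) - 1 - \<i> * of_real (- (x \<bullet> h)))"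
        by (simp add: norm_mult)
      also have "\<dots> \<le> norm (\<phi> x) * (- (x \<bullet> h))\<^sup>2"
        by (intro mult_left_mono norm_cis_linear_approx) simp
      also have "norm (\<phi> x) * (- (x \<bullet> h))\<^sup>2 \<le> norm (\<phi> x) * (norm x * norm h)\<^sup>2"
        using Cauchy_Schwarz_ineq2[of x h] by (intro mult_left_mono) (simp_all add: abs_le_square_iff[symmetric])
      finally show "norm (?r x) \<le> (norm h)\<^sup>2 * ((norm x)\<^sup>2 * norm (\<phi> x))"
        by (simp only: power_mult_distrib mult_ac)
    qed
    also have "\<dots> = K * norm h * norm h" unfolding K_def by (simp add: power2_eq_square)
    finally show "norm ((fourier \<phi> \<zeta> - fourier \<phi> \<xi>) - ?L (\<zeta> - \<xi>)) / norm (\<zeta> - \<xi>) \<le> K * norm (\<zeta> - \<xi>)"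
      using h by (simp add: h_def[symmetric] pos_divide_le_eq)
  qed simp
qed

lemma partial_deriv_fourier:
  assumes "\<phi> \<in> schwartz" "i \<in> Basis"
  shows "partial_deriv i (fourier \<phi>) = fourier (\<lambda>x. (- \<i>) * (of_real (x \<bullet> i) * \<phi> x))"
proof
  fix \<xi>
  show "partial_deriv i (fourier \<phi>) \<xi> = fourier (\<lambda>x. (- \<i>) * (of_real (x \<bullet> i) * \<phi> x)) \<xi>"
    by (subst partial_deriv_eq[OF fourier_has_derivative[OF assms(1)]])
       (simp add: inner_Basis assms(2) if_distrib[of "\<lambda>c. c *\<^sub>R _"] sum.delta cong: if_cong)
qed

text \<open>Integration by parts, in the form that the derivative of \<open>exp (- i x \<bullet> \<xi>) \<phi> x\<close> has integral zero.\<close>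

lemma fourier_partial_deriv:
  assumes "\<phi> \<in> schwartz" "i \<in> Basis"
  shows "fourier (partial_deriv i \<phi>) \<xi> = \<i> * of_real (i \<bullet> \<xi>) * fourier \<phi> \<xi>"
proof -
  let ?e = "\<lambda>x. cis (- (x \<bullet> \<xi>))"
  have e: "?e differentiable (at x)" for x
    using smooth_familyD(2)[OF slow_character] .
  have "0 = (LINT x|lborel. partial_deriv i (\<lambda>x. ?e x * \<phi> x) x)"
    by (rule integral_partial_deriv[symmetric, OF schwartz_mult_character assms(2)]) fact
  also have "\<dots> = (LINT x|lborel. (- \<i> * of_real (i \<bullet> \<xi>)) * (?e x * \<phi> x) + ?e x * partial_deriv i \<phi> x)"
    unfolding partial_deriv_mult[OF e schwartz_differentiable[OF assms(1)]] partial_deriv_character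
    by (simp add: mult_ac)
  also have "\<dots> = (- \<i> * of_real (i \<bullet> \<xi>)) * fourier \<phi> \<xi> + fourier (partial_deriv i \<phi>) \<xi>"
    unfolding fourier_def
    by (subst Bochner_Integration.integral_add)
       (auto intro!: schwartz_integrable schwartz_mult_character schwartz_partial_deriv assms
          Bochner_Integration.integrable_mult_right)
  finally show ?thesis by (simp add: algebra_simps)
qed

text \<open>The transform exchanges derivatives and multiplication by coordinates. The first exchange yields, by
  induction on the exponent, rapid decrease for the transforms of all bounded families; the second
  shows that these transforms are closed under partial derivatives.\<close>

lemma schwartz_family_fourier:
  fixes \<Phi> :: "'j \<Rightarrow> 'a::euclidean_space \<Rightarrow> complex"
  assumes "schwartz_family \<Phi>"
  shows "schwartz_family (\<lambda>j. fourier (\<Phi> j))"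
proof -
  have decay: "\<exists>C. \<forall>j \<xi>. (1 + norm \<xi>) ^ N * norm (fourier (\<Phi> j) \<xi>) \<le> C"
    if "schwartz_family \<Phi>" for N and \<Phi> :: "'j \<Rightarrow> 'a \<Rightarrow> complex"
    using that
  proof (induction N arbitrary: \<Phi>)
    case 0
    obtain C where C: "C \<ge> 0" "\<And>j x. norm (\<Phi> j x) \<le> C * decay_weight x"
      by (rule rapidly_decreasing_decay[OF smooth_familyD(1)[OF 0]]) (rule that, auto)
    show ?case
      using norm_fourier_le[OF schwartz_family_schwartz[OF 0] C(2)] by auto
  next
    case (Suc N)
    obtain C where C: "\<And>j \<xi>. (1 + norm \<xi>) ^ N * norm (fourier (\<Phi> j) \<xi>) \<le> C"
      using Suc.IH[OF Suc.prems] by blast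
    have "\<exists>C. \<forall>j \<xi>. (1 + norm \<xi>) ^ N * norm (fourier (partial_deriv b (\<Phi> j)) \<xi>) \<le> C" if "b \<in> Basis" for b
      by (rule Suc.IH[OF smooth_familyD(3)[OF Suc.prems that]])
    then obtain D where D: "\<And>b j \<xi>. b \<in> Basis \<Longrightarrow>
        (1 + norm \<xi>) ^ N * norm (fourier (partial_deriv b (\<Phi> j)) \<xi>) \<le> D b" by metis
    have "(1 + norm \<xi>) ^ Suc N * norm (fourier (\<Phi> j) \<xi>) \<le> C + sum D Basis" for j \<xi>
    proof -
      have "(1 + norm \<xi>) ^ Suc N * norm (fourier (\<Phi> j) \<xi>)
          = (1 + norm \<xi>) ^ N * norm (fourier (\<Phi> j) \<xi>) + (1 + norm \<xi>) ^ N * norm (fourier (\<Phi> j) \<xi>) * norm \<xi>"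
        by (simp add: algebra_simps)
      also have "\<dots> \<le> C + (1 + norm \<xi>) ^ N * norm (fourier (\<Phi> j) \<xi>) * (\<Sum>b\<in>Basis. \<bar>\<xi> \<bullet> b\<bar>)"
        by (intro add_mono C mult_left_mono norm_le_l1) auto
      also have "(1 + norm \<xi>) ^ N * norm (fourier (\<Phi> j) \<xi>) * (\<Sum>b\<in>Basis. \<bar>\<xi> \<bullet> b\<bar>)
          = (\<Sum>b\<in>Basis. (1 + norm \<xi>) ^ N * norm (fourier (partial_deriv b (\<Phi> j)) \<xi>))"
        unfolding sum_distrib_left
        by (intro sum.cong refl)
           (simp add: fourier_partial_deriv[OF schwartz_family_schwartz[OF Suc.prems]] norm_mult inner_commute mult_ac)
      also have "C + \<dots> \<le> C + sum D Basis" by (intro add_left_mono sum_mono D)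
      finally show ?thesis .
    qed
    then show ?case by blast
  qed
  show ?thesis
  proof (rule smooth_family_coinduct[where
        X = "\<lambda>\<Xi>. \<exists>\<Phi>. \<Xi> = (\<lambda>j. fourier (\<Phi> j)) \<and> schwartz_family \<Phi>"], goal_cases)
    case 1
    show ?case by (intro exI[of _ \<Phi>] conjI refl assms)
  next
    case (2 \<Xi>)
    then obtain \<Phi> where *: "\<Xi> = (\<lambda>j. fourier (\<Phi> j))" "schwartz_family \<Phi>" by (elim exE conjE) (rule that)
    show ?case unfolding *(1) rapidly_decreasing_def by (intro allI decay *(2))
  next
    case (3 \<Xi> j x)
    then obtain \<Phi> where *: "\<Xi> = (\<lambda>j. fourier (\<Phi> j))" "schwartz_family \<Phi>" by (elim exE conjE) (rule that)
    show ?case unfolding *(1)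
      by (rule differentiableI[OF fourier_has_derivative[OF schwartz_family_schwartz[OF *(2)]]])
  next
    case (4 \<Xi> i)
    then obtain \<Phi> where *: "\<Xi> = (\<lambda>j. fourier (\<Phi> j))" "schwartz_family \<Phi>" by (elim exE conjE) (rule that)
    have "schwartz_family (\<lambda>j x. (- \<i>) * (of_real (x \<bullet> i) * \<Phi> j x))"
      by (intro schwartz_family_cmult slow_mult_schwartz_family[OF slow_inner *(2)])
    then show ?case
      unfolding *(1) partial_deriv_fourier[OF schwartz_family_schwartz[OF *(2)] 4(2)]
      by (intro exI[of _ "\<lambda>j x. (- \<i>) * (of_real (x \<bullet> i) * \<Phi> j x)"] conjI refl)
  qed
qed

lemma schwartz_fourier: "\<phi> \<in> schwartz \<Longrightarrow> fourier \<phi> \<in> schwartz"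
  unfolding schwartz_iff by (rule schwartz_family_fourier)

lemma inv_fourier_eq: "inv_fourier \<phi> x = of_real (1 / (2 * pi) ^ DIM('a)) * fourier \<phi> (- x)"
  for x :: "'a::euclidean_space"
  unfolding inv_fourier_def fourier_def by (simp add: inner_commute)

lemma schwartz_inv_fourier:
  fixes \<phi> :: "'a::euclidean_space \<Rightarrow> complex"
  assumes "\<phi> \<in> schwartz" shows "inv_fourier \<phi> \<in> schwartz"
proof -
  have "(\<lambda>x. of_real (1 / (2 * pi) ^ DIM('a)) * fourier \<phi> (- x) + 0 * \<phi> x) \<in> schwartz"
    by (intro schwartz_lincomb schwartz_reflect schwartz_fourier assms)
  then show ?thesis by (simp add: inv_fourier_eq[abs_def])
qed

section \<open>Fourier inversion and Plancherel's theorem\<close>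

definition gauss :: "'a::euclidean_space \<Rightarrow> real" where
  "gauss x = exp (- (norm x)\<^sup>2 / 2)"

lemma gaussian_fourier_real:
  "integrable lborel (\<lambda>x::real. cis (x * t) * of_real (exp (- x\<^sup>2 / 2)))"
  "(LINT x|lborel. cis (x * t) * of_real (exp (- x\<^sup>2 / 2))) = of_real (sqrt (2 * pi) * exp (- t\<^sup>2 / 2))"
proof -
  have dens: "exp (- x\<^sup>2 / 2) = sqrt (2 * pi) * std_normal_density x" for x :: real
    by (simp add: std_normal_density_def)
  have int: "integrable lborel (\<lambda>x::real. exp (- x\<^sup>2 / 2))"
    unfolding dens by (intro integrable_mult_right integrable_normal_density) simp
  have [measurable]: "(\<lambda>x. cis (x * t)) \<in> borel_measurable borel"
    unfolding cis_conv_exp by measurable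
  show "integrable lborel (\<lambda>x::real. cis (x * t) * of_real (exp (- x\<^sup>2 / 2)))"
    by (rule Bochner_Integration.integrable_bound[OF int]) (auto simp: norm_mult)
  have "(LINT x|lborel. cis (x * t) * of_real (exp (- x\<^sup>2 / 2)))
      = of_real (sqrt (2 * pi)) * (LINT x|lborel. std_normal_density x *\<^sub>R iexp (t * x))"
    unfolding dens integral_mult_right_zero[symmetric]
    by (intro Bochner_Integration.integral_cong refl)
       (simp add: cis_conv_exp scaleR_conv_of_real mult_ac)
  also have "(LINT x|lborel. std_normal_density x *\<^sub>R iexp (t * x)) = char std_normal_distribution t"
    unfolding char_def by (subst integral_density) auto
  finally show "(LINT x|lborel. cis (x * t) * of_real (exp (- x\<^sup>2 / 2))) = of_real (sqrt (2 * pi) * exp (- t\<^sup>2 / 2))"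
    by (simp add: char_std_normal_distribution)
qed

lemma borel_measurable_cis[measurable (raw)]:
  "f \<in> borel_measurable M \<Longrightarrow> (\<lambda>x. cis (f x)) \<in> borel_measurable M"
  unfolding cis_conv_exp by measurable

lemma borel_measurable_gauss[measurable]: "gauss \<in> borel_measurable borel"
  unfolding gauss_def[abs_def] by measurable

lemma cis_sum: "cis (sum f A) = (\<Prod>b\<in>A. cis (f b))"
  by (induction A rule: infinite_finite_induct) (auto simp: cis_mult[symmetric])

lemma gauss_eq_prod: "gauss x = (\<Prod>b\<in>Basis. exp (- (x \<bullet> b)\<^sup>2 / 2))"
proof -
  have "- (norm x)\<^sup>2 / 2 = (\<Sum>b\<in>Basis. - (x \<bullet> b)\<^sup>2 / 2)"
    unfolding power2_norm_eq_inner euclidean_inner[of x x]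
    by (simp add: sum_negf sum_divide_distrib power2_eq_square)
  then show ?thesis unfolding gauss_def by (simp only: exp_sum[OF finite_Basis])
qed

lemma gauss_prod:
  "cis (x \<bullet> \<xi>) * of_real (gauss x) =
     (\<Prod>b\<in>Basis. cis ((x \<bullet> b) * (\<xi> \<bullet> b)) * of_real (exp (- (x \<bullet> b)\<^sup>2 / 2)))"
  unfolding gauss_eq_prod euclidean_inner[of x \<xi>] cis_sum of_real_prod prod.distrib ..

text \<open>Both factorize over the coordinates into the one-dimensional Gaussian integral, which is the
  characteristic function of the normal distribution.\<close>

lemma
  fixes \<xi> :: "'a::euclidean_space"
  shows integrable_gauss_character: "integrable lborel (\<lambda>x::'a. cis (x \<bullet> \<xi>) * of_real (gauss x))"
    and fourier_gauss: "(LINT x|lborel. cis (x \<bullet> \<xi>) * of_real (gauss x))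
      = of_real (sqrt (2 * pi) ^ DIM('a) * gauss \<xi>)"
proof -
  interpret product_sigma_finite "\<lambda>_::'a. lborel :: real measure" ..
  let ?f = "\<lambda>b y. cis (y * (\<xi> \<bullet> b)) * complex_of_real (exp (- y\<^sup>2 / 2))"
  have T[measurable]: "(\<lambda>f. \<Sum>b\<in>(Basis::'a set). f b *\<^sub>R b) \<in> measurable (\<Pi>\<^sub>M b\<in>Basis. lborel) borel"
    by measurable
  have inner: "(\<Sum>b\<in>(Basis::'a set). f b *\<^sub>R b) \<bullet> c = f c" if "c \<in> Basis" for f c
    using that by (simp add: inner_sum_left inner_Basis if_distrib cong: if_cong)
  have eq: "cis ((\<Sum>b\<in>(Basis::'a set). f b *\<^sub>R b) \<bullet> \<xi>) * of_real (gauss (\<Sum>b\<in>(Basis::'a set). f b *\<^sub>R b))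
      = (\<Prod>b\<in>(Basis::'a set). ?f b (f b))" for f
    unfolding gauss_prod by (intro prod.cong refl) (simp add: inner)
  show "integrable lborel (\<lambda>x::'a. cis (x \<bullet> \<xi>) * of_real (gauss x))"
  proof (subst lborel_eq, subst integrable_distr_eq)
    show "integrable (\<Pi>\<^sub>M b\<in>Basis. lborel) (\<lambda>f. cis ((\<Sum>b\<in>(Basis::'a set). f b *\<^sub>R b) \<bullet> \<xi>) *
        complex_of_real (gauss (\<Sum>b\<in>(Basis::'a set). f b *\<^sub>R b)))"
      unfolding eq by (rule product_integrable_prod) (simp, rule gaussian_fourier_real)
  qed measurable
  have "(LINT x|lborel. cis (x \<bullet> \<xi>) * of_real (gauss x)) = (\<Prod>b\<in>(Basis::'a set). LINT y|lborel. ?f b y)"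
  proof (subst lborel_eq, subst integral_distr)
    show "(LINT f|(\<Pi>\<^sub>M b\<in>Basis. lborel). cis ((\<Sum>b\<in>(Basis::'a set). f b *\<^sub>R b) \<bullet> \<xi>) *
        complex_of_real (gauss (\<Sum>b\<in>(Basis::'a set). f b *\<^sub>R b))) = (\<Prod>b\<in>(Basis::'a set). LINT y|lborel. ?f b y)"
      unfolding eq by (rule product_integral_prod) (simp, rule gaussian_fourier_real)
  qed measurable
  also have "\<dots> = of_real (sqrt (2 * pi) ^ DIM('a) * (\<Prod>b\<in>(Basis::'a set). exp (- (\<xi> \<bullet> b)\<^sup>2 / 2)))"
    unfolding gaussian_fourier_real by (simp add: prod.distrib)
  also have "(\<Prod>b\<in>(Basis::'a set). exp (- (\<xi> \<bullet> b)\<^sup>2 / 2)) = gauss \<xi>"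
    by (rule gauss_eq_prod[symmetric])
  finally show "(LINT x|lborel. cis (x \<bullet> \<xi>) * of_real (gauss x)) = of_real (sqrt (2 * pi) ^ DIM('a) * gauss \<xi>)" .
qed

lemma integrable_gauss: "integrable lborel (gauss :: 'a::euclidean_space \<Rightarrow> real)"
  using integrable_norm[OF integrable_gauss_character[of 0]] by (simp add: gauss_def[abs_def])

lemma integral_gauss: "(LINT x|lborel. gauss (x::'a::euclidean_space)) = sqrt (2 * pi) ^ DIM('a)"
proof -
  have "of_real (LINT x|lborel. gauss (x::'a)) = (complex_of_real (sqrt (2 * pi) ^ DIM('a)))"
    using fourier_gauss[of "0::'a"] by (simp add: gauss_def)
  then show ?thesis by (simp only: of_real_eq_iff)
qed

lemma integrable_lborel_affine:
  fixes f :: "'a::euclidean_space \<Rightarrow> 'b::{banach, second_countable_topology}"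
  assumes "integrable lborel f" "c \<noteq> 0"
  shows "integrable lborel (\<lambda>x. f (t + c *\<^sub>R x))"
proof -
  have [measurable]: "f \<in> borel_measurable borel" using assms(1) by simp
  have "integrable (density (distr lborel borel (\<lambda>x. t + c *\<^sub>R x)) (\<lambda>_. \<bar>c\<bar> ^ DIM('a))) f"
    using assms(1) lborel_affine[OF assms(2), of t] by simp
  then have "integrable lborel (\<lambda>x. \<bar>c\<bar> ^ DIM('a) *\<^sub>R f (t + c *\<^sub>R x))"
    by (subst (asm) integrable_density) (auto simp: integrable_distr_eq)
  from integrable_scaleR_right[OF this, of "inverse (\<bar>c\<bar> ^ DIM('a))"] show ?thesis
    using assms(2) by simp
qed

lemma integrable_kernel_product:
  fixes f g :: "'a::euclidean_space \<Rightarrow> complex"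
  assumes f: "integrable lborel f" and g: "integrable lborel g"
    and [measurable]: "(\<lambda>(x, y). k x y) \<in> borel_measurable (borel \<Otimes>\<^sub>M borel)"
    and k: "\<And>x y. norm (k x y) \<le> 1"
  shows "integrable (lborel \<Otimes>\<^sub>M lborel) (\<lambda>(x, y). k x y * (f x * g y))"
proof -
  have [measurable]: "f \<in> borel_measurable borel" "g \<in> borel_measurable borel" using f g by simp_all
  show ?thesis
  proof (rule Bochner_Integration.integrable_bound)
    show "integrable (lborel \<Otimes>\<^sub>M lborel) (\<lambda>(x, y). f x * g y)"
    proof (rule lborel_pair.Fubini_integrable)
      show "integrable lborel (\<lambda>x. LINT y|lborel. norm (case (x, y) of (x, y) \<Rightarrow> f x * g y))"
        using f by (simp add: norm_mult)
      show "AE x in lborel. integrable lborel (\<lambda>y. case (x, y) of (x, y) \<Rightarrow> f x * g y)"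
        using g by simp
    qed measurable
    show "AE p in lborel \<Otimes>\<^sub>M lborel. norm (case p of (x, y) \<Rightarrow> k x y * (f x * g y)) \<le> norm (case p of (x, y) \<Rightarrow> f x * g y)"
    proof (intro AE_I2)
      fix p :: "'a \<times> 'a"
      obtain x y where p: "p = (x, y)" by (cases p)
      show "norm (case p of (x, y) \<Rightarrow> k x y * (f x * g y)) \<le> norm (case p of (x, y) \<Rightarrow> f x * g y)"
        using mult_right_mono[OF k[of x y], of "norm (f x * g y)"] by (simp add: p norm_mult)
    qed
  qed measurable
qed

lemma schwartz_bounded:
  fixes \<phi> :: "'a::euclidean_space \<Rightarrow> complex"
  assumes "\<phi> \<in> schwartz"
  obtains B where "\<And>x. norm (\<phi> x) \<le> B"
proof -
  obtain C where C: "C \<ge> 0" "\<And>x. norm (\<phi> x) \<le> C * decay_weight x"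
    using schwartz_decay[OF assms] by metis
  have "norm (\<phi> x) \<le> C" for x
    using C(2)[of x] mult_left_mono[OF decay_weight_le_1[of x] C(1)] by linarith
  then show ?thesis by (rule that)
qed

text \<open>The double integral is regularized by the factor \<open>gauss (\<epsilon> \<xi>)\<close>. Fubini's theorem and the transform
  of the Gaussian then turn it into an average of \<open>\<psi> (x + \<epsilon> z)\<close> with weight \<open>gauss z\<close>, and both sides
  converge by dominated convergence as \<open>\<epsilon>\<close> tends to 0.\<close>

lemma inv_fourier_fourier:
  fixes \<psi> :: "'a::euclidean_space \<Rightarrow> complex"
  assumes \<psi>: "\<psi> \<in> schwartz"
  shows "inv_fourier (fourier \<psi>) x = \<psi> x"
proof -
  note [measurable] = schwartz_measurable[OF \<psi>] schwartz_measurable[OF schwartz_fourier[OF \<psi>]]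
  define c where "c = sqrt (2 * pi) ^ DIM('a)"
  define A where "A \<epsilon> = (LINT \<xi>|lborel. cis (x \<bullet> \<xi>) * fourier \<psi> \<xi> * of_real (gauss (\<epsilon> *\<^sub>R \<xi>)))" for \<epsilon>
  have A: "A \<epsilon> = of_real c * (LINT z|lborel. \<psi> (x + \<epsilon> *\<^sub>R z) * of_real (gauss z))" if \<epsilon>: "\<epsilon> > 0" for \<epsilon>
  proof -
    have g: "integrable lborel (\<lambda>\<xi>::'a. complex_of_real (gauss (\<epsilon> *\<^sub>R \<xi>)))"
      by (intro integrable_of_real) (use integrable_lborel_affine[OF integrable_gauss, of \<epsilon> 0] \<epsilon> in simp)
    have "A \<epsilon> = (LINT \<xi>|lborel. LINT y|lborel. cis ((x - y) \<bullet> \<xi>) * (\<psi> y * of_real (gauss (\<epsilon> *\<^sub>R \<xi>))))"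
      unfolding A_def
    proof (intro Bochner_Integration.integral_cong refl)
      fix \<xi> :: 'a
      have "cis (x \<bullet> \<xi>) * fourier \<psi> \<xi> * of_real (gauss (\<epsilon> *\<^sub>R \<xi>))
          = (LINT y|lborel. (cis (x \<bullet> \<xi>) * of_real (gauss (\<epsilon> *\<^sub>R \<xi>))) * (cis (- (y \<bullet> \<xi>)) * \<psi> y))"
        unfolding fourier_def by simp
      also have "\<dots> = (LINT y|lborel. cis ((x - y) \<bullet> \<xi>) * (\<psi> y * of_real (gauss (\<epsilon> *\<^sub>R \<xi>))))"
      proof (intro Bochner_Integration.integral_cong refl)
        fix y :: 'a
        have "cis ((x - y) \<bullet> \<xi>) = cis (x \<bullet> \<xi>) * cis (- (y \<bullet> \<xi>))" by (simp add: inner_diff_left cis_mult)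
        then show "(cis (x \<bullet> \<xi>) * of_real (gauss (\<epsilon> *\<^sub>R \<xi>))) * (cis (- (y \<bullet> \<xi>)) * \<psi> y)
            = cis ((x - y) \<bullet> \<xi>) * (\<psi> y * of_real (gauss (\<epsilon> *\<^sub>R \<xi>)))" by (simp only: mult_ac)
      qed
      finally show "cis (x \<bullet> \<xi>) * fourier \<psi> \<xi> * of_real (gauss (\<epsilon> *\<^sub>R \<xi>))
          = (LINT y|lborel. cis ((x - y) \<bullet> \<xi>) * (\<psi> y * of_real (gauss (\<epsilon> *\<^sub>R \<xi>))))" .
    qed
    also have "\<dots> = (LINT y|lborel. LINT \<xi>|lborel. cis ((x - y) \<bullet> \<xi>) * (\<psi> y * of_real (gauss (\<epsilon> *\<^sub>R \<xi>))))"
      by (rule lborel_pair.Fubini_integral)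
         (rule integrable_kernel_product[OF schwartz_integrable[OF \<psi>] g], auto)
    also have "\<dots> = (LINT y|lborel. \<psi> y * of_real (c / \<epsilon> ^ DIM('a) * gauss ((y - x) /\<^sub>R \<epsilon>)))"
    proof (intro Bochner_Integration.integral_cong refl)
      fix y :: 'a
      have "(LINT \<xi>|lborel. cis ((x - y) \<bullet> \<xi>) * of_real (gauss (\<epsilon> *\<^sub>R \<xi>)))
          = (LINT \<xi>|lborel. (\<lambda>\<zeta>. cis (\<zeta> \<bullet> ((x - y) /\<^sub>R \<epsilon>)) * of_real (gauss \<zeta>)) (0 + \<epsilon> *\<^sub>R \<xi>))"
      proof -
        have "(0 + \<epsilon> *\<^sub>R \<xi>) \<bullet> ((x - y) /\<^sub>R \<epsilon>) = (x - y) \<bullet> \<xi>" for \<xi>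
          using \<epsilon> by (simp add: inner_commute[of \<xi>] mult.assoc[symmetric])
        then show ?thesis by (simp only:) simp
      qed
      also have "\<dots> = of_real (1 / \<epsilon> ^ DIM('a)) * (LINT \<zeta>|lborel. cis (\<zeta> \<bullet> ((x - y) /\<^sub>R \<epsilon>)) * of_real (gauss \<zeta>))"
        using \<epsilon> by (subst (2) lborel_integral_affine[where c = \<epsilon> and t = 0]) (auto simp: scaleR_conv_of_real)
      also have "\<dots> = of_real (c / \<epsilon> ^ DIM('a) * gauss ((y - x) /\<^sub>R \<epsilon>))"
        unfolding fourier_gauss c_def by (simp add: gauss_def norm_minus_commute)
      finally have "(LINT \<xi>|lborel. cis ((x - y) \<bullet> \<xi>) * of_real (gauss (\<epsilon> *\<^sub>R \<xi>)))
          = of_real (c / \<epsilon> ^ DIM('a) * gauss ((y - x) /\<^sub>R \<epsilon>))" .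
      moreover have "(LINT \<xi>|lborel. cis ((x - y) \<bullet> \<xi>) * (\<psi> y * of_real (gauss (\<epsilon> *\<^sub>R \<xi>))))
          = \<psi> y * (LINT \<xi>|lborel. cis ((x - y) \<bullet> \<xi>) * of_real (gauss (\<epsilon> *\<^sub>R \<xi>)))"
        unfolding integral_mult_right_zero[symmetric] by (simp only: mult_ac)
      ultimately show "(LINT \<xi>|lborel. cis ((x - y) \<bullet> \<xi>) * (\<psi> y * of_real (gauss (\<epsilon> *\<^sub>R \<xi>))))
          = \<psi> y * of_real (c / \<epsilon> ^ DIM('a) * gauss ((y - x) /\<^sub>R \<epsilon>))" by simp
    qed
    also have "\<dots> = \<bar>\<epsilon>\<bar> ^ DIM('a) *\<^sub>R (LINT z|lborel. \<psi> (x + \<epsilon> *\<^sub>R z) * of_real (c / \<epsilon> ^ DIM('a) * gauss ((x + \<epsilon> *\<^sub>R z - x) /\<^sub>R \<epsilon>)))"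
      by (rule lborel_integral_affine) (use \<epsilon> in auto)
    also have "\<dots> = (LINT z|lborel. of_real (\<epsilon> ^ DIM('a)) * (\<psi> (x + \<epsilon> *\<^sub>R z) * of_real (c / \<epsilon> ^ DIM('a) * gauss z)))"
      using \<epsilon> by (simp add: scaleR_conv_of_real)
    also have "\<dots> = (LINT z|lborel. of_real c * (\<psi> (x + \<epsilon> *\<^sub>R z) * of_real (gauss z)))"
      using \<epsilon> by (intro Bochner_Integration.integral_cong refl) (simp add: field_simps)
    finally show ?thesis by simp
  qed
  define e where "e n = inverse (real (Suc n))" for n
  have e: "e n > 0" for n by (simp add: e_def)
  have e0: "e \<longlonglongrightarrow> 0" unfolding e_def by (rule LIMSEQ_inverse_real_of_nat)
  have gauss_lim: "(\<lambda>n. complex_of_real (gauss (e n *\<^sub>R \<xi>))) \<longlonglongrightarrow> of_real (gauss (0 *\<^sub>R \<xi>))" for \<xi> :: 'a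
    unfolding gauss_def by (intro tendsto_intros e0) simp
  have int_F: "integrable lborel (\<lambda>\<xi>. cis (x \<bullet> \<xi>) * fourier \<psi> \<xi>)"
    by (rule Bochner_Integration.integrable_bound[OF schwartz_integrable[OF schwartz_fourier[OF \<psi>]]])
       (auto simp: norm_mult)
  have "(\<lambda>n. A (e n)) \<longlonglongrightarrow> (LINT \<xi>|lborel. cis (x \<bullet> \<xi>) * fourier \<psi> \<xi>)"
    unfolding A_def
  proof (rule integral_dominated_convergence[where w = "\<lambda>\<xi>. norm (cis (x \<bullet> \<xi>) * fourier \<psi> \<xi>)"])
    show "AE \<xi> in lborel. (\<lambda>n. cis (x \<bullet> \<xi>) * fourier \<psi> \<xi> * of_real (gauss (e n *\<^sub>R \<xi>))) \<longlonglongrightarrow> cis (x \<bullet> \<xi>) * fourier \<psi> \<xi>"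
    proof (rule AE_I2)
      fix \<xi>
      show "(\<lambda>n. cis (x \<bullet> \<xi>) * fourier \<psi> \<xi> * of_real (gauss (e n *\<^sub>R \<xi>))) \<longlonglongrightarrow> cis (x \<bullet> \<xi>) * fourier \<psi> \<xi>"
        using tendsto_mult[OF tendsto_const gauss_lim[of \<xi>]] by (simp add: gauss_def)
    qed
    show "integrable lborel (\<lambda>\<xi>. norm (cis (x \<bullet> \<xi>) * fourier \<psi> \<xi>))" by (rule integrable_norm[OF int_F])
    show "AE \<xi> in lborel. norm (cis (x \<bullet> \<xi>) * fourier \<psi> \<xi> * of_real (gauss (e n *\<^sub>R \<xi>))) \<le> norm (cis (x \<bullet> \<xi>) * fourier \<psi> \<xi>)" for n
    proof (rule AE_I2)
      fix \<xi> :: 'a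
      have "gauss (e n *\<^sub>R \<xi>) \<le> 1" "0 \<le> gauss (e n *\<^sub>R \<xi>)" by (auto simp: gauss_def)
      then show "norm (cis (x \<bullet> \<xi>) * fourier \<psi> \<xi> * of_real (gauss (e n *\<^sub>R \<xi>))) \<le> norm (cis (x \<bullet> \<xi>) * fourier \<psi> \<xi>)"
        by (simp add: norm_mult mult_left_le)
    qed
  qed measurable
  moreover have "(\<lambda>n. A (e n)) \<longlonglongrightarrow> of_real c * (LINT z|lborel. \<psi> x * of_real (gauss (z::'a)))"
    unfolding A[OF e]
  proof (intro tendsto_mult tendsto_const)
    obtain B where B: "\<And>x. norm (\<psi> x) \<le> B" using schwartz_bounded[OF \<psi>] by metis
    show "(\<lambda>n. LINT z|lborel. \<psi> (x + e n *\<^sub>R z) * of_real (gauss z)) \<longlonglongrightarrow> (LINT z|lborel. \<psi> x * of_real (gauss (z::'a)))"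
    proof (rule integral_dominated_convergence[where w = "\<lambda>z::'a. B * gauss z"])
      show "integrable lborel (\<lambda>z::'a. B * gauss z)" by (simp add: integrable_gauss)
      show "AE z in lborel. (\<lambda>n. \<psi> (x + e n *\<^sub>R z) * of_real (gauss z)) \<longlonglongrightarrow> \<psi> x * of_real (gauss z)"
      proof (rule AE_I2)
        fix z
        have "(\<lambda>n. x + e n *\<^sub>R z) \<longlonglongrightarrow> x + 0 *\<^sub>R z" by (intro tendsto_intros e0)
        then have "(\<lambda>n. x + e n *\<^sub>R z) \<longlonglongrightarrow> x" by simp
        moreover have "isCont \<psi> x"
          using schwartz_continuous[OF \<psi>] by (simp add: continuous_on_eq_continuous_at)
        ultimately have "(\<lambda>n. \<psi> (x + e n *\<^sub>R z)) \<longlonglongrightarrow> \<psi> x"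
          using isCont_tendsto_compose by metis
        then show "(\<lambda>n. \<psi> (x + e n *\<^sub>R z) * of_real (gauss z)) \<longlonglongrightarrow> \<psi> x * of_real (gauss z)"
          by (intro tendsto_mult tendsto_const)
      qed
      show "AE z in lborel. norm (\<psi> (x + e n *\<^sub>R z) * of_real (gauss z)) \<le> B * gauss z" for n
        using B by (intro AE_I2) (auto simp: norm_mult gauss_def intro: mult_right_mono)
    qed measurable
  qed
  ultimately have "(LINT \<xi>|lborel. cis (x \<bullet> \<xi>) * fourier \<psi> \<xi>) = of_real c * (LINT z|lborel. \<psi> x * complex_of_real (gauss (z::'a)))"
    by (rule LIMSEQ_unique)
  also have "\<dots> = of_real ((2 * pi) ^ DIM('a)) * \<psi> x"
  proof -
    have cc: "c * c = (2 * pi) ^ DIM('a)" unfolding c_def power_mult_distrib[symmetric] by simp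
    have "of_real c * (LINT z|lborel. \<psi> x * complex_of_real (gauss (z::'a)))
        = of_real c * (\<psi> x * of_real (LINT z|lborel. gauss (z::'a)))" by simp
    also have "\<dots> = of_real (c * c) * \<psi> x" unfolding integral_gauss c_def[symmetric] of_real_mult by (simp only: mult_ac)
    finally show ?thesis unfolding cc .
  qed
  finally show ?thesis unfolding inv_fourier_def by simp
qed

lemma fourier_inv_fourier:
  fixes \<phi> :: "'a::euclidean_space \<Rightarrow> complex"
  assumes \<phi>: "\<phi> \<in> schwartz"
  shows "fourier (inv_fourier \<phi>) \<xi> = \<phi> \<xi>"
proof -
  note [measurable] = schwartz_measurable[OF schwartz_fourier[OF \<phi>]]
  let ?k = "complex_of_real (1 / (2 * pi) ^ DIM('a))"
  have "fourier (inv_fourier \<phi>) \<xi> = ?k * (LINT x|lborel. cis (- (x \<bullet> \<xi>)) * fourier \<phi> (- x))"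
    unfolding fourier_def[of "inv_fourier \<phi>"] inv_fourier_eq integral_mult_right_zero[symmetric]
    by (simp only: mult_ac)
  also have "(LINT x|lborel. cis (- (x \<bullet> \<xi>)) * fourier \<phi> (- x)) = (LINT x|lborel. cis (x \<bullet> \<xi>) * fourier \<phi> x)"
    by (subst (2) lborel_integral_affine[where c = "-1" and t = 0]) auto
  also have "?k * \<dots> = inv_fourier (fourier \<phi>) \<xi>" unfolding inv_fourier_def by (simp add: inner_commute)
  finally show ?thesis using inv_fourier_fourier[OF \<phi>] by simp
qed

text \<open>Writing out the conjugate transform and exchanging the integrals reduces this to inversion.\<close>

lemma plancherel:
  fixes \<psi> :: "'a::euclidean_space \<Rightarrow> complex"
  assumes \<psi>: "\<psi> \<in> schwartz"
  shows "(LINT \<xi>|lborel. (norm (fourier \<psi> \<xi>))\<^sup>2) = (2 * pi) ^ DIM('a) * (LINT x|lborel. (norm (\<psi> x))\<^sup>2)"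
proof -
  note [measurable] = schwartz_measurable[OF \<psi>] schwartz_measurable[OF schwartz_fourier[OF \<psi>]]
  have cnj_int: "integrable lborel (\<lambda>x. cnj (\<psi> x))" using schwartz_integrable[OF \<psi>] by simp
  have "(LINT \<xi>|lborel. fourier \<psi> \<xi> * cnj (fourier \<psi> \<xi>))
      = (LINT \<xi>|lborel. LINT x|lborel. cis (x \<bullet> \<xi>) * (cnj (\<psi> x) * fourier \<psi> \<xi>))"
  proof (intro Bochner_Integration.integral_cong refl)
    fix \<xi>
    have "cnj (fourier \<psi> \<xi>) = (LINT x|lborel. cis (x \<bullet> \<xi>) * cnj (\<psi> x))"
    proof -
      have "cnj (fourier \<psi> \<xi>) = (LINT x|lborel. cnj (cis (- (x \<bullet> \<xi>)) * \<psi> x))"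
        unfolding fourier_def by (rule Bochner_Integration.integral_cnj[symmetric])
      then show ?thesis by (simp add: cis_cnj)
    qed
    then show "fourier \<psi> \<xi> * cnj (fourier \<psi> \<xi>) = (LINT x|lborel. cis (x \<bullet> \<xi>) * (cnj (\<psi> x) * fourier \<psi> \<xi>))"
      unfolding mult.assoc[symmetric] by simp
  qed
  also have "\<dots> = (LINT x|lborel. LINT \<xi>|lborel. cis (x \<bullet> \<xi>) * (cnj (\<psi> x) * fourier \<psi> \<xi>))"
    by (rule lborel_pair.Fubini_integral)
       (rule integrable_kernel_product[OF cnj_int schwartz_integrable[OF schwartz_fourier[OF \<psi>]]], auto)
  also have "\<dots> = (LINT x|lborel. of_real ((2 * pi) ^ DIM('a)) * (\<psi> x * cnj (\<psi> x)))"
  proof (intro Bochner_Integration.integral_cong refl)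
    fix x
    have "(LINT \<xi>|lborel. cis (x \<bullet> \<xi>) * fourier \<psi> \<xi>) = of_real ((2 * pi) ^ DIM('a)) * \<psi> x"
      using inv_fourier_fourier[OF \<psi>, of x] unfolding inv_fourier_def by (simp add: field_simps)
    moreover have "(LINT \<xi>|lborel. cis (x \<bullet> \<xi>) * (cnj (\<psi> x) * fourier \<psi> \<xi>))
        = cnj (\<psi> x) * (LINT \<xi>|lborel. cis (x \<bullet> \<xi>) * fourier \<psi> \<xi>)"
      unfolding integral_mult_right_zero[symmetric] by (simp only: mult_ac)
    ultimately show "(LINT \<xi>|lborel. cis (x \<bullet> \<xi>) * (cnj (\<psi> x) * fourier \<psi> \<xi>))
        = of_real ((2 * pi) ^ DIM('a)) * (\<psi> x * cnj (\<psi> x))" by (simp only: mult_ac)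
  qed
  also have "\<dots> = of_real ((2 * pi) ^ DIM('a) * (LINT x|lborel. (norm (\<psi> x))\<^sup>2))"
    unfolding complex_norm_square[symmetric] of_real_power[symmetric] by (simp del: of_real_power)
  finally have "complex_of_real (LINT \<xi>|lborel. (norm (fourier \<psi> \<xi>))\<^sup>2)
      = of_real ((2 * pi) ^ DIM('a) * (LINT x|lborel. (norm (\<psi> x))\<^sup>2))"
    unfolding complex_norm_square[symmetric] of_real_power[symmetric] by (simp del: of_real_power)
  then show ?thesis by (simp only: of_real_eq_iff)
qed

section \<open>A uniform boundedness principle\<close>

text \<open>The uniform boundedness principle for functionals on \<open>\<ell>\<^sup>1\<close>, by a gliding hump. If the \<open>a s n\<close> were
  unbounded, one could choose \<open>s\<^sub>k\<close>, \<open>n\<^sub>k\<close> and weights \<open>e\<^sub>k\<close> one after the other such that, in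
  \<open>\<Sum>k. e\<^sub>k a s\<^sub>j n\<^sub>k\<close>, the \<open>j\<close>-th term exceeds the sum of the earlier ones by \<open>j + 1\<close>, while the
  later weights are so small that the later terms sum up to at most 1. This one combination is then
  unbounded in \<open>s\<close>.\<close>

lemma uniform_bound_of_summable_combinations:
  fixes a :: "'s \<Rightarrow> 'i \<Rightarrow> complex"
  assumes pointwise: "\<And>s. s \<in> S \<Longrightarrow> \<exists>C. \<forall>n. norm (a s n) \<le> C"
    and coordinate: "\<And>n. \<exists>B. \<forall>s\<in>S. norm (a s n) \<le> B"
    and combination: "\<And>(n::nat \<Rightarrow> 'i) (x::nat \<Rightarrow> real). (\<And>k. x k > 0) \<Longrightarrow> summable x \<Longrightarrow>
       \<exists>B. \<forall>s\<in>S. norm (\<Sum>k. of_real (x k) * a s (n k)) \<le> B"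
  shows "\<exists>B. \<forall>s\<in>S. \<forall>n. norm (a s n) \<le> B"
proof (rule ccontr)
  assume "\<not> ?thesis"
  then have large: "\<exists>s\<in>S. \<exists>n. norm (a s n) > B" for B by (meson not_le)
  obtain C0 where C0: "\<And>s n. s \<in> S \<Longrightarrow> norm (a s n) \<le> C0 s" using pointwise by metis
  define C where "C s = \<bar>C0 s\<bar>" for s
  have C: "norm (a s n) \<le> C s" if "s \<in> S" for s n
    using C0[OF that, of n] unfolding C_def by linarith
  have C_nonneg: "C s \<ge> 0" for s by (simp add: C_def)
  obtain b where b: "\<And>s n. s \<in> S \<Longrightarrow> norm (a s n) \<le> b n" using coordinate by metis
  \<comment> \<open>A stage consists of the parameter, the index, the weight and the bound for the earlier terms.\<close>
  define P where "P k st = (case st of (s, n, e, E) \<Rightarrow>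
      s \<in> S \<and> 0 < e \<and> e \<le> 1 \<and> e * norm (a s n) \<ge> real k + E + 1 \<and> (k = 0 \<longrightarrow> E = 0))"
    for k :: nat and st :: "'s \<times> 'i \<times> real \<times> real"
  define Q where "Q st st' = (case st of (s, n, e, E) \<Rightarrow> case st' of (s', n', e', E') \<Rightarrow>
      e' = e / (2 * (1 + C s)) \<and> E' = E + e * b n)"
    for st st' :: "'s \<times> 'i \<times> real \<times> real"
  have ex: "\<exists>s n. s \<in> S \<and> e * norm (a s n) \<ge> B" if "e > 0" for e B
  proof -
    obtain s n where "s \<in> S" "norm (a s n) > B / e" using large by blast
    then show ?thesis using that by (auto simp: field_simps intro!: exI[of _ s] exI[of _ n])
  qed
  have "\<exists>f. \<forall>k. P k (f k) \<and> Q (f k) (f (Suc k))"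
  proof (rule dependent_nat_choice)
    obtain s n where "s \<in> S" "1 * norm (a s n) \<ge> 1" using ex[of 1 1] by auto
    then have "P 0 (s, n, 1, 0)" by (simp add: P_def)
    then show "\<exists>st. P 0 st" by blast
  next
    fix st k assume "P k st"
    moreover obtain s n e E where st: "st = (s, n, e, E)" by (cases st)
    ultimately have e: "0 < e" "e \<le> 1" "s \<in> S" by (auto simp: P_def)
    define e' where "e' = e / (2 * (1 + C s))"
    have e': "0 < e'" "e' \<le> 1"
      using e C_nonneg[of s] by (auto simp: e'_def divide_le_eq intro!: divide_pos_pos mult_pos_pos)
    obtain s' n' where "s' \<in> S" "e' * norm (a s' n') \<ge> real (Suc k) + (E + e * b n) + 1"
      using ex[OF e'(1)] by blast
    then have "P (Suc k) (s', n', e', E + e * b n)" using e' by (simp add: P_def)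
    moreover have "Q st (s', n', e', E + e * b n)" by (simp add: Q_def st e'_def)
    ultimately show "\<exists>st'. P (Suc k) st' \<and> Q st st'" by blast
  qed
  then obtain f where f: "\<And>k. P k (f k)" "\<And>k. Q (f k) (f (Suc k))" by blast
  define s where "s k = fst (f k)" for k
  define n where "n k = fst (snd (f k))" for k
  define e where "e k = fst (snd (snd (f k)))" for k
  define E where "E k = snd (snd (snd (f k)))" for k
  have fk: "f k = (s k, n k, e k, E k)" for k by (simp add: s_def n_def e_def E_def)
  have s: "s k \<in> S" and e: "0 < e k" "e k \<le> 1" and hump: "e k * norm (a (s k) (n k)) \<ge> real k + E k + 1"
    and E0: "E 0 = 0" for k
    using f(1)[of k] f(1)[of 0] by (auto simp: P_def fk)
  have e_Suc: "e (Suc k) = e k / (2 * (1 + C (s k)))" and E_Suc: "E (Suc k) = E k + e k * b (n k)" for k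
    using f(2)[of k] by (auto simp: Q_def fk)
  have E_eq: "E k = (\<Sum>l<k. e l * b (n l))" for k by (induction k) (auto simp: E0 E_Suc)
  \<comment> \<open>The weights at least halve, and the factor \<open>1 + C (s k)\<close> makes them small against \<open>a (s k)\<close>.\<close>
  have half: "e (Suc k) \<le> e k / 2" for k
    using C_nonneg[of "s k"] e(1)[of k] unfolding e_Suc by (intro divide_left_mono) auto
  have tail: "e (k + j) \<le> e j * (1 / 2) ^ k" for k j
  proof (induction k)
    case (Suc k)
    then show ?case using half[of "k + j"] by simp
  qed simp
  have sum_geo: "summable (\<lambda>k. c * (1 / 2 :: real) ^ k)" for c by (intro summable_mult summable_geometric) simp
  have suminf_geo: "(\<Sum>k. c * (1 / 2 :: real) ^ k) = c * 2" for c
    by (subst suminf_mult) (auto simp: suminf_geometric intro: summable_geometric)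
  have e_summable: "summable (\<lambda>k. e (k + j))" for j
    by (rule summable_comparison_test'[where N = 0, OF sum_geo[of "e j"]]) (use tail e(1) in \<open>simp add: abs_of_pos\<close>)
  have "summable e" using e_summable[of 0] by simp
  then obtain B where B: "\<And>t. t \<in> S \<Longrightarrow> norm (\<Sum>k. of_real (e k) * a t (n k)) \<le> B"
    using combination[of e n] e(1) by blast
  have "real j \<le> B" for j
  proof -
    let ?g = "\<lambda>k. complex_of_real (e k) * a (s j) (n k)"
    have bound: "norm (?g k) \<le> e k * C (s j)" for k
      using C[OF s] e(1)[of k] by (simp add: norm_mult mult_left_mono)
    have sum_norm: "summable (\<lambda>k. norm (?g (k + i)))" for i
      by (rule summable_comparison_test'[where N = 0, OF summable_mult2[OF e_summable[of i], of "C (s j)"]]) (use bound in auto)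
    have "norm (\<Sum>k. ?g (k + Suc j)) \<le> (\<Sum>k. norm (?g (k + Suc j)))"
      by (rule summable_norm[OF sum_norm])
    also have "\<dots> \<le> (\<Sum>k. (e (Suc j) * C (s j)) * (1 / 2) ^ k)"
    proof (rule suminf_le[OF _ sum_norm sum_geo])
      fix k
      show "norm (?g (k + Suc j)) \<le> (e (Suc j) * C (s j)) * (1 / 2) ^ k"
        using bound[of "k + Suc j"] mult_right_mono[OF tail[of k "Suc j"] C_nonneg[of "s j"]]
        by (simp add: mult_ac)
    qed
    also have "\<dots> = e j * (C (s j) / (1 + C (s j)))"
      unfolding suminf_geo e_Suc using C_nonneg[of "s j"] by (simp add: field_simps)
    also have "\<dots> \<le> 1 * 1"
      using e[of j] C_nonneg[of "s j"] by (intro mult_mono) (auto simp: divide_le_eq)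
    finally have tail_le: "norm (\<Sum>k. ?g (k + Suc j)) \<le> 1" by simp
    have "norm (\<Sum>k<j. ?g k) \<le> (\<Sum>k<j. norm (?g k))" by (rule norm_sum)
    also have "\<dots> \<le> E j"
      unfolding E_eq using b[OF s] e(1) by (intro sum_mono) (simp add: norm_mult mult_left_mono less_imp_le)
    finally have head_le: "norm (\<Sum>k<j. ?g k) \<le> E j" .
    have "summable ?g" using summable_norm_cancel[of ?g] sum_norm[of 0] by simp
    then have "(\<Sum>k. ?g k) = (\<Sum>k. ?g (k + Suc j)) + (\<Sum>k<Suc j. ?g k)"
      by (rule suminf_split_initial_segment)
    then have "?g j = (\<Sum>k. ?g k) - (\<Sum>k. ?g (k + Suc j)) - (\<Sum>k<j. ?g k)" by simp
    then have "norm (?g j) \<le> norm (\<Sum>k. ?g k) + norm (\<Sum>k. ?g (k + Suc j)) + norm (\<Sum>k<j. ?g k)"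
      using norm_triangle_ineq4[of "(\<Sum>k. ?g k) - (\<Sum>k. ?g (k + Suc j))" "\<Sum>k<j. ?g k"]
        norm_triangle_ineq4[of "\<Sum>k. ?g k" "\<Sum>k. ?g (k + Suc j)"] by (simp only:)
    moreover have "norm (?g j) = e j * norm (a (s j) (n j))" using e(1)[of j] by (simp add: norm_mult)
    ultimately show ?thesis using hump[of j] tail_le head_le B[OF s[of j]] by linarith
  qed
  then show False using reals_Archimedean2[of B] by (meson not_le)
qed

section \<open>The flow of the linear problem on the Fourier side\<close>

text \<open>The Weierstrass M-test with majorant \<open>x\<close>.\<close>

lemma holomorphic_series:
  fixes g :: "nat \<Rightarrow> complex \<Rightarrow> complex" and x :: "nat \<Rightarrow> real"
  assumes hol: "\<And>k. g k holomorphic_on ball 0 R" and le: "\<And>k z. z \<in> ball 0 R \<Longrightarrow> norm (g k z) \<le> 1"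
    and x: "\<And>k. x k \<ge> 0" "summable x"
  shows "(\<lambda>z. \<Sum>k. of_real (x k) * g k z) holomorphic_on ball 0 R"
    and "z \<in> ball 0 R \<Longrightarrow> norm (\<Sum>k. of_real (x k) * g k z) \<le> suminf x"
    and "z \<in> ball 0 R \<Longrightarrow> summable (\<lambda>k. of_real (x k) * g k z)"
proof -
  have le_x: "norm (of_real (x k) * g k z) \<le> x k" if "z \<in> ball 0 R" for k z
    using mult_left_mono[OF le[OF that] x(1)[of k]] x(1)[of k] by (simp add: norm_mult)
  have abs: "summable (\<lambda>k. norm (of_real (x k) * g k z))" if "z \<in> ball 0 R" for z
    by (rule summable_comparison_test'[where N = 0, OF x(2)]) (use le_x[OF that] in auto)
  show "z \<in> ball 0 R \<Longrightarrow> summable (\<lambda>k. of_real (x k) * g k z)"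
    by (rule summable_norm_cancel[OF abs])
  show "norm (\<Sum>k. of_real (x k) * g k z) \<le> suminf x" if "z \<in> ball 0 R"
    using summable_norm[OF abs[OF that]] suminf_le[OF le_x[OF that] abs[OF that] x(2)] by linarith
  have unif: "uniform_limit (ball 0 R) (\<lambda>n z. \<Sum>k<n. of_real (x k) * g k z) (\<lambda>z. \<Sum>k. of_real (x k) * g k z) sequentially"
    by (rule Weierstrass_m_test[OF le_x x(2)])
  show "(\<lambda>z. \<Sum>k. of_real (x k) * g k z) holomorphic_on ball 0 R"
  proof (rule holomorphic_uniform_sequence[OF open_ball])
    show "(\<lambda>z. \<Sum>k<n. of_real (x k) * g k z) holomorphic_on ball 0 R" for n
      by (intro holomorphic_intros hol)
    fix z :: complex assume "z \<in> ball 0 R"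
    then obtain d where d: "d > 0" "cball z d \<subseteq> ball 0 R"
      using open_contains_cball[of "ball 0 R"] open_ball by blast
    then show "\<exists>d>0. cball z d \<subseteq> ball 0 R \<and>
        uniform_limit (cball z d) (\<lambda>n z. \<Sum>k<n. of_real (x k) * g k z) (\<lambda>z. \<Sum>k. of_real (x k) * g k z) sequentially"
      using uniform_limit_on_subset[OF unif] by blast
  qed
qed

text \<open>The symbol of \<open>- \<Delta> P\<close>; as \<open>1 - 1 / (1 + |x|\<^sup>2)\<close> it visibly lies between 0 and 1.\<close>

definition symbol :: "'a::euclidean_space \<Rightarrow> real" where
  "symbol x = 1 - inverse (1 + x \<bullet> x)"

lemma symbol_bounds: "0 \<le> symbol x" "symbol x \<le> 1" "\<bar>symbol x\<bar> \<le> 1"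
  unfolding symbol_def using bessel_symbol_bounds[of x] by auto

lemma slow_symbol: "slow_family (\<lambda>_. symbol)"
proof -
  have "slow_family (\<lambda>_ x. (\<lambda>_. 1) x + (- 1) * inverse (1 + x \<bullet> x) :: real)"
    by (intro slow_family_add slow_family_cmult slow_bessel_symbol slow_family_const[where B = 1]) simp
  then show ?thesis by (simp add: symbol_def[abs_def])
qed

lemma schwartz_family_symbol:
  assumes "bounded_holomorphic 2 f" "\<psi> \<in> schwartz"
  shows "schwartz_family (\<lambda>j x. f j (of_real (symbol x)) * \<psi> x)"
  by (intro slow_mult_schwartz_family slow_family_holomorphic[OF slow_symbol symbol_bounds(3) assms(1)]
      schwartz_constant_family[OF assms(2)]) simp

lemma schwartz_symbol:
  assumes "f holomorphic_on ball 0 2" "\<And>z. z \<in> ball 0 2 \<Longrightarrow> norm (f z) \<le> B" "\<psi> \<in> schwartz"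
  shows "(\<lambda>x. f (of_real (symbol x)) * \<psi> x) \<in> schwartz"
proof -
  have "bounded_holomorphic 2 (\<lambda>_::unit. f)" using assms unfolding bounded_holomorphic_def by blast
  then show ?thesis using schwartz_family_symbol[OF _ assms(3)] by (simp add: schwartz_iff)
qed

text \<open>Linearity and boundedness on bounded sequences are all that the flow uses of the Fourier transform of
  a tempered distribution.\<close>

definition schwartz_linear :: "(('a::euclidean_space \<Rightarrow> complex) \<Rightarrow> complex) \<Rightarrow> bool" where
  "schwartz_linear v \<longleftrightarrow>
     (\<forall>\<phi>\<in>schwartz. \<forall>\<psi>\<in>schwartz. \<forall>a b. v (\<lambda>x. a * \<phi> x + b * \<psi> x) = a * v \<phi> + b * v \<psi>)"

definition bounded_on_schwartz :: "(('a::euclidean_space \<Rightarrow> complex) \<Rightarrow> complex) \<Rightarrow> bool" where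
  "bounded_on_schwartz v \<longleftrightarrow>
     (\<forall>\<Phi>::nat \<Rightarrow> _. schwartz_family \<Phi> \<longrightarrow> (\<exists>C. \<forall>j. norm (v (\<Phi> j)) \<le> C))"

lemma schwartz_linearD:
  assumes "schwartz_linear v" "\<phi> \<in> schwartz" "\<psi> \<in> schwartz"
  shows "v (\<lambda>x. a * \<phi> x + b * \<psi> x) = a * v \<phi> + b * v \<psi>"
    "v (\<lambda>x. a * \<phi> x) = a * v \<phi>"
proof -
  show *: "v (\<lambda>x. a * \<phi> x + b * \<psi> x) = a * v \<phi> + b * v \<psi>" for b
    using assms unfolding schwartz_linear_def by blast
  show "v (\<lambda>x. a * \<phi> x) = a * v \<phi>" using *[of 0] by simp
qed

text \<open>The remainder after \<open>N\<close> terms, divided by the tail \<open>\<tau> N\<close> of the scalar series, is bounded by 1 on the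
  disc. Applied to the symbol these normalized remainders form a bounded family, so \<open>v\<close> maps the
  remainder itself to something of size \<open>O(\<tau> N)\<close>.\<close>

lemma symbol_series_sums:
  fixes v :: "('a::euclidean_space \<Rightarrow> complex) \<Rightarrow> complex" and x :: "nat \<Rightarrow> real"
  assumes v: "schwartz_linear v" "bounded_on_schwartz v" and \<psi>: "\<psi> \<in> schwartz"
    and hol: "\<And>k. g k holomorphic_on ball 0 2" and le: "\<And>k z. z \<in> ball 0 2 \<Longrightarrow> norm (g k z) \<le> 1"
    and x: "\<And>k. x k > 0" "summable x"
  shows "(\<lambda>k. of_real (x k) * v (\<lambda>\<xi>. g k (of_real (symbol \<xi>)) * \<psi> \<xi>)) sums
     v (\<lambda>\<xi>. (\<Sum>k. of_real (x k) * g k (of_real (symbol \<xi>))) * \<psi> \<xi>)"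
proof -
  define \<tau> where "\<tau> N = (\<Sum>k. x (k + N))" for N
  have x_tail: "summable (\<lambda>k. x (k + N))" for N using x(2) by (simp add: summable_iff_shift)
  have \<tau>_pos: "\<tau> N > 0" for N unfolding \<tau>_def by (rule suminf_pos[OF x_tail]) (rule x(1))
  have \<tau>_lim: "\<tau> \<longlonglongrightarrow> 0"
  proof -
    have "\<tau> = (\<lambda>N. suminf x - (\<Sum>k<N. x k))"
      unfolding \<tau>_def using suminf_minus_initial_segment[OF x(2)] by auto
    moreover have "(\<lambda>N. suminf x - (\<Sum>k<N. x k)) \<longlonglongrightarrow> suminf x - suminf x"
      by (intro tendsto_diff tendsto_const summable_LIMSEQ x(2))
    ultimately show ?thesis by simp
  qed
  let ?t = "\<lambda>N z. \<Sum>k. of_real (x (k + N)) * g (k + N) z"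
  define h where "h N z = of_real (1 / \<tau> N) * ?t N z" for N z
  have ball: "complex_of_real (symbol \<xi>) \<in> ball 0 2" for \<xi> :: 'a
    using symbol_bounds[of \<xi>] by simp
  have tail: "?t N holomorphic_on ball 0 2" "z \<in> ball 0 2 \<Longrightarrow> norm (?t N z) \<le> (\<Sum>k. x (k + N))"
      "z \<in> ball 0 2 \<Longrightarrow> summable (\<lambda>k. of_real (x (k + N)) * g (k + N) z)" for N z
    using holomorphic_series[where g = "\<lambda>k. g (k + N)" and x = "\<lambda>k. x (k + N)",
        OF hol le less_imp_le[OF x(1)] x_tail] by simp_all
  have t_schwartz: "(\<lambda>\<xi>. ?t N (of_real (symbol \<xi>)) * \<psi> \<xi>) \<in> schwartz" for N
    by (rule schwartz_symbol[OF tail(1) tail(2) \<psi>])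
  have g_schwartz: "(\<lambda>\<xi>. g k (of_real (symbol \<xi>)) * \<psi> \<xi>) \<in> schwartz" for k
    by (rule schwartz_symbol[OF hol le \<psi>])
  have "bounded_holomorphic 2 h"
    unfolding bounded_holomorphic_def
  proof (intro conjI allI exI[of _ 1] ballI)
    show "h N holomorphic_on ball 0 2" for N
      unfolding h_def[abs_def] by (intro holomorphic_intros tail(1))
    fix N and z :: complex assume "z \<in> ball 0 2"
    then have "norm (?t N z) \<le> \<tau> N" unfolding \<tau>_def by (rule tail(2))
    then show "norm (h N z) \<le> 1" using \<tau>_pos[of N] by (simp add: h_def norm_mult norm_divide divide_le_eq)
  qed
  then have fam: "schwartz_family (\<lambda>N \<xi>. h N (of_real (symbol \<xi>)) * \<psi> \<xi>)"
    by (rule schwartz_family_symbol[OF _ \<psi>])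
  have "\<exists>C. \<forall>N. norm (v (\<lambda>\<xi>. h N (of_real (symbol \<xi>)) * \<psi> \<xi>)) \<le> C"
    using v(2)[unfolded bounded_on_schwartz_def, rule_format, OF fam] .
  then obtain C where C: "\<forall>N. norm (v (\<lambda>\<xi>. h N (of_real (symbol \<xi>)) * \<psi> \<xi>)) \<le> C" ..
  let ?w = "\<lambda>k. of_real (x k) * v (\<lambda>\<xi>. g k (of_real (symbol \<xi>)) * \<psi> \<xi>)"
  have split: "v (\<lambda>\<xi>. ?t 0 (of_real (symbol \<xi>)) * \<psi> \<xi>) = (\<Sum>k<N. ?w k) + v (\<lambda>\<xi>. ?t N (of_real (symbol \<xi>)) * \<psi> \<xi>)" for N
  proof (induction N)
    case (Suc N)
    have "?t N z = of_real (x N) * g N z + ?t (Suc N) z" if "z \<in> ball 0 2" for z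
      using suminf_split_head[OF tail(3)[OF that, of N]] by (simp add: algebra_simps)
    then have eq: "(\<lambda>\<xi>. ?t N (of_real (symbol \<xi>)) * \<psi> \<xi>) =
        (\<lambda>\<xi>. of_real (x N) * (g N (of_real (symbol \<xi>)) * \<psi> \<xi>) + 1 * (?t (Suc N) (of_real (symbol \<xi>)) * \<psi> \<xi>))"
      using ball by (intro ext) (simp only: distrib_right mult.assoc mult_1)
    have "v (\<lambda>\<xi>. ?t N (of_real (symbol \<xi>)) * \<psi> \<xi>) = ?w N + v (\<lambda>\<xi>. ?t (Suc N) (of_real (symbol \<xi>)) * \<psi> \<xi>)"
      unfolding eq schwartz_linearD(1)[OF v(1) g_schwartz t_schwartz] by (simp only: mult_1)
    then show ?case using Suc.IH by (simp only: sum.lessThan_Suc add.assoc)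
  qed simp
  have err: "norm (v (\<lambda>\<xi>. ?t N (of_real (symbol \<xi>)) * \<psi> \<xi>)) \<le> \<tau> N * C" for N
  proof -
    have eq: "(\<lambda>\<xi>. h N (of_real (symbol \<xi>)) * \<psi> \<xi>) = (\<lambda>\<xi>. of_real (1 / \<tau> N) * (?t N (of_real (symbol \<xi>)) * \<psi> \<xi>))"
      by (simp add: h_def mult.assoc)
    have "v (\<lambda>\<xi>. h N (of_real (symbol \<xi>)) * \<psi> \<xi>) = of_real (1 / \<tau> N) * v (\<lambda>\<xi>. ?t N (of_real (symbol \<xi>)) * \<psi> \<xi>)"
      unfolding eq by (rule schwartz_linearD(2)[OF v(1) t_schwartz \<psi>])
    then have "norm (v (\<lambda>\<xi>. ?t N (of_real (symbol \<xi>)) * \<psi> \<xi>)) / \<tau> N \<le> C"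
      using C[rule_format, of N] \<tau>_pos[of N] by (simp add: norm_mult norm_divide)
    then show ?thesis using \<tau>_pos[of N] by (simp add: pos_divide_le_eq mult.commute)
  qed
  have "(\<lambda>N. v (\<lambda>\<xi>. ?t N (of_real (symbol \<xi>)) * \<psi> \<xi>)) \<longlonglongrightarrow> 0"
  proof (rule Lim_null_comparison[OF always_eventually])
    show "\<forall>N. norm (v (\<lambda>\<xi>. ?t N (of_real (symbol \<xi>)) * \<psi> \<xi>)) \<le> \<tau> N * C" using err by blast
    show "(\<lambda>N. \<tau> N * C) \<longlonglongrightarrow> 0" using tendsto_mult_left_zero[OF \<tau>_lim] .
  qed
  then have "(\<lambda>N. v (\<lambda>\<xi>. ?t 0 (of_real (symbol \<xi>)) * \<psi> \<xi>) - v (\<lambda>\<xi>. ?t N (of_real (symbol \<xi>)) * \<psi> \<xi>))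
      \<longlonglongrightarrow> v (\<lambda>\<xi>. ?t 0 (of_real (symbol \<xi>)) * \<psi> \<xi>) - 0"
    by (intro tendsto_diff tendsto_const)
  moreover have "v (\<lambda>\<xi>. ?t 0 (of_real (symbol \<xi>)) * \<psi> \<xi>) - v (\<lambda>\<xi>. ?t N (of_real (symbol \<xi>)) * \<psi> \<xi>) = (\<Sum>k<N. ?w k)" for N
    using split[of N] by simp
  ultimately show ?thesis unfolding sums_def by simp
qed

lemma schwartz_symbol_power:
  assumes "\<psi> \<in> schwartz"
  shows "(\<lambda>\<xi>. (of_real (symbol \<xi>) / 2) ^ n * \<psi> \<xi>) \<in> schwartz"
    "(\<lambda>\<xi>. of_real (symbol \<xi>) ^ n * \<psi> \<xi>) \<in> schwartz"
proof -
  show "(\<lambda>\<xi>. (of_real (symbol \<xi>) / 2) ^ n * \<psi> \<xi>) \<in> schwartz"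
    by (rule schwartz_symbol[OF _ _ assms, where B = 1])
       (auto intro!: holomorphic_intros power_le_one simp: norm_power norm_divide)
  show "(\<lambda>\<xi>. of_real (symbol \<xi>) ^ n * \<psi> \<xi>) \<in> schwartz"
    by (rule schwartz_symbol[OF _ _ assms, where B = "2 ^ n"])
       (auto intro!: holomorphic_intros power_mono simp: norm_power)
qed

text \<open>A summable combination of the functions \<open>(m/2)\<^sup>n \<psi>\<close> is again a Schwartz function. Its pairing with
  \<open>V s\<close> is therefore continuous in \<open>s\<close> and bounded on the compact interval, which is what
  the uniform boundedness principle asks for.\<close>

lemma flow_uniform_bound:
  fixes V :: "real \<Rightarrow> ('a::euclidean_space \<Rightarrow> complex) \<Rightarrow> complex"
  assumes lin: "\<And>s. s \<ge> 0 \<Longrightarrow> schwartz_linear (V s)"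
    and bdd: "\<And>s. s \<ge> 0 \<Longrightarrow> bounded_on_schwartz (V s)"
    and cont: "\<And>\<psi>. \<psi> \<in> schwartz \<Longrightarrow> continuous_on {0..} (\<lambda>s. V s \<psi>)"
    and \<psi>: "\<psi> \<in> schwartz"
  shows "\<exists>B. \<forall>s\<in>{0..T}. \<forall>n. norm (V s (\<lambda>\<xi>. (of_real (symbol \<xi>) / 2) ^ n * \<psi> \<xi>)) \<le> B"
proof -
  have sup: "\<exists>B. \<forall>s\<in>{0..T}. norm (V s \<phi>) \<le> B" if "\<phi> \<in> schwartz" for \<phi>
  proof -
    have "continuous_on {0..T} (\<lambda>s. V s \<phi>)" by (rule continuous_on_subset[OF cont[OF that]]) auto
    then have "bounded ((\<lambda>s. V s \<phi>) ` {0..T})"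
      by (intro compact_imp_bounded compact_continuous_image compact_Icc)
    then show ?thesis unfolding bounded_iff by blast
  qed
  have pow: "(\<lambda>z. (z / 2) ^ n) holomorphic_on ball 0 2" "z \<in> ball 0 2 \<Longrightarrow> norm ((z / 2) ^ n) \<le> 1"
    for n and z :: complex
    by (auto intro!: holomorphic_intros power_le_one simp: norm_power norm_divide)
  show ?thesis
  proof (rule uniform_bound_of_summable_combinations)
    fix s :: real assume s: "s \<in> {0..T}"
    have "schwartz_family (\<lambda>n x. (of_real (symbol x) / 2) ^ n * \<psi> x)"
      by (rule schwartz_family_symbol[where f = "\<lambda>n z. (z / 2) ^ n", OF _ \<psi>])
         (use pow in \<open>auto simp: bounded_holomorphic_def intro!: exI[of _ 1]\<close>)
    from bdd[of s, unfolded bounded_on_schwartz_def, rule_format, OF _ this]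
    show "\<exists>C. \<forall>n. norm (V s (\<lambda>\<xi>. (of_real (symbol \<xi>) / 2) ^ n * \<psi> \<xi>)) \<le> C" using s by simp
  next
    show "\<exists>B. \<forall>s\<in>{0..T}. norm (V s (\<lambda>\<xi>. (of_real (symbol \<xi>) / 2) ^ n * \<psi> \<xi>)) \<le> B" for n
      by (rule sup[OF schwartz_symbol_power(1)[OF \<psi>]])
  next
    fix n :: "nat \<Rightarrow> nat" and x :: "nat \<Rightarrow> real" assume x: "\<And>k. x k > 0" "summable x"
    let ?f = "\<lambda>z. \<Sum>k. of_real (x k) * (z / 2) ^ n k"
    have hol: "?f holomorphic_on ball 0 2" "z \<in> ball 0 2 \<Longrightarrow> norm (?f z) \<le> suminf x" for z :: complex
      using holomorphic_series[where g = "\<lambda>k z. (z / 2) ^ n k" and R = 2, OF pow less_imp_le[OF x(1)] x(2)]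
      by simp_all
    have fs: "(\<lambda>\<xi>. ?f (of_real (symbol \<xi>)) * \<psi> \<xi>) \<in> schwartz"
      by (rule schwartz_symbol[OF hol(1) _ \<psi>]) (rule hol(2))
    obtain B where B: "\<forall>s\<in>{0..T}. norm (V s (\<lambda>\<xi>. ?f (of_real (symbol \<xi>)) * \<psi> \<xi>)) \<le> B"
      using sup[OF fs] by (elim exE) (rule that)
    have "(\<Sum>k. of_real (x k) * V s (\<lambda>\<xi>. (of_real (symbol \<xi>) / 2) ^ n k * \<psi> \<xi>))
        = V s (\<lambda>\<xi>. ?f (of_real (symbol \<xi>)) * \<psi> \<xi>)" if "s \<in> {0..T}" for s
      by (rule sums_unique[symmetric], rule symbol_series_sums[where g = "\<lambda>k z. (z / 2) ^ n k", OF lin bdd \<psi> pow x])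
         (use that in auto)
    then show "\<exists>B. \<forall>s\<in>{0..T}. norm (\<Sum>k. of_real (x k) * V s (\<lambda>\<xi>. (of_real (symbol \<xi>) / 2) ^ n k * \<psi> \<xi>)) \<le> B"
      using B by (intro exI[of _ B]) simp
  qed
qed

text \<open>Let \<open>h N s = \<Sum>n\<le>N. (s - T)\<^sup>n / n! * V s (m\<^sup>n \<psi>)\<close>. Differentiating, everything telescopes except the last
  term \<open>- (s - T)\<^sup>N / N! * V s (m\<^bsup>N+1\<^esup> \<psi>)\<close>, which tends to 0 uniformly on \<open>[0, T]\<close> by the uniform
  bound. Hence \<open>h N T - h N 0\<close> tends to 0; the first value is \<open>V T \<psi>\<close>, and the second converges to the right-hand side by
  the exponential series.\<close>

lemma flow_formula:
  fixes V :: "real \<Rightarrow> ('a::euclidean_space \<Rightarrow> complex) \<Rightarrow> complex"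
  assumes lin: "\<And>s. s \<ge> 0 \<Longrightarrow> schwartz_linear (V s)"
    and bdd: "\<And>s. s \<ge> 0 \<Longrightarrow> bounded_on_schwartz (V s)"
    and cont: "\<And>\<psi>. \<psi> \<in> schwartz \<Longrightarrow> continuous_on {0..} (\<lambda>s. V s \<psi>)"
    and deriv: "\<And>\<psi> s. \<psi> \<in> schwartz \<Longrightarrow> s > 0 \<Longrightarrow>
       ((\<lambda>s. V s \<psi>) has_vector_derivative - V s (\<lambda>\<xi>. of_real (symbol \<xi>) * \<psi> \<xi>)) (at s)"
    and \<psi>: "\<psi> \<in> schwartz" and T: "T \<ge> 0"
  shows "V T \<psi> = V 0 (\<lambda>\<xi>. of_real (exp (- T * symbol \<xi>)) * \<psi> \<xi>)"
proof (cases "T = 0")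
  case True
  then show ?thesis by simp
next
  case False
  then have T: "T > 0" using T by simp
  define W where "W n = (\<lambda>\<xi>. of_real (symbol \<xi>) ^ n * \<psi> \<xi>)" for n
  have W: "W n \<in> schwartz" for n unfolding W_def by (rule schwartz_symbol_power(2)[OF \<psi>])
  have W_Suc: "(\<lambda>\<xi>. of_real (symbol \<xi>) * W n \<xi>) = W (Suc n)" for n
    by (simp add: W_def mult.assoc)
  have W_half: "W n = (\<lambda>\<xi>. 2 ^ n * ((of_real (symbol \<xi>) / 2) ^ n * \<psi> \<xi>))" for n
    by (simp add: W_def power_divide)
  have "\<exists>B. \<forall>s\<in>{0..T}. \<forall>n. norm (V s (\<lambda>\<xi>. (of_real (symbol \<xi>) / 2) ^ n * \<psi> \<xi>)) \<le> B"
    by (rule flow_uniform_bound[OF lin bdd cont \<psi>])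
  then obtain B where B: "\<forall>s\<in>{0..T}. \<forall>n. norm (V s (\<lambda>\<xi>. (of_real (symbol \<xi>) / 2) ^ n * \<psi> \<xi>)) \<le> B" ..
  have V_half: "V s (W n) = 2 ^ n * V s (\<lambda>\<xi>. (of_real (symbol \<xi>) / 2) ^ n * \<psi> \<xi>)" if "s \<ge> 0" for s n
    unfolding W_half by (rule schwartz_linearD(2)[OF lin[OF that] schwartz_symbol_power(1)[OF \<psi>] \<psi>])
  have VW: "norm (V s (W n)) \<le> 2 ^ n * B" if "s \<in> {0..T}" for s n
    using B[rule_format, OF that, of n] that by (simp add: V_half norm_mult norm_power)
  define h where "h N s = (\<Sum>n\<le>N. of_real ((s - T) ^ n / fact n) * V s (W n))" for N s
  have h_deriv: "(h N has_vector_derivative - (of_real ((s - T) ^ N / fact N) * V s (W (Suc N)))) (at s)"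
    if s: "s > 0" for N s
  proof (induction N)
    case 0
    then show ?case
      using deriv[OF W s, of 0] unfolding W_Suc by (simp add: h_def[abs_def])
  next
    case (Suc N)
    have fac: "((\<lambda>s. of_real ((s - T) ^ Suc N / fact (Suc N))) has_vector_derivative
        complex_of_real ((s - T) ^ N / fact N)) (at s)"
    proof -
      have "((\<lambda>s. (s - T) ^ Suc N / fact (Suc N)) has_real_derivative (s - T) ^ N / fact N) (at s)"
      proof -
        have "((\<lambda>s. s - T) has_real_derivative 1) (at s)" by (auto intro!: derivative_eq_intros)
        from DERIV_cdivide[OF DERIV_power_Suc[OF this, of N], of "fact (Suc N)"]
        show ?thesis by (rule DERIV_cong) (simp del: of_nat_Suc add: field_simps, simp add: algebra_simps)
      qed
      then show ?thesis
        by (intro has_vector_derivative_of_real) (simp add: has_real_derivative_iff_has_vector_derivative)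
    qed
    have "((\<lambda>s. h N s + of_real ((s - T) ^ Suc N / fact (Suc N)) * V s (W (Suc N))) has_vector_derivative
        - (of_real ((s - T) ^ N / fact N) * V s (W (Suc N))) +
        (of_real ((s - T) ^ Suc N / fact (Suc N)) * - V s (W (Suc (Suc N))) + of_real ((s - T) ^ N / fact N) * V s (W (Suc N)))) (at s)"
      using deriv[OF W s, of "Suc N"] unfolding W_Suc
      by (intro has_vector_derivative_add has_vector_derivative_mult Suc.IH fac)
    then show ?case by (simp add: h_def[abs_def])
  qed
  have h_cont: "continuous_on {0..T} (h N)" for N
    unfolding h_def[abs_def]
    by (intro continuous_intros continuous_on_subset[OF cont[OF W]]) auto
  have step: "norm (h N T - h N 0) \<le> 2 * B * T * ((2 * T) ^ N / fact N)" for N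
  proof -
    have "\<exists>s\<in>{0<..<T}. norm (h N T - h N 0) \<le> norm ((T - 0) *\<^sub>R - (of_real ((s - T) ^ N / fact N) * V s (W (Suc N))))"
      using h_deriv by (intro mvt_general[OF T h_cont]) (simp add: has_vector_derivative_def)
    then obtain s where s: "0 < s" "s < T"
      and le: "norm (h N T - h N 0) \<le> norm ((T - 0) *\<^sub>R - (of_real ((s - T) ^ N / fact N) * V s (W (Suc N))))"
      by auto
    have "\<bar>s - T\<bar> ^ N \<le> T ^ N" using s by (intro power_mono) auto
    note le
    also have "norm ((T - 0) *\<^sub>R - (of_real ((s - T) ^ N / fact N) * V s (W (Suc N))))
        = T * (\<bar>s - T\<bar> ^ N / fact N * norm (V s (W (Suc N))))"
      using T by (simp add: norm_mult norm_divide norm_power power_abs del: of_real_diff)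
    also have "\<dots> \<le> T * (T ^ N / fact N * (2 ^ Suc N * B))"
      using s T \<open>\<bar>s - T\<bar> ^ N \<le> T ^ N\<close>
      by (intro mult_left_mono mult_mono divide_right_mono VW) auto
    finally show ?thesis by (simp add: power_mult_distrib mult_ac)
  qed
  have "(\<lambda>N. (2 * T) ^ N / fact N) \<longlonglongrightarrow> 0"
    using summable_LIMSEQ_zero[OF summable_exp[of "2 * T"]] by (simp add: divide_inverse mult.commute)
  then have "(\<lambda>N. 2 * B * T * ((2 * T) ^ N / fact N)) \<longlonglongrightarrow> 2 * B * T * 0"
    by (intro tendsto_mult tendsto_const)
  then have "(\<lambda>N. 2 * B * T * ((2 * T) ^ N / fact N)) \<longlonglongrightarrow> 0" by (simp only: mult_zero_right)
  then have h_diff: "(\<lambda>N. h N T - h N 0) \<longlonglongrightarrow> 0"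
    by (rule Lim_null_comparison[OF always_eventually, rotated]) (rule allI, rule step)
  have h_T: "h N T = V T \<psi>" for N
  proof -
    have "h N T = (\<Sum>n\<le>N. if n = 0 then V T (W n) else 0)"
      unfolding h_def by (intro sum.cong) auto
    then show ?thesis by (simp add: W_def)
  qed
  have h_0: "(\<lambda>N. h N 0) \<longlonglongrightarrow> V 0 (\<lambda>\<xi>. of_real (exp (- T * symbol \<xi>)) * \<psi> \<xi>)"
  proof -
    let ?g = "\<lambda>k z. (- z / 2) ^ k :: complex"
    let ?x = "\<lambda>k. (2 * T) ^ k / fact k"
    have x: "?x k > 0" "summable ?x" for k
      using T summable_exp[of "2 * T"] by (auto simp: field_simps)
    have pow: "?g k holomorphic_on ball 0 2" "z \<in> ball 0 2 \<Longrightarrow> norm (?g k z) \<le> 1" for k z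
      by (auto intro!: holomorphic_intros power_le_one simp: norm_power norm_divide)
    have exp: "(\<Sum>k. of_real (?x k) * ?g k (of_real r)) = of_real (exp (- T * r))" for r
    proof -
      have "of_real (?x k) * ?g k (of_real r) = of_real ((- T * r) ^ k /\<^sub>R fact k)" for k
      proof -
        have "(2 * T) ^ k * (- r / 2) ^ k = (- T * r) ^ k"
          unfolding power_mult_distrib[symmetric] by simp
        then have "?x k * (- r / 2) ^ k = (- T * r) ^ k /\<^sub>R fact k"
          by (simp only: times_divide_eq_left real_scaleR_def divide_inverse mult_ac)
        moreover have "?g k (of_real r) = of_real ((- r / 2) ^ k)" by simp
        ultimately show ?thesis by (simp only: of_real_mult[symmetric])
      qed
      moreover have "(\<lambda>k. complex_of_real ((- T * r) ^ k /\<^sub>R fact k)) sums of_real (exp (- T * r))"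
        by (intro sums_of_real exp_converges)
      ultimately show ?thesis by (simp only: sums_unique[symmetric])
    qed
    have "(\<lambda>k. of_real (?x k) * V 0 (\<lambda>\<xi>. ?g k (of_real (symbol \<xi>)) * \<psi> \<xi>)) sums
        V 0 (\<lambda>\<xi>. (\<Sum>k. of_real (?x k) * ?g k (of_real (symbol \<xi>))) * \<psi> \<xi>)"
      by (rule symbol_series_sums[OF lin bdd \<psi> pow x]) auto
    then have lim: "(\<lambda>k. of_real (?x k) * V 0 (\<lambda>\<xi>. ?g k (of_real (symbol \<xi>)) * \<psi> \<xi>)) sums
        V 0 (\<lambda>\<xi>. of_real (exp (- T * symbol \<xi>)) * \<psi> \<xi>)" unfolding exp .
    have "of_real (?x k) * V 0 (\<lambda>\<xi>. ?g k (of_real (symbol \<xi>)) * \<psi> \<xi>) = of_real ((0 - T) ^ k / fact k) * V 0 (W k)" for k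
    proof -
      have "(\<lambda>\<xi>. ?g k (of_real (symbol \<xi>)) * \<psi> \<xi>) = (\<lambda>\<xi>. (-1) ^ k * ((of_real (symbol \<xi>) / 2) ^ k * \<psi> \<xi>))"
        by (intro ext) (simp only: minus_divide_left[symmetric] power_minus[of "_ / 2"] mult.assoc)
      then have "V 0 (\<lambda>\<xi>. ?g k (of_real (symbol \<xi>)) * \<psi> \<xi>) = (-1) ^ k * V 0 (\<lambda>\<xi>. (of_real (symbol \<xi>) / 2) ^ k * \<psi> \<xi>)"
        by (simp only: schwartz_linearD(2)[OF lin[OF order_refl] schwartz_symbol_power(1)[OF \<psi>] \<psi>])
      then show ?thesis unfolding V_half[OF order_refl]
        by (simp add: power_minus[of T] power_mult_distrib)
    qed
    with lim have "(\<lambda>k. of_real ((0 - T) ^ k / fact k) * V 0 (W k)) sums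
        V 0 (\<lambda>\<xi>. of_real (exp (- T * symbol \<xi>)) * \<psi> \<xi>)" by (simp only:)
    then show ?thesis unfolding sums_def_le h_def .
  qed
  have "(\<lambda>N. V T \<psi> - h N 0) \<longlonglongrightarrow> 0" using h_diff unfolding h_T .
  moreover have "(\<lambda>N. V T \<psi> - h N 0) \<longlonglongrightarrow> V T \<psi> - V 0 (\<lambda>\<xi>. of_real (exp (- T * symbol \<xi>)) * \<psi> \<xi>)"
    by (intro tendsto_diff tendsto_const h_0)
  ultimately have "0 = V T \<psi> - V 0 (\<lambda>\<xi>. of_real (exp (- T * symbol \<xi>)) * \<psi> \<xi>)"
    by (rule LIMSEQ_unique)
  then show ?thesis by simp
qed

section \<open>The solution formula\<close>

lemma fourier_multiplier_eq:
  "fourier_multiplier m u \<phi> = u (fourier (\<lambda>\<xi>. of_real (m \<xi>) * inv_fourier \<phi> \<xi>))"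
  unfolding fourier_multiplier_def dist_inv_fourier_def dist_mult_def dist_fourier_def ..

lemma fourier_multiplier_fourier:
  "\<psi> \<in> schwartz \<Longrightarrow> fourier_multiplier m u (fourier \<psi>) = u (fourier (\<lambda>\<xi>. of_real (m \<xi>) * \<psi> \<xi>))"
  by (simp add: fourier_multiplier_eq inv_fourier_fourier)

lemma fourier_lincomb:
  assumes "\<phi> \<in> schwartz" "\<psi> \<in> schwartz"
  shows "fourier (\<lambda>x. a * \<phi> x + b * \<psi> x) = (\<lambda>\<xi>. a * fourier \<phi> \<xi> + b * fourier \<psi> \<xi>)"
proof
  fix \<xi>
  have i: "integrable lborel (\<lambda>x. cis (- (x \<bullet> \<xi>)) * \<phi> x)" "integrable lborel (\<lambda>x. cis (- (x \<bullet> \<xi>)) * \<psi> x)"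
    by (intro schwartz_integrable schwartz_mult_character assms)+
  have "fourier (\<lambda>x. a * \<phi> x + b * \<psi> x) \<xi>
      = (LINT x|lborel. a * (cis (- (x \<bullet> \<xi>)) * \<phi> x) + b * (cis (- (x \<bullet> \<xi>)) * \<psi> x))"
    unfolding fourier_def by (simp only: distrib_left mult_ac)
  also have "\<dots> = a * fourier \<phi> \<xi> + b * fourier \<psi> \<xi>"
    unfolding fourier_def using i by simp
  finally show "fourier (\<lambda>x. a * \<phi> x + b * \<psi> x) \<xi> = a * fourier \<phi> \<xi> + b * fourier \<psi> \<xi>" .
qed

lemma inv_fourier_lincomb:
  fixes \<phi> \<psi> :: "'a::euclidean_space \<Rightarrow> complex"
  assumes "\<phi> \<in> schwartz" "\<psi> \<in> schwartz"
  shows "inv_fourier (\<lambda>x. a * \<phi> x + b * \<psi> x) = (\<lambda>\<xi>. a * inv_fourier \<phi> \<xi> + b * inv_fourier \<psi> \<xi>)"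
  unfolding inv_fourier_eq[abs_def] fourier_lincomb[OF assms] by (simp only: distrib_left mult_ac)

lemma tempered_fourier:
  fixes u :: "'a::euclidean_space distribution"
  assumes "tempered u"
  shows "schwartz_linear (\<lambda>\<psi>. u (fourier \<psi>))" "bounded_on_schwartz (\<lambda>\<psi>. u (fourier \<psi>))"
proof -
  show "schwartz_linear (\<lambda>\<psi>. u (fourier \<psi>))"
    unfolding schwartz_linear_def
    by (simp add: fourier_lincomb tempered_lincomb[OF assms] schwartz_fourier)
  show "bounded_on_schwartz (\<lambda>\<psi>. u (fourier \<psi>))"
    unfolding bounded_on_schwartz_def
  proof (intro allI impI)
    fix \<Phi> :: "nat \<Rightarrow> 'a \<Rightarrow> complex" assume "schwartz_family \<Phi>"
    from tempered_bounded_on_family[OF assms schwartz_family_fourier[OF this]]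
    show "\<exists>C. \<forall>j. norm (u (fourier (\<Phi> j))) \<le> C" by metis
  qed
qed

lemma schwartz_linear_sum:
  fixes v :: "('a::euclidean_space \<Rightarrow> complex) \<Rightarrow> complex" and \<psi> :: "'a \<Rightarrow> complex"
  assumes v: "schwartz_linear v" and "finite A" "\<And>i. i \<in> A \<Longrightarrow> f i \<in> schwartz" and "\<psi> \<in> schwartz"
  shows "(\<lambda>x. \<Sum>i\<in>A. f i x) \<in> schwartz \<and> v (\<lambda>x. \<Sum>i\<in>A. f i x) = (\<Sum>i\<in>A. v (f i))"
  using assms(2,3)
proof (induction A rule: finite_induct)
  case empty
  show ?case
    using schwartz_lincomb[OF assms(4,4), of 0 0] schwartz_linearD(2)[OF v assms(4,4), of 0] by simp
next
  case (insert i A)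
  then have 1: "f i \<in> schwartz" "(\<lambda>x. \<Sum>i\<in>A. f i x) \<in> schwartz" "v (\<lambda>x. \<Sum>i\<in>A. f i x) = (\<Sum>i\<in>A. v (f i))"
    by auto
  show ?case
    using schwartz_lincomb[OF 1(1,2), of 1 1] schwartz_linearD(1)[OF v 1(1,2), of 1 1] insert.hyps 1(3) by simp
qed

text \<open>The two derivatives of the transform of \<open>\<psi>\<close> bring down the factor \<open>- (x \<bullet> i)\<^sup>2\<close>, and the sum over \<open>i\<close>
  of these factors, multiplied by \<open>1 / (1 + |x|\<^sup>2)\<close>, is minus the symbol.\<close>

lemma laplacian_P_fourier:
  fixes u :: "'a::euclidean_space distribution"
  assumes u: "tempered u" and \<psi>: "\<psi> \<in> schwartz"
  shows "dist_laplacian (P_op u) (fourier \<psi>) = - u (fourier (\<lambda>\<xi>. of_real (symbol \<xi>) * \<psi> \<xi>))"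
proof -
  let ?p = "\<lambda>\<xi>::'a. 1 / (1 + (norm \<xi>)\<^sup>2)"
  let ?\<psi>1 = "\<lambda>i x. (- \<i>) * (of_real (x \<bullet> i) * \<psi> x)"
  let ?\<psi>2 = "\<lambda>i x. (- \<i>) * (of_real (x \<bullet> i) * ?\<psi>1 i x)"
  let ?f = "\<lambda>i x. of_real (?p x) * ?\<psi>2 i x"
  have mult: "(\<lambda>x. (- \<i>) * (of_real (x \<bullet> i) * \<phi> x)) \<in> schwartz" if "\<phi> \<in> schwartz" for \<phi> :: "'a \<Rightarrow> complex" and i
    using schwartz_lincomb[OF schwartz_mult_inner[OF that] that, of "- \<i>" _ 0] by simp
  have \<psi>1: "?\<psi>1 i \<in> schwartz" and \<psi>2: "?\<psi>2 i \<in> schwartz" for i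
    by (intro mult \<psi>)+
  have p: "slow_family (\<lambda>_. ?p)"
    using slow_bessel_symbol by (simp add: power2_norm_eq_inner inverse_eq_divide)
  have f: "?f i \<in> schwartz" for i
    by (rule schwartz_slow_mult[OF slow_family_of_real[OF p] \<psi>2])
  have "dist_laplacian (P_op u) (fourier \<psi>) = (\<Sum>i\<in>Basis. P_op u (partial_deriv i (partial_deriv i (fourier \<psi>))))"
    unfolding dist_laplacian_def dist_deriv_def by simp
  also have "\<dots> = (\<Sum>i\<in>Basis. u (fourier (?f i)))"
  proof (rule sum.cong[OF refl])
    fix i :: 'a assume i: "i \<in> Basis"
    show "P_op u (partial_deriv i (partial_deriv i (fourier \<psi>))) = u (fourier (?f i))"
      unfolding partial_deriv_fourier[OF \<psi> i] partial_deriv_fourier[OF \<psi>1 i] P_op_def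
      by (rule fourier_multiplier_fourier[OF \<psi>2])
  qed
  also have "\<dots> = u (fourier (\<lambda>x. \<Sum>i\<in>Basis. ?f i x))"
    by (rule conjunct2[OF schwartz_linear_sum[OF tempered_fourier(1)[OF u] finite_Basis f \<psi>], symmetric])
  also have "(\<lambda>x. \<Sum>i\<in>Basis. ?f i x) = (\<lambda>x. (- 1) * (of_real (symbol x) * \<psi> x))"
  proof
    fix x :: 'a
    have sq: "(- \<i>) * (a * ((- \<i>) * (a * w))) = - (a * a) * w" for a w
      by (simp add: complex_eq_iff algebra_simps)
    have "?f i x = of_real (- (?p x * ((x \<bullet> i) * (x \<bullet> i)))) * \<psi> x" for i
      unfolding sq by simp
    then have "(\<Sum>i\<in>Basis. ?f i x) = of_real (\<Sum>i\<in>Basis. - (?p x * ((x \<bullet> i) * (x \<bullet> i)))) * \<psi> x"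
      by (simp only: sum_distrib_right of_real_sum)
    also have "(\<Sum>i\<in>Basis. - (?p x * ((x \<bullet> i) * (x \<bullet> i)))) = - (?p x * (x \<bullet> x))"
      unfolding euclidean_inner[of x x] by (simp add: sum_negf sum_distrib_left)
    also have "?p x * (x \<bullet> x) = symbol x"
    proof -
      have "1 + x \<bullet> x \<noteq> 0" using inner_ge_zero[of x] by linarith
      then show ?thesis by (simp add: symbol_def power2_norm_eq_inner field_simps)
    qed
    finally show "(\<Sum>i\<in>Basis. ?f i x) = (- 1) * (of_real (symbol x) * \<psi> x)" by simp
  qed
  also have "u (fourier (\<lambda>x. (- 1) * (of_real (symbol x) * \<psi> x))) = (- 1) * u (fourier (\<lambda>x. of_real (symbol x) * \<psi> x))"
    by (rule schwartz_linearD(2)[OF tempered_fourier(1)[OF u] _ \<psi>])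
       (rule schwartz_slow_mult[OF slow_family_of_real[OF slow_symbol] \<psi>])
  finally show ?thesis by simp
qed

lemma schwartz_exp_symbol:
  assumes "\<psi> \<in> schwartz"
  shows "(\<lambda>\<xi>. of_real (exp (- t * symbol \<xi>)) * \<psi> \<xi>) \<in> schwartz"
proof -
  have "(\<lambda>\<xi>. exp (of_real (- t) * of_real (symbol \<xi>)) * \<psi> \<xi>) \<in> schwartz"
  proof (rule schwartz_symbol[OF _ _ assms])
    show "(\<lambda>z. exp (of_real (- t) * z)) holomorphic_on ball 0 2" by (intro holomorphic_intros)
    fix z :: complex assume "z \<in> ball 0 2"
    then have "\<bar>t\<bar> * norm z \<le> \<bar>t\<bar> * 2" by (intro mult_left_mono) auto
    then have "exp (norm (of_real (- t) * z)) \<le> exp (\<bar>t\<bar> * 2)" by (simp add: norm_mult)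
    then show "norm (exp (of_real (- t) * z)) \<le> exp (\<bar>t\<bar> * 2)" using norm_exp order_trans by blast
  qed
  then show ?thesis by (simp add: exp_of_real[symmetric])
qed

lemma solution_fourier:
  assumes sol: "linear_solution u0 u" and \<psi>: "\<psi> \<in> schwartz" and t: "t \<ge> 0"
  shows "u t (fourier \<psi>) = u0 (fourier (\<lambda>\<xi>. of_real (exp (- t * symbol \<xi>)) * \<psi> \<xi>))"
proof -
  have temp: "tempered (u s)" if "s \<ge> 0" for s using sol that unfolding linear_solution_def by blast
  note exp_schwartz = schwartz_exp_symbol[OF \<psi>, of t]
  have "u t (fourier \<psi>) = u 0 (fourier (\<lambda>\<xi>. of_real (exp (- t * symbol \<xi>)) * \<psi> \<xi>))"
  proof (rule flow_formula[where V = "\<lambda>s \<psi>. u s (fourier \<psi>)", OF _ _ _ _ \<psi> t])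
    fix s :: real assume "s \<ge> 0"
    then show "schwartz_linear (\<lambda>\<psi>. u s (fourier \<psi>))" "bounded_on_schwartz (\<lambda>\<psi>. u s (fourier \<psi>))"
      using tempered_fourier[OF temp] by blast+
  next
    fix \<psi> :: "'a \<Rightarrow> complex" assume "\<psi> \<in> schwartz"
    then show "continuous_on {0..} (\<lambda>s. u s (fourier \<psi>))"
      using sol schwartz_fourier unfolding linear_solution_def by blast
  next
    fix \<psi> :: "'a \<Rightarrow> complex" and s :: real assume \<psi>: "\<psi> \<in> schwartz" and s: "s > 0"
    obtain u' where u': "((\<lambda>s. u s (fourier \<psi>)) has_vector_derivative u') (at s)"
        "u' - dist_laplacian (P_op (u s)) (fourier \<psi>) = 0"
      using sol schwartz_fourier[OF \<psi>] s unfolding linear_solution_def by metis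
    then show "((\<lambda>s. u s (fourier \<psi>)) has_vector_derivative - u s (fourier (\<lambda>\<xi>. of_real (symbol \<xi>) * \<psi> \<xi>))) (at s)"
      using laplacian_P_fourier[OF temp \<psi>, of s] s by (simp add: add_eq_0_iff)
  qed
  also have "\<dots> = u0 (fourier (\<lambda>\<xi>. of_real (exp (- t * symbol \<xi>)) * \<psi> \<xi>))"
    using sol schwartz_fourier[OF exp_schwartz] unfolding linear_solution_def by blast
  finally show ?thesis .
qed

lemma solution_eq:
  assumes "linear_solution u0 u" "\<phi> \<in> schwartz" "t \<ge> 0"
  shows "u t \<phi> = u0 (fourier (\<lambda>\<xi>. of_real (exp (- t * symbol \<xi>)) * inv_fourier \<phi> \<xi>))"
proof -
  have "fourier (inv_fourier \<phi>) = \<phi>" by (intro ext fourier_inv_fourier assms)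
  then show ?thesis
    using solution_fourier[OF assms(1) schwartz_inv_fourier[OF assms(2)] assms(3)] by simp
qed

section \<open>Littlewood--Paley blocks of the solution\<close>

lemma lp_block_eq:
  "lp_block chi k u \<phi> = u (fourier (\<lambda>\<xi>. of_real (lp_phi chi (2 powr - of_int k *\<^sub>R \<xi>)) * inv_fourier \<phi> \<xi>))"
  unfolding lp_block_def fourier_multiplier_eq ..

lemma schwartz_lp_phi:
  assumes "lp_cutoff chi" "\<psi> \<in> schwartz"
  shows "(\<lambda>\<xi>. of_real (lp_phi chi (c *\<^sub>R \<xi>)) * \<psi> \<xi>) \<in> schwartz"
  by (rule schwartz_slow_mult[OF slow_family_of_real[OF slow_lp_phi[OF assms(1)]] assms(2)])

lemma schwartz_linear_lp_block:
  assumes "lp_cutoff chi" "tempered u"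
  shows "schwartz_linear (lp_block chi k u)"
  unfolding schwartz_linear_def
proof (intro ballI allI)
  fix \<phi> \<psi> :: "'a \<Rightarrow> complex" and a b assume \<phi>: "\<phi> \<in> schwartz" and \<psi>: "\<psi> \<in> schwartz"
  let ?m = "\<lambda>\<xi>. complex_of_real (lp_phi chi (2 powr - of_int k *\<^sub>R \<xi>))"
  have "(\<lambda>\<xi>. ?m \<xi> * inv_fourier (\<lambda>x. a * \<phi> x + b * \<psi> x) \<xi>)
      = (\<lambda>\<xi>. a * (?m \<xi> * inv_fourier \<phi> \<xi>) + b * (?m \<xi> * inv_fourier \<psi> \<xi>))"
    unfolding inv_fourier_lincomb[OF \<phi> \<psi>] by (simp only: distrib_left distrib_right mult_ac)
  then show "lp_block chi k u (\<lambda>x. a * \<phi> x + b * \<psi> x) = a * lp_block chi k u \<phi> + b * lp_block chi k u \<psi>"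
    unfolding lp_block_eq
    by (simp only: schwartz_linearD(1)[OF tempered_fourier(1)[OF assms(2)]]
          schwartz_lp_phi[OF assms(1)] schwartz_inv_fourier \<phi> \<psi>)
qed

text \<open>Blocks and flow are both multiplication operators on the Fourier side, so they commute.\<close>

lemma lp_block_solution:
  assumes chi: "lp_cutoff chi" and sol: "linear_solution u0 u" and \<phi>: "\<phi> \<in> schwartz" and t: "t \<ge> 0"
  shows "lp_block chi k (u t) \<phi>
     = lp_block chi k u0 (fourier (\<lambda>\<xi>. of_real (exp (- t * symbol \<xi>)) * inv_fourier \<phi> \<xi>))"
proof -
  have \<psi>: "inv_fourier \<phi> \<in> schwartz" by (rule schwartz_inv_fourier[OF \<phi>])
  show ?thesis
    unfolding lp_block_eq solution_fourier[OF sol schwartz_lp_phi[OF chi \<psi>] t]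
      inv_fourier_fourier[OF schwartz_exp_symbol[OF \<psi>]]
    by (simp only: mult_ac)
qed

text \<open>By commutation, the block sums of \<open>u t\<close> at \<open>\<phi>\<close> are the block sums of the datum at the evolved
  test function.\<close>

lemma solution_in_S_h:
  assumes chi: "lp_cutoff chi" and sol: "linear_solution u0 u" and u0: "u0 \<in> S_h chi" and t: "t \<ge> 0"
  shows "u t \<in> S_h chi"
  unfolding S_h_def
proof (intro CollectI conjI ballI)
  show "tempered (u t)" using sol t unfolding linear_solution_def by blast
  fix \<phi> :: "'a \<Rightarrow> complex" assume \<phi>: "\<phi> \<in> schwartz"
  have "fourier (\<lambda>\<xi>. of_real (exp (- t * symbol \<xi>)) * inv_fourier \<phi> \<xi>) \<in> schwartz"
    by (intro schwartz_fourier schwartz_exp_symbol schwartz_inv_fourier \<phi>)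
  then show "(\<lambda>N. \<Sum>k = - int N..int N. lp_block chi k (u t) \<phi>) \<longlonglongrightarrow> u t \<phi>"
    using u0 unfolding lp_block_solution[OF chi sol \<phi> t] solution_eq[OF sol \<phi> t] S_h_def by blast
qed

text \<open>The sum of the cutoffs of the blocks \<open>k - 1\<close>, \<open>k\<close> and \<open>k + 1\<close>. It equals 1 on the support of the cutoff
  of block \<open>k\<close> and vanishes for \<open>|\<xi>| < 3/8 * 2\<^sup>k\<close>; inserting it localizes the factor
  \<open>exp (- t m)\<close> to frequencies where \<open>m\<close> is bounded below.\<close>

definition lp_fat :: "('a::euclidean_space \<Rightarrow> real) \<Rightarrow> int \<Rightarrow> 'a \<Rightarrow> real" where
  "lp_fat chi k \<xi> = chi ((2 powr - of_int k / 4) *\<^sub>R \<xi>) - chi ((2 * 2 powr - of_int k) *\<^sub>R \<xi>)"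

lemma lp_cutoff_values:
  assumes "lp_cutoff chi"
  shows "0 \<le> chi x" "chi x \<le> 1" "norm x < 3 / 4 \<Longrightarrow> chi x = 1" "norm x \<ge> 4 / 3 \<Longrightarrow> chi x = 0"
proof -
  show "0 \<le> chi x" "chi x \<le> 1" "norm x < 3 / 4 \<Longrightarrow> chi x = 1"
    using assms unfolding lp_cutoff_def by (auto simp: image_subset_iff)
  have "closure {\<xi>. chi \<xi> \<noteq> 0} \<subseteq> ball 0 (4 / 3)" using assms unfolding lp_cutoff_def by blast
  then have "chi x \<noteq> 0 \<Longrightarrow> x \<in> ball 0 (4 / 3)" using closure_subset[of "{\<xi>. chi \<xi> \<noteq> 0}"] by blast
  then show "norm x \<ge> 4 / 3 \<Longrightarrow> chi x = 0" by force
qed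

lemma lp_fat_eq_1:
  assumes "lp_cutoff chi" "lp_phi chi (2 powr - of_int k *\<^sub>R \<xi>) \<noteq> 0"
  shows "lp_fat chi k \<xi> = 1"
proof -
  let ?r = "2 powr - real_of_int k * norm \<xi>"
  have r: "0 \<le> ?r" "norm (2 powr - of_int k *\<^sub>R \<xi>) = ?r" "norm ((1 / 2) *\<^sub>R 2 powr - of_int k *\<^sub>R \<xi>) = ?r / 2"
      "norm ((2 powr - of_int k / 4) *\<^sub>R \<xi>) = ?r / 4" "norm ((2 * 2 powr - of_int k) *\<^sub>R \<xi>) = 2 * ?r"
    by simp_all
  have "3 / 4 \<le> ?r"
  proof (rule ccontr)
    assume "\<not> 3 / 4 \<le> ?r"
    then have "norm (2 powr - of_int k *\<^sub>R \<xi>) < 3 / 4" "norm ((1 / 2) *\<^sub>R 2 powr - of_int k *\<^sub>R \<xi>) < 3 / 4"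
      using r by linarith+
    then show False using assms lp_cutoff_values(3)[OF assms(1)] unfolding lp_phi_def by fastforce
  qed
  moreover have "?r < 8 / 3"
  proof (rule ccontr)
    assume "\<not> ?r < 8 / 3"
    then have "norm (2 powr - of_int k *\<^sub>R \<xi>) \<ge> 4 / 3" "norm ((1 / 2) *\<^sub>R 2 powr - of_int k *\<^sub>R \<xi>) \<ge> 4 / 3"
      using r by linarith+
    then show False using assms lp_cutoff_values(4)[OF assms(1)] unfolding lp_phi_def by fastforce
  qed
  ultimately have "norm ((2 powr - of_int k / 4) *\<^sub>R \<xi>) < 3 / 4" "norm ((2 * 2 powr - of_int k) *\<^sub>R \<xi>) \<ge> 4 / 3"
    using r by linarith+
  then show ?thesis
    unfolding lp_fat_def using lp_cutoff_values(3,4)[OF assms(1)] by simp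
qed

text \<open>The value of the symbol at \<open>|\<xi>| = 3/8 * 2\<^sup>k\<close>.\<close>

definition block_rate :: "int \<Rightarrow> real" where
  "block_rate k = (9 / 64 * 4 powr of_int k) / (1 + 9 / 64 * 4 powr of_int k)"

lemma exp_symbol_lp_fat_le:
  fixes \<xi> :: "'a::euclidean_space"
  assumes "lp_cutoff chi" "t \<ge> 0"
  shows "\<bar>exp (- t * symbol \<xi>) * lp_fat chi k \<xi>\<bar> \<le> exp (- t * block_rate k)"
proof (cases "lp_fat chi k \<xi> = 0")
  case False
  let ?r = "2 powr - real_of_int k * norm \<xi>"
  have "3 / 8 \<le> ?r"
  proof (rule ccontr)
    assume "\<not> 3 / 8 \<le> ?r"
    moreover have "0 \<le> ?r" by simp
    moreover have "norm ((2 powr - of_int k / 4) *\<^sub>R \<xi>) = ?r / 4" "norm ((2 * 2 powr - of_int k) *\<^sub>R \<xi>) = 2 * ?r"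
      by simp_all
    ultimately have "norm ((2 powr - of_int k / 4) *\<^sub>R \<xi>) < 3 / 4" "norm ((2 * 2 powr - of_int k) *\<^sub>R \<xi>) < 3 / 4"
      by linarith+
    then show False using False lp_cutoff_values(3)[OF assms(1)] unfolding lp_fat_def by fastforce
  qed
  then have "(3 / 8)\<^sup>2 \<le> ?r\<^sup>2" by (intro power_mono) auto
  moreover have "?r\<^sup>2 = 4 powr - of_int k * (\<xi> \<bullet> \<xi>)"
  proof -
    have "(2 powr - real_of_int k)\<^sup>2 = 4 powr - real_of_int k"
      unfolding power2_eq_square using powr_mult[of 2 2 "- real_of_int k"] by simp
    then show ?thesis by (simp add: power_mult_distrib power2_norm_eq_inner)
  qed
  ultimately have "9 / 64 \<le> inverse (4 powr of_int k) * (\<xi> \<bullet> \<xi>)"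
    by (simp add: powr_minus power2_eq_square)
  moreover have "9 / 64 * q \<le> X" if "q > 0" "9 / 64 \<le> inverse q * X" for q X :: real
    using that by (simp add: field_simps)
  ultimately have a: "9 / 64 * 4 powr of_int k \<le> \<xi> \<bullet> \<xi>" by simp
  have "block_rate k \<le> symbol \<xi>"
  proof -
    have *: "x / (1 + x) = 1 - inverse (1 + x)" if "x \<ge> 0" for x :: real using that by (simp add: field_simps)
    have "inverse (1 + \<xi> \<bullet> \<xi>) \<le> inverse (1 + 9 / 64 * 4 powr of_int k)"
      using a by (intro le_imp_inverse_le) (auto intro: add_pos_nonneg)
    then show ?thesis unfolding block_rate_def symbol_def by (subst *) auto
  qed
  then have "exp (- t * symbol \<xi>) \<le> exp (- t * block_rate k)" using assms(2) by (simp add: mult_left_mono)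
  moreover have "\<bar>lp_fat chi k \<xi>\<bar> \<le> 1"
    using lp_cutoff_values(1,2)[OF assms(1), of "(2 powr - of_int k / 4) *\<^sub>R \<xi>"]
      lp_cutoff_values(1,2)[OF assms(1), of "(2 * 2 powr - of_int k) *\<^sub>R \<xi>"]
    unfolding lp_fat_def by (intro abs_leI) linarith+
  ultimately have "exp (- t * symbol \<xi>) * \<bar>lp_fat chi k \<xi>\<bar> \<le> exp (- t * block_rate k) * 1"
    by (intro mult_mono) auto
  then show ?thesis by (simp add: abs_mult)
qed simp

lemma slow_lp_fat:
  assumes "lp_cutoff chi" shows "slow_family (\<lambda>_. lp_fat chi k)"
proof -
  have s: "slow_family (\<lambda>_. chi)"
    using assms slow_compact_support unfolding lp_cutoff_def by blast
  have "slow_family (\<lambda>_ \<xi>. chi ((2 powr - of_int k / 4) *\<^sub>R \<xi>) + (-1) * chi ((2 * 2 powr - of_int k) *\<^sub>R \<xi>))"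
    by (intro slow_family_add slow_family_cmult slow_family_scaled s)
  then show ?thesis by (simp add: lp_fat_def[abs_def])
qed

lemma schwartz_norm_sq_integrable:
  assumes "\<phi> \<in> schwartz" shows "integrable lborel (\<lambda>x. (norm (\<phi> x))\<^sup>2)"
proof -
  note [measurable] = schwartz_measurable[OF assms]
  obtain B where B: "\<And>x. norm (\<phi> x) \<le> B" using schwartz_bounded[OF assms] by metis
  show ?thesis
  proof (rule Bochner_Integration.integrable_bound)
    show "integrable lborel (\<lambda>x. B * norm (\<phi> x))" using schwartz_integrable[OF assms] by simp
    show "AE x in lborel. norm ((norm (\<phi> x))\<^sup>2) \<le> norm (B * norm (\<phi> x))"
    proof (rule AE_I2)
      fix x
      have "0 \<le> B" using B[of x] norm_ge_zero order_trans by blast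
      then show "norm ((norm (\<phi> x))\<^sup>2) \<le> norm (B * norm (\<phi> x))"
        using mult_right_mono[OF B[of x], of "norm (\<phi> x)"] by (simp add: power2_eq_square)
    qed
  qed measurable
qed

text \<open>The function \<open>\<theta>\<close> has Fourier transform \<open>exp (- t m)\<close> times the fattened cutoff times that of
  \<open>\<phi>\<close>. The block \<open>k\<close> does not see the fattened cutoff, whereas Plancherel does.\<close>

lemma lp_block_solution_localized:
  fixes \<phi> :: "'a::euclidean_space \<Rightarrow> complex"
  assumes chi: "lp_cutoff chi" and sol: "linear_solution u0 u" and \<phi>: "\<phi> \<in> schwartz" and t: "t \<ge> 0"
  obtains \<theta> where "\<theta> \<in> schwartz" "lp_block chi k (u t) \<phi> = lp_block chi k u0 \<theta>"
    "(LINT x|lborel. (norm (\<theta> x))\<^sup>2) \<le> (exp (- t * block_rate k))\<^sup>2 * (LINT x|lborel. (norm (\<phi> x))\<^sup>2)"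
proof -
  let ?\<psi> = "inv_fourier \<phi>"
  have \<psi>: "?\<psi> \<in> schwartz" by (rule schwartz_inv_fourier[OF \<phi>])
  let ?\<eta> = "\<lambda>\<xi>. of_real (exp (- t * symbol \<xi>)) * (of_real (lp_fat chi k \<xi>) * ?\<psi> \<xi>)"
  have \<eta>: "?\<eta> \<in> schwartz"
    by (intro schwartz_exp_symbol schwartz_slow_mult[OF slow_family_of_real[OF slow_lp_fat[OF chi]]] \<psi>)
  let ?m = "\<lambda>\<xi>. complex_of_real (lp_phi chi (2 powr - of_int k *\<^sub>R \<xi>))"
  have eq: "(\<lambda>\<xi>. ?m \<xi> * ?\<eta> \<xi>) = (\<lambda>\<xi>. ?m \<xi> * (of_real (exp (- t * symbol \<xi>)) * ?\<psi> \<xi>))"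
  proof
    fix \<xi>
    show "?m \<xi> * ?\<eta> \<xi> = ?m \<xi> * (of_real (exp (- t * symbol \<xi>)) * ?\<psi> \<xi>)"
      using lp_fat_eq_1[OF chi, of k \<xi>] by (cases "?m \<xi> = 0") simp_all
  qed
  have 1: "lp_block chi k (u t) \<phi> = lp_block chi k u0 (fourier ?\<eta>)"
    unfolding lp_block_solution[OF chi sol \<phi> t]
    unfolding lp_block_eq inv_fourier_fourier[OF \<eta>] inv_fourier_fourier[OF schwartz_exp_symbol[OF \<psi>]] eq ..
  have "(LINT \<xi>|lborel. (norm (?\<eta> \<xi>))\<^sup>2) \<le> (LINT \<xi>|lborel. (exp (- t * block_rate k))\<^sup>2 * (norm (?\<psi> \<xi>))\<^sup>2)"
  proof (rule integral_mono)
    show "integrable lborel (\<lambda>\<xi>. (norm (?\<eta> \<xi>))\<^sup>2)" by (rule schwartz_norm_sq_integrable[OF \<eta>])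
    show "integrable lborel (\<lambda>\<xi>. (exp (- t * block_rate k))\<^sup>2 * (norm (?\<psi> \<xi>))\<^sup>2)"
      by (intro integrable_mult_right schwartz_norm_sq_integrable \<psi>)
    fix \<xi> :: 'a
    have "norm (?\<eta> \<xi>) = \<bar>exp (- t * symbol \<xi>) * lp_fat chi k \<xi>\<bar> * norm (?\<psi> \<xi>)"
      by (simp add: norm_mult abs_mult)
    also have "\<dots> \<le> exp (- t * block_rate k) * norm (?\<psi> \<xi>)"
      by (intro mult_right_mono exp_symbol_lp_fat_le chi t) simp
    finally have "(norm (?\<eta> \<xi>))\<^sup>2 \<le> (exp (- t * block_rate k) * norm (?\<psi> \<xi>))\<^sup>2"
      by (intro power_mono) auto
    then show "(norm (?\<eta> \<xi>))\<^sup>2 \<le> (exp (- t * block_rate k))\<^sup>2 * (norm (?\<psi> \<xi>))\<^sup>2"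
      by (simp only: power_mult_distrib)
  qed
  then have "(LINT x|lborel. (norm (fourier ?\<eta> x))\<^sup>2)
      \<le> (2 * pi) ^ DIM('a) * ((exp (- t * block_rate k))\<^sup>2 * (LINT \<xi>|lborel. (norm (?\<psi> \<xi>))\<^sup>2))"
    unfolding plancherel[OF \<eta>] by (intro mult_left_mono) simp_all
  also have "\<dots> = (exp (- t * block_rate k))\<^sup>2 * (LINT x|lborel. (norm (fourier ?\<psi> x))\<^sup>2)"
    unfolding plancherel[OF \<psi>] by (simp only: mult_ac)
  also have "(\<lambda>x. fourier ?\<psi> x) = \<phi>" by (intro ext fourier_inv_fourier \<phi>)
  finally show ?thesis by (intro that[OF schwartz_fourier[OF \<eta>] 1])
qed

section \<open>The dual description of the L2 norm of a distribution\<close>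

definition l2_sq :: "('a::euclidean_space \<Rightarrow> complex) \<Rightarrow> real" where
  "l2_sq f = (LINT x|lborel. (norm (f x))\<^sup>2)"

definition square_integrable :: "('a::euclidean_space \<Rightarrow> complex) \<Rightarrow> bool" where
  "square_integrable f \<longleftrightarrow> f \<in> borel_measurable borel \<and> integrable lborel (\<lambda>x. (norm (f x))\<^sup>2)"

lemma l2_sq_nonneg: "0 \<le> l2_sq f"
  unfolding l2_sq_def by simp

lemma schwartz_square_integrable: "\<phi> \<in> schwartz \<Longrightarrow> square_integrable \<phi>"
  unfolding square_integrable_def by (simp add: schwartz_measurable schwartz_norm_sq_integrable)

lemma square_integrable_mult:
  assumes "square_integrable f" "square_integrable g"
  shows "integrable lborel (\<lambda>x. f x * g x)" "integrable lborel (\<lambda>x. norm (f x) * norm (g x))"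
proof -
  have [measurable]: "f \<in> borel_measurable borel" "g \<in> borel_measurable borel"
    using assms by (auto simp: square_integrable_def)
  have int: "integrable lborel (\<lambda>x. (norm (f x))\<^sup>2 + (norm (g x))\<^sup>2)"
    using assms by (auto simp: square_integrable_def)
  have le: "norm (f x) * norm (g x) \<le> (norm (f x))\<^sup>2 + (norm (g x))\<^sup>2" for x
  proof -
    have "2 * (norm (f x) * norm (g x)) \<le> (norm (f x))\<^sup>2 + (norm (g x))\<^sup>2"
      using sum_squares_bound[of "norm (f x)" "norm (g x)"] by (simp add: mult.assoc)
    moreover have "0 \<le> norm (f x) * norm (g x)" by simp
    ultimately show ?thesis by linarith
  qed
  show "integrable lborel (\<lambda>x. f x * g x)"
    by (rule Bochner_Integration.integrable_bound[OF int]) (use le in \<open>auto simp: norm_mult\<close>)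
  show "integrable lborel (\<lambda>x. norm (f x) * norm (g x))"
    by (rule Bochner_Integration.integrable_bound[OF int]) (use le in \<open>auto simp: norm_mult\<close>)
qed

lemma square_integrable_cnj:
  assumes "square_integrable f" shows "square_integrable (\<lambda>x. cnj (f x))"
  using assms measurable_compose[OF _ borel_measurable_continuous_onI[OF continuous_on_cnj[OF continuous_on_id]], of f borel]
  by (simp add: square_integrable_def)

lemma l2_sq_expand:
  assumes f: "square_integrable f" and g: "square_integrable g"
  shows "square_integrable (\<lambda>x. f x + of_real t * g x)"
    and "l2_sq (\<lambda>x. f x + of_real t * g x) = l2_sq f + 2 * t * Re (LINT x|lborel. cnj (f x) * g x) + t\<^sup>2 * l2_sq g"
proof -
  have [measurable]: "f \<in> borel_measurable borel" "g \<in> borel_measurable borel"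
    and i1: "integrable lborel (\<lambda>x. (norm (f x))\<^sup>2)" "integrable lborel (\<lambda>x. (norm (g x))\<^sup>2)"
    using f g by (auto simp: square_integrable_def)
  have cf: "square_integrable (\<lambda>x. cnj (f x))" by (rule square_integrable_cnj[OF f])
  note i2 = square_integrable_mult(1)[OF cf g]
  have eq: "(norm (f x + of_real t * g x))\<^sup>2 = (norm (f x))\<^sup>2 + 2 * t * Re (cnj (f x) * g x) + t\<^sup>2 * (norm (g x))\<^sup>2" for x
    unfolding cmod_power2 by (simp add: power2_eq_square algebra_simps)
  have i3: "integrable lborel (\<lambda>x. Re (cnj (f x) * g x))" by (rule integrable_Re[OF i2])
  show "square_integrable (\<lambda>x. f x + of_real t * g x)"
    unfolding square_integrable_def eq using i1 i3 by (intro conjI Bochner_Integration.integrable_add integrable_mult_right) auto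
  have sum3: "(LINT x|lborel. F x + c * H x + d * K x) = (LINT x|lborel. F x) + c * (LINT x|lborel. H x) + d * (LINT x|lborel. K x)"
    if "integrable lborel F" "integrable lborel H" "integrable lborel K" for F H K :: "'a \<Rightarrow> real" and c d
    using that by simp
  have "l2_sq (\<lambda>x. f x + of_real t * g x)
      = l2_sq f + 2 * t * (LINT x|lborel. Re (cnj (f x) * g x)) + t\<^sup>2 * l2_sq g"
    unfolding l2_sq_def eq by (rule sum3[OF i1(1) i3 i1(2)])
  then show "l2_sq (\<lambda>x. f x + of_real t * g x) = l2_sq f + 2 * t * Re (LINT x|lborel. cnj (f x) * g x) + t\<^sup>2 * l2_sq g"
    by (simp only: integral_Re[OF i2])
qed

text \<open>The square integral of \<open>|f| + t |g|\<close> is nonnegative for all real \<open>t\<close>. The two statements differ in where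
  the absolute value stands.\<close>

lemma cauchy_schwarz_l2:
  assumes f: "square_integrable f" and g: "square_integrable g"
  shows "(LINT x|lborel. norm (f x) * norm (g x)) \<le> sqrt (l2_sq f) * sqrt (l2_sq g)"
    and "norm (LINT x|lborel. f x * g x) \<le> sqrt (l2_sq f) * sqrt (l2_sq g)"
proof -
  let ?X = "LINT x|lborel. norm (f x) * norm (g x)"
  let ?f = "\<lambda>x. complex_of_real (norm (f x))" and ?g = "\<lambda>x. complex_of_real (norm (g x))"
  have sq: "square_integrable ?f" "square_integrable ?g"
    using f g by (auto simp: square_integrable_def)
  have l: "l2_sq ?f = l2_sq f" "l2_sq ?g = l2_sq g" by (simp_all add: l2_sq_def)
  have "(LINT x|lborel. cnj (?f x) * ?g x) = of_real ?X" by (simp add: of_real_mult[symmetric] del: of_real_mult)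
  then have poly: "0 \<le> l2_sq f + 2 * t * ?X + t\<^sup>2 * l2_sq g" for t
    using l2_sq_expand(2)[OF sq, of t] l2_sq_nonneg[of "\<lambda>x. ?f x + of_real t * ?g x"] l by simp
  have "?X\<^sup>2 \<le> l2_sq f * l2_sq g"
  proof (cases "l2_sq g = 0")
    case True
    have "?X = 0"
    proof (rule ccontr)
      assume "?X \<noteq> 0"
      then have "l2_sq f + 2 * (- (l2_sq f + 1) / (2 * ?X)) * ?X = - 1" by (simp add: field_simps)
      then show False using poly[of "- (l2_sq f + 1) / (2 * ?X)"] True by simp
    qed
    then show ?thesis using True by simp
  next
    case False
    then have g0: "l2_sq g > 0" using l2_sq_nonneg[of g] by linarith
    have "0 \<le> l2_sq f + 2 * (- ?X / l2_sq g) * ?X + (- ?X / l2_sq g)\<^sup>2 * l2_sq g" by (rule poly)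
    also have "\<dots> = l2_sq f - ?X\<^sup>2 / l2_sq g" using g0 by (simp add: power2_eq_square field_simps)
    finally show ?thesis using g0 by (simp add: field_simps)
  qed
  then have "sqrt (?X\<^sup>2) \<le> sqrt (l2_sq f * l2_sq g)" by (rule real_sqrt_le_mono)
  then show 1: "?X \<le> sqrt (l2_sq f) * sqrt (l2_sq g)" by (simp add: real_sqrt_mult)
  have "norm (LINT x|lborel. f x * g x) \<le> (LINT x|lborel. norm (f x * g x))" by (rule integral_norm_bound)
  then show "norm (LINT x|lborel. f x * g x) \<le> sqrt (l2_sq f) * sqrt (l2_sq g)"
    using 1 by (simp add: norm_mult)
qed

text \<open>Cauchy-Schwarz for every function that represents \<open>v\<close>, followed by the infimum.\<close>

lemma L2_norm_dual_bound:
  fixes v :: "'a::euclidean_space distribution"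
  assumes "L2_norm v < \<infinity>" "\<phi> \<in> schwartz"
  shows "norm (v \<phi>) \<le> enn2real (L2_norm v) * sqrt (l2_sq \<phi>)"
proof -
  have below: "norm (v \<phi>) \<le> B * sqrt (l2_sq \<phi>)" if B: "enn2real (L2_norm v) < B" for B
  proof -
    have "L2_norm v < ennreal B"
      using B assms(1) by (cases "L2_norm v") (auto simp: ennreal_lessI)
    then obtain f where f: "represents f v"
      and lt: "ennreal_powr (\<integral>\<^sup>+ x. ennreal ((norm (f x))\<^sup>2) \<partial>lborel) (1 / 2) < ennreal B"
      unfolding L2_norm_def by (auto simp: INF_less_iff)
    have [measurable]: "f \<in> borel_measurable borel" using f unfolding represents_def by simp
    have fin: "(\<integral>\<^sup>+ x. ennreal ((norm (f x))\<^sup>2) \<partial>lborel) \<noteq> \<infinity>"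
    proof
      assume "(\<integral>\<^sup>+ x. ennreal ((norm (f x))\<^sup>2) \<partial>lborel) = \<infinity>"
      then show False using lt by (simp add: ennreal_powr_def)
    qed
    have sq: "square_integrable f"
      unfolding square_integrable_def using fin
      by (auto intro!: integrableI_bounded simp: less_top)
    have "(\<integral>\<^sup>+ x. ennreal ((norm (f x))\<^sup>2) \<partial>lborel) = ennreal (l2_sq f)"
      unfolding l2_sq_def using sq by (intro nn_integral_eq_integral) (auto simp: square_integrable_def)
    then have "sqrt (l2_sq f) < B"
      using lt l2_sq_nonneg[of f] B order.strict_trans1[OF enn2real_nonneg B]
      by (simp add: ennreal_powr_def powr_half_sqrt ennreal_less_iff)
    moreover have "norm (v \<phi>) \<le> sqrt (l2_sq f) * sqrt (l2_sq \<phi>)"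
      using cauchy_schwarz_l2(2)[OF sq schwartz_square_integrable[OF assms(2)]] f assms(2)
      unfolding represents_def by simp
    ultimately show ?thesis
      using mult_right_mono[of "sqrt (l2_sq f)" B "sqrt (l2_sq \<phi>)"] l2_sq_nonneg[of \<phi>] by simp
  qed
  have "(\<lambda>n. (enn2real (L2_norm v) + inverse (real (Suc n))) * sqrt (l2_sq \<phi>))
      \<longlonglongrightarrow> (enn2real (L2_norm v) + 0) * sqrt (l2_sq \<phi>)"
    by (intro tendsto_intros LIMSEQ_inverse_real_of_nat)
  then have "norm (v \<phi>) \<le> (enn2real (L2_norm v) + 0) * sqrt (l2_sq \<phi>)"
  proof (rule LIMSEQ_le_const)
    show "\<exists>N. \<forall>n\<ge>N. norm (v \<phi>) \<le> (enn2real (L2_norm v) + inverse (real (Suc n))) * sqrt (l2_sq \<phi>)"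
      by (intro exI allI impI below) simp
  qed
  then show ?thesis by simp
qed

text \<open>Completeness of \<open>L\<^sup>2\<close> for a sequence with an explicit Cauchy rate. Multiplication by a square integrable
  positive weight turns it into a Cauchy sequence in \<open>L\<^sup>1\<close>, so a subsequence converges
  almost everywhere; Fatou's lemma shows that the limit is also one in \<open>L\<^sup>2\<close>.\<close>

lemma square_integrable_limit:
  fixes \<phi> :: "nat \<Rightarrow> 'a::euclidean_space \<Rightarrow> complex"
  assumes sq: "\<And>n. square_integrable (\<phi> n)"
    and cauchy: "\<And>i j. l2_sq (\<lambda>x. \<phi> i x + of_real (- 1) * \<phi> j x) \<le> 2 * inverse (real (Suc i)) + 2 * inverse (real (Suc j))"
  obtains r g where "strict_mono r" "square_integrable g"
    "\<And>i. l2_sq (\<lambda>x. \<phi> (r i) x + of_real (- 1) * g x) \<le> 4 * inverse (real (Suc i))"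
proof -
  have [measurable]: "\<phi> n \<in> borel_measurable borel" for n using sq by (simp add: square_integrable_def)
  \<comment> \<open>The weight passes from square integrable to integrable functions.\<close>
  define w where "w x = complex_of_real (decay_weight x)" for x :: 'a
  have w: "square_integrable w"
  proof -
    have "(norm (w x))\<^sup>2 \<le> decay_weight x" for x
      using mult_left_mono[OF decay_weight_le_1[of x] less_imp_le[OF decay_weight_pos[of x]]] decay_weight_pos[of x]
      by (simp add: w_def power2_eq_square)
    then have "integrable lborel (\<lambda>x. (norm (w x))\<^sup>2)"
      by (intro Bochner_Integration.integrable_bound[OF integrable_decay_weight])
         (auto simp: w_def intro!: AE_I2 intro: order_trans[OF _ abs_ge_self])
    then show ?thesis by (simp add: square_integrable_def w_def[abs_def])
  qed
  obtain r where r: "strict_mono r" and ae: "AE x in lborel. Cauchy (\<lambda>i. w x * \<phi> (r i) x)"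
  proof (rule cauchy_L1_AE_cauchy_subseq[where s = "\<lambda>n x. w x * \<phi> n x"])
    show "integrable lborel (\<lambda>x. w x * \<phi> n x)" for n by (rule square_integrable_mult(1)[OF w sq])
    fix e :: real assume e: "e > 0"
    let ?K = "sqrt (l2_sq w)"
    have "(\<lambda>n. (?K + 1) * sqrt (4 * inverse (real (Suc n)))) \<longlonglongrightarrow> (?K + 1) * sqrt (4 * 0)"
      by (intro tendsto_intros LIMSEQ_inverse_real_of_nat)
    then have "eventually (\<lambda>n. (?K + 1) * sqrt (4 * inverse (real (Suc n))) < e) sequentially"
      by (rule order_tendstoD(2)) (use e in simp)
    then obtain N where N: "(?K + 1) * sqrt (4 * inverse (real (Suc N))) < e"
      unfolding eventually_sequentially by blast
    have "(LINT x|lborel. norm (w x * \<phi> i x - w x * \<phi> j x)) < e" if "i \<ge> N" "j \<ge> N" for i j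
    proof -
      have "(LINT x|lborel. norm (w x * \<phi> i x - w x * \<phi> j x))
          = (LINT x|lborel. norm (w x) * norm (\<phi> i x + of_real (- 1) * \<phi> j x))"
        by (simp add: right_diff_distrib[symmetric] norm_mult)
      also have "\<dots> \<le> ?K * sqrt (l2_sq (\<lambda>x. \<phi> i x + of_real (- 1) * \<phi> j x))"
        by (rule cauchy_schwarz_l2(1)[OF w l2_sq_expand(1)[OF sq sq]])
      also have "\<dots> \<le> (?K + 1) * sqrt (4 * inverse (real (Suc N)))"
      proof (intro mult_mono real_sqrt_le_mono)
        have "inverse (real (Suc i)) \<le> inverse (real (Suc N))" "inverse (real (Suc j)) \<le> inverse (real (Suc N))"
          using that by (auto intro!: le_imp_inverse_le)
        then show "l2_sq (\<lambda>x. \<phi> i x + of_real (- 1) * \<phi> j x) \<le> 4 * inverse (real (Suc N))"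
          using cauchy[of i j] by linarith
      qed (use l2_sq_nonneg in \<open>auto intro!: add_nonneg_nonneg\<close>)
      finally show ?thesis using N by linarith
    qed
    then show "\<exists>N. \<forall>i\<ge>N. \<forall>j\<ge>N. (LINT x|lborel. norm (w x * \<phi> i x - w x * \<phi> j x)) < e" by blast
  qed
  define g where "g x = lim (\<lambda>i. \<phi> (r i) x)" for x
  have [measurable]: "g \<in> borel_measurable borel"
    unfolding g_def[abs_def] by (rule borel_measurable_lim_metric) measurable
  have conv: "AE x in lborel. (\<lambda>i. \<phi> (r i) x) \<longlonglongrightarrow> g x"
    using ae
  proof eventually_elim
    case (elim x)
    then obtain l where "(\<lambda>i. w x * \<phi> (r i) x) \<longlonglongrightarrow> l" using Cauchy_convergent convergent_def by blast
    then have "(\<lambda>i. inverse (w x) * (w x * \<phi> (r i) x)) \<longlonglongrightarrow> inverse (w x) * l" by (intro tendsto_mult tendsto_const)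
    moreover have "w x \<noteq> 0" using decay_weight_pos[of x] by (simp add: w_def)
    ultimately have "(\<lambda>i. \<phi> (r i) x) \<longlonglongrightarrow> inverse (w x) * l" by (simp add: mult.assoc[symmetric])
    then show ?case unfolding g_def by (simp add: limI)
  qed
  have r_ge: "i \<le> r i" for i using r by (rule seq_suble)
  have fatou: "(\<integral>\<^sup>+ x. ennreal ((norm (\<phi> (r i) x + of_real (- 1) * g x))\<^sup>2) \<partial>lborel) \<le> ennreal (4 * inverse (real (Suc i)))" for i
  proof -
    have "(\<integral>\<^sup>+ x. ennreal ((norm (\<phi> (r i) x + of_real (- 1) * g x))\<^sup>2) \<partial>lborel)
        = (\<integral>\<^sup>+ x. liminf (\<lambda>j. ennreal ((norm (\<phi> (r i) x + of_real (- 1) * \<phi> (r j) x))\<^sup>2)) \<partial>lborel)"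
    proof (rule nn_integral_cong_AE)
      show "AE x in lborel. ennreal ((norm (\<phi> (r i) x + of_real (- 1) * g x))\<^sup>2)
          = liminf (\<lambda>j. ennreal ((norm (\<phi> (r i) x + of_real (- 1) * \<phi> (r j) x))\<^sup>2))"
        using conv
      proof eventually_elim
        case (elim x)
        have "(\<lambda>j. ennreal ((norm (\<phi> (r i) x + of_real (- 1) * \<phi> (r j) x))\<^sup>2))
            \<longlonglongrightarrow> ennreal ((norm (\<phi> (r i) x + of_real (- 1) * g x))\<^sup>2)"
          by (intro tendsto_ennrealI tendsto_power tendsto_norm tendsto_add tendsto_mult tendsto_const elim)
        then show ?case by (intro lim_imp_Liminf[symmetric]) simp_all
      qed
    qed
    also have "\<dots> \<le> liminf (\<lambda>j. \<integral>\<^sup>+ x. ennreal ((norm (\<phi> (r i) x + of_real (- 1) * \<phi> (r j) x))\<^sup>2) \<partial>lborel)"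
      by (rule nn_integral_liminf) measurable
    also have "\<dots> \<le> ennreal (4 * inverse (real (Suc i)))"
    proof (rule Liminf_le)
      show "eventually (\<lambda>j. (\<integral>\<^sup>+ x. ennreal ((norm (\<phi> (r i) x + of_real (- 1) * \<phi> (r j) x))\<^sup>2) \<partial>lborel)
          \<le> ennreal (4 * inverse (real (Suc i)))) sequentially"
        unfolding eventually_sequentially
      proof (intro exI allI impI)
        fix j assume "i \<le> j"
        have "inverse (real (Suc (r i))) \<le> inverse (real (Suc i))" "inverse (real (Suc (r j))) \<le> inverse (real (Suc i))"
          using r_ge[of i] r_ge[of j] \<open>i \<le> j\<close> by (auto intro!: le_imp_inverse_le)
        then have "l2_sq (\<lambda>x. \<phi> (r i) x + of_real (- 1) * \<phi> (r j) x) \<le> 4 * inverse (real (Suc i))"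
          using cauchy[of "r i" "r j"] by linarith
        moreover have "(\<integral>\<^sup>+ x. ennreal ((norm (\<phi> (r i) x + of_real (- 1) * \<phi> (r j) x))\<^sup>2) \<partial>lborel)
            = ennreal (l2_sq (\<lambda>x. \<phi> (r i) x + of_real (- 1) * \<phi> (r j) x))"
          unfolding l2_sq_def using l2_sq_expand(1)[OF sq sq, of "r i" "- 1" "r j"]
          by (intro nn_integral_eq_integral) (auto simp: square_integrable_def)
        ultimately show "(\<integral>\<^sup>+ x. ennreal ((norm (\<phi> (r i) x + of_real (- 1) * \<phi> (r j) x))\<^sup>2) \<partial>lborel)
            \<le> ennreal (4 * inverse (real (Suc i)))" by (simp add: ennreal_leI)
      qed
    qed simp
    finally show ?thesis .
  qed
  have diff: "square_integrable (\<lambda>x. \<phi> (r i) x + of_real (- 1) * g x)" for i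
    unfolding square_integrable_def
    by (auto intro!: integrableI_bounded order.strict_trans1[OF fatou[simplified]])
  have g: "square_integrable g"
    using l2_sq_expand(1)[OF sq[of "r 0"] diff[of 0], of "- 1"] by simp
  have "l2_sq (\<lambda>x. \<phi> (r i) x + of_real (- 1) * g x) \<le> 4 * inverse (real (Suc i))" for i
  proof -
    have "ennreal (l2_sq (\<lambda>x. \<phi> (r i) x + of_real (- 1) * g x))
        = (\<integral>\<^sup>+ x. ennreal ((norm (\<phi> (r i) x + of_real (- 1) * g x))\<^sup>2) \<partial>lborel)"
      unfolding l2_sq_def using diff[of i]
      by (intro nn_integral_eq_integral[symmetric]) (auto simp: square_integrable_def)
    then have "ennreal (l2_sq (\<lambda>x. \<phi> (r i) x + of_real (- 1) * g x)) \<le> ennreal (4 * inverse (real (Suc i)))"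
      using fatou[of i] by (simp only:)
    then show ?thesis by (rule ennreal_le_iff[THEN iffD1, rotated]) simp
  qed
  then show ?thesis using that[OF r g] by blast
qed

text \<open>The Riesz representation theorem for a functional that is given on Schwartz functions only. A minimizing
  sequence of \<open>J \<phi> = \<parallel>\<phi>\<parallel>\<^sup>2 - 2 Re (v \<phi>)\<close> is a Cauchy sequence by the parallelogram law, and at its
  limit \<open>g\<close> the first variation of \<open>J\<close> vanishes, which says that \<open>v\<close> is the pairing with the conjugate of \<open>g\<close>.
  Testing \<open>v\<close> with the minimizing sequence gives \<open>\<parallel>g\<parallel>\<^sup>2 \<le> B \<parallel>g\<parallel>\<close>.\<close>

lemma L2_norm_le_dual:
  fixes v :: "'a::euclidean_space distribution"
  assumes v: "schwartz_linear v" and bound: "\<And>\<phi>. \<phi> \<in> schwartz \<Longrightarrow> norm (v \<phi>) \<le> B * sqrt (l2_sq \<phi>)"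
    and B: "B \<ge> 0"
  shows "L2_norm v \<le> ennreal B"
proof -
  define J where "J \<phi> = l2_sq \<phi> - 2 * Re (v \<phi>)" for \<phi>
  have sq: "square_integrable \<phi>" if "\<phi> \<in> schwartz" for \<phi> :: "'a \<Rightarrow> complex"
    by (rule schwartz_square_integrable[OF that])
  have lin: "(\<lambda>x. a x + of_real t * b x) \<in> schwartz" "v (\<lambda>x. a x + of_real t * b x) = v a + of_real t * v b"
    if "a \<in> schwartz" "b \<in> schwartz" for a b t
    using schwartz_lincomb[OF that, of 1 "of_real t"] schwartz_linearD(1)[OF v that, of 1 "of_real t"] by simp_all
  have J_lower: "- (B\<^sup>2) \<le> J \<phi>" if "\<phi> \<in> schwartz" for \<phi>
  proof -
    have "Re (v \<phi>) \<le> B * sqrt (l2_sq \<phi>)" using bound[OF that] complex_Re_le_cmod[of "v \<phi>"] by linarith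
    moreover have "0 \<le> (sqrt (l2_sq \<phi>) - B)\<^sup>2" by simp
    then have "2 * (B * sqrt (l2_sq \<phi>)) \<le> l2_sq \<phi> + B\<^sup>2"
      using l2_sq_nonneg[of \<phi>] by (simp add: power2_diff mult_ac)
    ultimately show ?thesis unfolding J_def by linarith
  qed
  define \<mu> where "\<mu> = Inf (J ` schwartz)"
  have bdd: "bdd_below (J ` (schwartz :: ('a \<Rightarrow> complex) set))"
    using J_lower by (intro bdd_belowI2[where m = "- (B\<^sup>2)"])
  have \<mu>_le: "\<mu> \<le> J \<phi>" if "\<phi> \<in> schwartz" for \<phi>
    unfolding \<mu>_def by (rule cInf_lower[OF imageI[OF that] bdd])
  have ne: "(schwartz :: ('a \<Rightarrow> complex) set) \<noteq> {}"
  proof -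
    have "schwartz_family (\<lambda>(_::unit) (_::'a). 0 :: complex)"
    proof (rule smooth_family_coinduct[where X = "\<lambda>\<Xi>. \<Xi> = (\<lambda>_ _. 0)"], goal_cases)
      case 1
      show ?case ..
    next
      case (2 \<Xi>)
      show ?case unfolding \<open>\<Xi> = (\<lambda>_ _. 0)\<close> rapidly_decreasing_def by (intro allI exI[of _ 0]) simp
    next
      case (3 \<Xi> j x)
      show ?case unfolding \<open>\<Xi> = (\<lambda>_ _. 0)\<close> by simp
    next
      case (4 \<Xi> i)
      show ?case unfolding \<open>\<Xi> = (\<lambda>_ _. 0)\<close> by (intro ext) (rule partial_deriv_eq[OF has_derivative_const])
    qed
    then show ?thesis using schwartz_iff by blast
  qed
  have "\<exists>\<phi>\<in>schwartz. J \<phi> < \<mu> + inverse (real (Suc n))" for n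
  proof -
    have "Inf (J ` schwartz) < \<mu> + inverse (real (Suc n))" by (simp add: \<mu>_def)
    then obtain y where "y \<in> J ` schwartz" "y < \<mu> + inverse (real (Suc n))"
      using cInf_lessD[of "J ` schwartz"] ne by blast
    then show ?thesis by blast
  qed
  then obtain \<phi> where \<phi>: "\<And>n. \<phi> n \<in> schwartz" and J\<phi>: "\<And>n. J (\<phi> n) < \<mu> + inverse (real (Suc n))" by metis
  have par: "l2_sq (\<lambda>x. a x + of_real (- 1) * b x) = 2 * J a + 2 * J b - 4 * J (\<lambda>x. (1/2) * a x + (1/2) * b x)"
    if a: "a \<in> schwartz" and b: "b \<in> schwartz" for a b
  proof -
    let ?I = "Re (LINT x|lborel. cnj (a x) * b x)"
    have "l2_sq (\<lambda>x. (1/2) * a x + (1/2) * b x) = (1/4) * l2_sq (\<lambda>x. a x + of_real 1 * b x)"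
    proof -
      have "norm ((1/2) * a x + (1/2) * b x) = (1/2) * norm (a x + of_real 1 * b x)" for x
        unfolding distrib_left[symmetric] norm_mult by simp
      then have "(norm ((1/2) * a x + (1/2) * b x))\<^sup>2 = (1/4) * (norm (a x + of_real 1 * b x))\<^sup>2" for x
        by (simp only: power_mult_distrib) (simp add: power2_eq_square)
      then show ?thesis unfolding l2_sq_def by (simp only: integral_mult_right_zero)
    qed
    moreover have "v (\<lambda>x. (1/2) * a x + (1/2) * b x) = (1/2) * v a + (1/2) * v b"
      by (rule schwartz_linearD(1)[OF v a b])
    ultimately show ?thesis
      unfolding J_def using l2_sq_expand(2)[OF sq[OF a] sq[OF b], of 1] l2_sq_expand(2)[OF sq[OF a] sq[OF b], of "- 1"]
      by simp
  qed
  have "l2_sq (\<lambda>x. \<phi> i x + of_real (- 1) * \<phi> j x) \<le> 2 * inverse (real (Suc i)) + 2 * inverse (real (Suc j))" for i j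
    using par[OF \<phi>[of i] \<phi>[of j]] J\<phi>[of i] J\<phi>[of j]
      \<mu>_le[OF schwartz_lincomb[OF \<phi>[of i] \<phi>[of j], of "1/2" "1/2"]] by linarith
  then obtain r g where r: "strict_mono r" and g: "square_integrable g"
    and lim: "\<And>i. l2_sq (\<lambda>x. \<phi> (r i) x + of_real (- 1) * g x) \<le> 4 * inverse (real (Suc i))"
    using square_integrable_limit[of \<phi>, OF sq[OF \<phi>]] by metis
  define \<psi> where "\<psi> i = \<phi> (r i)" for i
  have \<psi>: "\<psi> i \<in> schwartz" for i by (simp add: \<psi>_def \<phi>)
  have J\<psi>: "J (\<psi> i) < \<mu> + inverse (real (Suc i))" for i
  proof -
    have "inverse (real (Suc (r i))) \<le> inverse (real (Suc i))"
      using seq_suble[OF r, of i] by (auto intro!: le_imp_inverse_le)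
    then show ?thesis using J\<phi>[of "r i"] unfolding \<psi>_def by linarith
  qed
  define e where "e i = l2_sq (\<lambda>x. \<psi> i x + of_real (- 1) * g x)" for i
  have e: "0 \<le> e i" "e i \<le> 4 * inverse (real (Suc i))" for i
    using lim[of i] l2_sq_nonneg by (auto simp: e_def \<psi>_def)
  have inv0: "(\<lambda>n. inverse (real (Suc n))) \<longlonglongrightarrow> 0" by (rule LIMSEQ_inverse_real_of_nat)
  have "(\<lambda>n. 4 * inverse (real (Suc n))) \<longlonglongrightarrow> 4 * 0" by (intro tendsto_intros inv0)
  then have "(\<lambda>n. 4 * inverse (real (Suc n))) \<longlonglongrightarrow> 0" by (simp only: mult_zero_right)
  then have e0: "e \<longlonglongrightarrow> 0"
    by (rule Lim_null_comparison[OF always_eventually, rotated]) (use e in simp)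
  have weak: "(\<lambda>i. LINT x|lborel. cnj (\<psi> i x) * f x) \<longlonglongrightarrow> (LINT x|lborel. cnj (g x) * f x)"
    if f: "square_integrable f" for f
  proof -
    have "norm ((LINT x|lborel. cnj (\<psi> i x) * f x) - (LINT x|lborel. cnj (g x) * f x)) \<le> sqrt (e i) * sqrt (l2_sq f)" for i
    proof -
      have d: "square_integrable (\<lambda>x. cnj (\<psi> i x + of_real (- 1) * g x))"
        by (rule square_integrable_cnj[OF l2_sq_expand(1)[OF sq[OF \<psi>] g]])
      have dd: "(LINT x|lborel. cnj (\<psi> i x) * f x) - (LINT x|lborel. cnj (g x) * f x)
          = (LINT x|lborel. cnj (\<psi> i x + of_real (- 1) * g x) * f x)"
        using square_integrable_mult(1)[OF square_integrable_cnj[OF sq[OF \<psi>[of i]]] f]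
          square_integrable_mult(1)[OF square_integrable_cnj[OF g] f]
        by (subst Bochner_Integration.integral_diff[symmetric]) (auto simp: left_diff_distrib)
      show ?thesis
        using cauchy_schwarz_l2(2)[OF d f] unfolding dd e_def by (simp only: l2_sq_def complex_mod_cnj)
    qed
    moreover have "(\<lambda>i. sqrt (e i) * sqrt (l2_sq f)) \<longlonglongrightarrow> sqrt 0 * sqrt (l2_sq f)"
      by (intro tendsto_intros e0)
    then have "(\<lambda>i. sqrt (e i) * sqrt (l2_sq f)) \<longlonglongrightarrow> 0" by simp
    then have "(\<lambda>i. (LINT x|lborel. cnj (\<psi> i x) * f x) - (LINT x|lborel. cnj (g x) * f x)) \<longlonglongrightarrow> 0"
      by (rule Lim_null_comparison[OF always_eventually, rotated]) (rule allI, fact)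
    then show ?thesis by (simp add: LIM_zero_iff)
  qed
  have Re_eq: "Re (v \<eta>) = Re (LINT x|lborel. cnj (g x) * \<eta> x)" if \<eta>: "\<eta> \<in> schwartz" for \<eta>
  proof -
    define D where "D = Re (LINT x|lborel. cnj (g x) * \<eta> x) - Re (v \<eta>)"
    let ?Q = "l2_sq \<eta>"
    have "0 \<le> 2 * t * D + t\<^sup>2 * ?Q" for t
    proof -
      have "- inverse (real (Suc i)) \<le> 2 * t * (Re (LINT x|lborel. cnj (\<psi> i x) * \<eta> x) - Re (v \<eta>)) + t\<^sup>2 * ?Q" for i
      proof -
        have "J (\<lambda>x. \<psi> i x + of_real t * \<eta> x) = J (\<psi> i) + 2 * t * (Re (LINT x|lborel. cnj (\<psi> i x) * \<eta> x) - Re (v \<eta>)) + t\<^sup>2 * ?Q"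
          unfolding J_def lin(2)[OF \<psi> \<eta>] l2_sq_expand(2)[OF sq[OF \<psi>] sq[OF \<eta>]] by (simp add: algebra_simps)
        then show ?thesis using \<mu>_le[OF lin(1)[OF \<psi> \<eta>], of i t] J\<psi>[of i] by linarith
      qed
      moreover have "(\<lambda>i. 2 * t * (Re (LINT x|lborel. cnj (\<psi> i x) * \<eta> x) - Re (v \<eta>)) + t\<^sup>2 * ?Q)
          \<longlonglongrightarrow> 2 * t * D + t\<^sup>2 * ?Q"
        unfolding D_def by (intro tendsto_intros weak sq \<eta>)
      moreover have "(\<lambda>i. - inverse (real (Suc i))) \<longlonglongrightarrow> - 0" by (intro tendsto_minus inv0)
      ultimately show ?thesis using LIMSEQ_le by fastforce
    qed
    \<comment> \<open>The denominator is \<open>?Q + 1\<close> rather than \<open>?Q\<close> so that \<open>?Q = 0\<close> needs no separate treatment.\<close>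
    from this[of "- D / (?Q + 1)"]
    have *: "0 \<le> 2 * (- D / (?Q + 1)) * D + (- D / (?Q + 1))\<^sup>2 * ?Q" .
    have Q: "?Q \<ge> 0" by (rule l2_sq_nonneg)
    have "(- D / (?Q + 1))\<^sup>2 * ?Q \<le> (- D / (?Q + 1))\<^sup>2 * (?Q + 1)" by (intro mult_left_mono) auto
    also have "\<dots> = D\<^sup>2 / (?Q + 1)" using Q by (simp add: power2_eq_square)
    finally have "0 \<le> - (D\<^sup>2 / (?Q + 1))" using * by (simp add: power2_eq_square)
    then have "D\<^sup>2 \<le> 0" using Q by (simp add: divide_le_0_iff)
    then show ?thesis by (simp add: D_def)
  qed
  have repr: "v \<eta> = (LINT x|lborel. cnj (g x) * \<eta> x)" if \<eta>: "\<eta> \<in> schwartz" for \<eta>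
  proof (rule complex_eqI)
    show "Re (v \<eta>) = Re (LINT x|lborel. cnj (g x) * \<eta> x)" by (rule Re_eq[OF \<eta>])
    have i\<eta>: "(\<lambda>x. \<i> * \<eta> x) \<in> schwartz" using schwartz_lincomb[OF \<eta> \<eta>, of \<i> 0] by simp
    have "Re (\<i> * v \<eta>) = Re (LINT x|lborel. \<i> * (cnj (g x) * \<eta> x))"
      using Re_eq[OF i\<eta>] unfolding schwartz_linearD(2)[OF v \<eta> \<eta>] by (simp only: mult_ac)
    then have "Re (\<i> * v \<eta>) = Re (\<i> * (LINT x|lborel. cnj (g x) * \<eta> x))" by (simp only: integral_mult_right_zero)
    then show "Im (v \<eta>) = Im (LINT x|lborel. cnj (g x) * \<eta> x)" by simp
  qed
  have rep: "represents (\<lambda>x. cnj (g x)) v"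
    unfolding represents_def using square_integrable_cnj[OF g] repr
      square_integrable_mult(1)[OF square_integrable_cnj[OF g] sq]
    by (auto simp: square_integrable_def)
  have "sqrt (l2_sq g) \<le> B"
  proof -
    let ?G = "l2_sq g"
    have gg: "(LINT x|lborel. cnj (g x) * g x) = of_real ?G"
      unfolding l2_sq_def by (simp add: mult.commute complex_norm_square[symmetric] of_real_power[symmetric] del: of_real_power)
    have q: "l2_sq (\<psi> i) = e i + 2 * Re (LINT x|lborel. cnj (\<psi> i x) * g x) - ?G" for i
      unfolding e_def l2_sq_expand(2)[OF sq[OF \<psi>] g] by simp
    have "(\<lambda>i. e i + 2 * Re (LINT x|lborel. cnj (\<psi> i x) * g x) - ?G) \<longlonglongrightarrow> 0 + 2 * Re (of_real ?G) - ?G"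
      unfolding gg[symmetric] by (intro tendsto_intros e0 weak g)
    then have q_lim: "(\<lambda>i. l2_sq (\<psi> i)) \<longlonglongrightarrow> ?G" unfolding q by simp
    have "Re (LINT x|lborel. cnj (\<psi> i x) * g x) \<le> B * sqrt (l2_sq (\<psi> i))" for i
    proof -
      have "cnj (v (\<psi> i)) = (LINT x|lborel. cnj (\<psi> i x) * g x)"
        unfolding repr[OF \<psi>] by (simp add: Bochner_Integration.integral_cnj[symmetric] mult.commute del: Bochner_Integration.integral_cnj)
      then have "Re (LINT x|lborel. cnj (\<psi> i x) * g x) = Re (v (\<psi> i))" by (metis cnj.sel(1))
      then show ?thesis using bound[OF \<psi>[of i]] complex_Re_le_cmod[of "v (\<psi> i)"] by linarith
    qed
    moreover have "(\<lambda>i. Re (LINT x|lborel. cnj (\<psi> i x) * g x)) \<longlonglongrightarrow> Re (of_real ?G)"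
      unfolding gg[symmetric] by (intro tendsto_intros weak g)
    moreover have "(\<lambda>i. B * sqrt (l2_sq (\<psi> i))) \<longlonglongrightarrow> B * sqrt ?G" by (intro tendsto_intros q_lim)
    ultimately have "Re (of_real ?G) \<le> B * sqrt ?G" using LIMSEQ_le by blast
    then have "sqrt ?G * sqrt ?G \<le> B * sqrt ?G" using l2_sq_nonneg[of g] by simp
    moreover have "sqrt ?G = 0 \<or> sqrt ?G > 0" using l2_sq_nonneg[of g] by auto
    ultimately show ?thesis using B mult_right_le_imp_le[of "sqrt ?G" "sqrt ?G" B] by (elim disjE) simp_all
  qed
  have "L2_norm v \<le> ennreal_powr (\<integral>\<^sup>+ x. ennreal ((norm (cnj (g x)))\<^sup>2) \<partial>lborel) (1 / 2)"
    unfolding L2_norm_def using rep by (intro INF_lower) simp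
  also have "(\<integral>\<^sup>+ x. ennreal ((norm (cnj (g x)))\<^sup>2) \<partial>lborel) = ennreal (l2_sq g)"
    unfolding l2_sq_def using g by (simp add: nn_integral_eq_integral square_integrable_def)
  also have "ennreal_powr (ennreal (l2_sq g)) (1 / 2) = ennreal (sqrt (l2_sq g))"
    using l2_sq_nonneg[of g] by (simp add: ennreal_powr_def powr_half_sqrt)
  also have "\<dots> \<le> ennreal B" using \<open>sqrt (l2_sq g) \<le> B\<close> by (rule ennreal_leI)
  finally show ?thesis .
qed

section \<open>Decay of the blocks\<close>

text \<open>By duality, this is the localized form of the solution formula.\<close>

lemma lp_block_decay:
  assumes chi: "lp_cutoff chi" and u0: "tempered u0" and sol: "linear_solution u0 u" and t: "t \<ge> 0"
  shows "L2_norm (lp_block chi k (u t)) \<le> ennreal (exp (- t * block_rate k)) * L2_norm (lp_block chi k u0)"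
proof (cases "L2_norm (lp_block chi k u0) = \<infinity>")
  case True
  then show ?thesis by (simp add: ennreal_mult_top)
next
  case False
  let ?N = "enn2real (L2_norm (lp_block chi k u0))"
  have N: "L2_norm (lp_block chi k u0) = ennreal ?N" using False by (simp add: less_top)
  have temp: "tempered (u t)" using sol t unfolding linear_solution_def by blast
  have "L2_norm (lp_block chi k (u t)) \<le> ennreal (exp (- t * block_rate k) * ?N)"
  proof (rule L2_norm_le_dual[OF schwartz_linear_lp_block[OF chi temp]])
    fix \<phi> :: "'a \<Rightarrow> complex" assume \<phi>: "\<phi> \<in> schwartz"
    obtain \<theta> where \<theta>: "\<theta> \<in> schwartz" "lp_block chi k (u t) \<phi> = lp_block chi k u0 \<theta>"
      "l2_sq \<theta> \<le> (exp (- t * block_rate k))\<^sup>2 * l2_sq \<phi>"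
      using lp_block_solution_localized[OF chi sol \<phi> t] unfolding l2_sq_def by metis
    have "sqrt (l2_sq \<theta>) \<le> sqrt ((exp (- t * block_rate k))\<^sup>2 * l2_sq \<phi>)" by (rule real_sqrt_le_mono[OF \<theta>(3)])
    also have "\<dots> = exp (- t * block_rate k) * sqrt (l2_sq \<phi>)" by (simp add: real_sqrt_mult)
    finally have "?N * sqrt (l2_sq \<theta>) \<le> ?N * (exp (- t * block_rate k) * sqrt (l2_sq \<phi>))"
      by (intro mult_left_mono) auto
    moreover have "norm (lp_block chi k u0 \<theta>) \<le> ?N * sqrt (l2_sq \<theta>)"
      using False by (intro L2_norm_dual_bound \<theta>(1)) (simp add: less_top)
    ultimately show "norm (lp_block chi k (u t) \<phi>) \<le> exp (- t * block_rate k) * ?N * sqrt (l2_sq \<phi>)"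
      unfolding \<theta>(2) by (simp add: mult_ac)
  qed simp
  also have "\<dots> = ennreal (exp (- t * block_rate k)) * L2_norm (lp_block chi k u0)"
    by (subst N) (simp add: ennreal_mult)
  finally show ?thesis .
qed

text \<open>For \<open>x = 9/64 * 4\<^sup>k\<close> the rate \<open>x / (1 + x)\<close> is increasing in \<open>x\<close>, with value \<open>9/73\<close> at \<open>k = 0\<close>; for \<open>k < 0\<close> the
  denominator is at most \<open>73/64\<close>.\<close>

lemma block_rate_lower:
  shows "k \<ge> 0 \<Longrightarrow> 9 / 73 \<le> block_rate k"
    and "k < 0 \<Longrightarrow> 9 / 73 * 4 powr of_int k \<le> block_rate k"
proof -
  let ?q = "4 powr real_of_int k"
  have q: "?q > 0" by simp
  have pos: "0 < 1 + 9 / 64 * ?q" using q by (intro add_pos_pos) auto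
  show "9 / 73 \<le> block_rate k" if "k \<ge> 0"
  proof -
    have "1 \<le> ?q" using that by (intro ge_one_powr_ge_zero) auto
    then show ?thesis unfolding block_rate_def using pos by (simp add: pos_le_divide_eq)
  qed
  show "9 / 73 * ?q \<le> block_rate k" if "k < 0"
  proof -
    have "?q \<le> 4 powr 0" using that by (intro powr_mono) auto
    then have "?q * ?q \<le> ?q * 1" using q by (intro mult_left_mono) auto
    then show ?thesis unfolding block_rate_def using pos by (simp add: pos_le_divide_eq algebra_simps)
  qed
qed

section \<open>Summation over the dyadic blocks\<close>

text \<open>From \<open>z \<le> exp z\<close> at \<open>z = c y / b\<close>, raised to the power \<open>b\<close>.\<close>

lemma powr_exp_bounded:
  fixes b c y :: real
  assumes "b > 0" "c > 0" "y > 0"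
  shows "y powr b * exp (- c * y) \<le> (b / c) powr b"
proof -
  have "y * c / b \<le> exp (y * c / b)" using exp_ge_add_one_self[of "y * c / b"] by linarith
  then have "(y * c / b) powr b \<le> exp (y * c / b) powr b" using assms by (intro powr_mono2) auto
  also have "\<dots> = exp (c * y)" using assms by (simp add: exp_powr_real mult.commute)
  finally have le: "(y * c / b) powr b \<le> exp (c * y)" .
  have "y powr b = (b / c) powr b * (y * c / b) powr b"
    using assms by (simp add: powr_mult[symmetric])
  then have "y powr b * exp (- c * y) = (b / c) powr b * ((y * c / b) powr b * exp (- c * y))" by simp
  also have "\<dots> \<le> (b / c) powr b * (exp (c * y) * exp (- c * y))"
    using le by (intro mult_left_mono mult_right_mono) auto
  also have "\<dots> = (b / c) powr b" by (simp add: exp_minus)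
  finally show ?thesis .
qed

lemma sum_geometric_int:
  fixes q :: real
  assumes q: "0 < q" "q < 1" and F: "finite (F :: int set)"
  shows "(\<Sum>k\<in>F. q ^ nat \<bar>k\<bar>) \<le> 2 / (1 - q)"
proof -
  have half: "(\<Sum>k\<in>G. q ^ nat \<bar>k\<bar>) \<le> 1 / (1 - q)" if "finite G" "inj_on (\<lambda>k. nat \<bar>k\<bar>) G" for G :: "int set"
  proof -
    have "(\<Sum>k\<in>G. q ^ nat \<bar>k\<bar>) = (\<Sum>n\<in>(\<lambda>k. nat \<bar>k\<bar>) ` G. q ^ n)"
      using that(2) by (subst sum.reindex) auto
    also have "\<dots> \<le> (\<Sum>n. q ^ n)"
      using q that(1) by (intro sum_le_suminf summable_geometric) auto
    also have "\<dots> = 1 / (1 - q)" using q by (simp add: suminf_geometric)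
    finally show ?thesis .
  qed
  have "(\<Sum>k\<in>F. q ^ nat \<bar>k\<bar>) = (\<Sum>k\<in>{k\<in>F. k \<ge> 0}. q ^ nat \<bar>k\<bar>) + (\<Sum>k\<in>{k\<in>F. k < 0}. q ^ nat \<bar>k\<bar>)"
    using F by (subst sum.union_disjoint[symmetric]) (auto intro!: sum.cong)
  also have "\<dots> \<le> 1 / (1 - q) + 1 / (1 - q)"
    using F by (intro add_mono half) (auto simp: inj_on_def)
  finally show ?thesis by simp
qed

text \<open>Put \<open>a = s/2\<close>, \<open>\<tau> = 1 + t\<close> and \<open>y = \<tau> 4\<^sup>k\<close>. The summand is \<open>\<tau> powr (- a) * y powr a\<close> times an
  exponential that is at most \<open>exp c * exp (- c y)\<close>, as \<open>4\<^sup>k \<le> 1\<close>. Now \<open>y powr a * exp (- c y)\<close> is at most a constant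
  times the smaller of \<open>y powr a\<close> and \<open>y powr (- a)\<close>, that is, times \<open>4 powr (- a |\<rho>|)\<close> for
  \<open>\<rho> = log 4 y\<close>. Since \<open>\<rho>\<close> runs through a translate of the integers, the sum is at most a
  two-sided geometric series, whatever \<open>\<tau>\<close> is.\<close>

lemma dyadic_heat_sum:
  fixes s c :: real
  assumes s: "s > 0" and c: "c > 0"
  shows "\<exists>K>0. \<forall>t\<ge>0. \<forall>F. finite F \<and> F \<subseteq> {..<0::int} \<longrightarrow>
     (\<Sum>k\<in>F. 2 powr (of_int k * s) * exp (- t * (c * 4 powr of_int k))) \<le> K * (1 + t) powr (- s / 2)"
proof -
  define a where "a = s / 2"
  have a: "a > 0" using s by (simp add: a_def)
  define q where "q = 4 powr (- a)"
  have q: "0 < q" "q < 1" using a by (auto simp: q_def powr_less_one)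
  define K2 where "K2 = 1 + (2 * a / c) powr (2 * a)"
  have K2: "K2 \<ge> 1" by (simp add: K2_def)
  define K where "K = exp c * (K2 * 4 powr a * (2 / (1 - q)))"
  have K: "K > 0" using K2 q by (simp add: K_def)
  have "(\<Sum>k\<in>F. 2 powr (of_int k * s) * exp (- t * (c * 4 powr of_int k))) \<le> K * (1 + t) powr (- s / 2)"
    if t: "t \<ge> 0" and F: "finite F" "F \<subseteq> {..<0::int}" for t F
  proof -
    define \<tau> where "\<tau> = 1 + t"
    have \<tau>: "\<tau> \<ge> 1" using t by (simp add: \<tau>_def)
    \<comment> \<open>Rounding the shift \<open>log 4 \<tau>\<close> down costs the factor \<open>4 powr a\<close> and makes the exponents integers.\<close>
    define n where "n = \<lfloor>log 4 \<tau>\<rfloor>"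
    have summand: "2 powr (of_int k * s) * exp (- t * (c * 4 powr of_int k))
        \<le> exp c * (K2 * 4 powr a) * \<tau> powr (- a) * q ^ nat \<bar>k + n\<bar>" if k: "k \<in> F" for k
    proof -
      define y where "y = \<tau> * 4 powr of_int k"
      have y: "y > 0" using \<tau> by (simp add: y_def)
      define \<rho> where "\<rho> = of_int k + log 4 \<tau>"
      have y_eq: "y = 4 powr \<rho>" using \<tau> by (simp add: y_def \<rho>_def powr_add)
      have "4 powr real_of_int k \<le> 4 powr 0" using k F(2) by (intro powr_mono) auto
      then have "c * 4 powr of_int k \<le> c * 1" using c by (intro mult_left_mono) auto
      then have "- t * (c * 4 powr of_int k) \<le> c + - c * y"
        by (simp add: y_def \<tau>_def algebra_simps)
      then have e: "exp (- t * (c * 4 powr of_int k)) \<le> exp c * exp (- c * y)"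
        by (simp add: exp_add[symmetric])
      have pw: "2 powr (of_int k * s) = \<tau> powr (- a) * y powr a"
      proof -
        have "(4::real) powr (of_int k * a) = (2 powr 2) powr (of_int k * a)" by simp
        also have "\<dots> = 2 powr (of_int k * s)" unfolding powr_powr a_def by (simp add: mult.commute)
        finally have "2 powr (of_int k * s) = (4 powr of_int k) powr a" by (simp add: powr_powr)
        moreover have "\<tau> powr (- a) * y powr a = (\<tau> powr (- a) * \<tau> powr a) * (4 powr of_int k) powr a"
          using \<tau> by (simp add: y_def powr_mult)
        moreover have "\<tau> powr (- a) * \<tau> powr a = 1" using \<tau> by (simp add: powr_add[symmetric])
        ultimately show ?thesis by simp
      qed
      have up: "y powr a * exp (- c * y) \<le> K2 * y powr a"
      proof -
        have "exp (- c * y) \<le> 1" using c y by simp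
        then have "exp (- c * y) \<le> K2" using K2 by linarith
        then show ?thesis by (subst mult.commute) (intro mult_right_mono, auto)
      qed
      have down: "y powr a * exp (- c * y) \<le> K2 * y powr (- a)"
      proof -
        have "y powr a * exp (- c * y) = y powr (- a) * (y powr (2 * a) * exp (- c * y))"
          by (simp add: powr_add[symmetric] mult.assoc[symmetric])
        also have "\<dots> \<le> y powr (- a) * K2"
          using powr_exp_bounded[of "2 * a" c y] a c y by (intro mult_left_mono) (auto simp: K2_def)
        finally show ?thesis by (simp add: mult.commute)
      qed
      have "y powr a * exp (- c * y) \<le> K2 * 4 powr (- a * \<bar>\<rho>\<bar>)"
        using up down unfolding y_eq powr_powr by (cases "\<rho> \<ge> 0") (simp_all add: mult.commute)
      also have "\<dots> \<le> K2 * (4 powr a * q ^ nat \<bar>k + n\<bar>)"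
      proof (intro mult_left_mono)
        have "real_of_int n \<le> log 4 \<tau>" "log 4 \<tau> < real_of_int n + 1" unfolding n_def by linarith+
        then have "real_of_int \<bar>k + n\<bar> - 1 \<le> \<bar>\<rho>\<bar>" unfolding \<rho>_def by linarith
        then have "a * (real_of_int \<bar>k + n\<bar> - 1) \<le> a * \<bar>\<rho>\<bar>" using a by (intro mult_left_mono) auto
        then have "4 powr (- a * \<bar>\<rho>\<bar>) \<le> 4 powr (a + - a * real (nat \<bar>k + n\<bar>))"
          by (intro powr_mono) (auto simp: algebra_simps)
        also have "\<dots> = 4 powr a * q ^ nat \<bar>k + n\<bar>"
          unfolding powr_add q_def by (simp add: powr_powr powr_realpow[symmetric])
        finally show "4 powr (- a * \<bar>\<rho>\<bar>) \<le> 4 powr a * q ^ nat \<bar>k + n\<bar>" .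
      qed (use K2 in simp)
      finally have h: "y powr a * exp (- c * y) \<le> K2 * (4 powr a * q ^ nat \<bar>k + n\<bar>)" .
      have "2 powr (of_int k * s) * exp (- t * (c * 4 powr of_int k))
          \<le> (\<tau> powr (- a) * y powr a) * (exp c * exp (- c * y))"
        unfolding pw by (intro mult_left_mono e) simp
      also have "\<dots> = exp c * \<tau> powr (- a) * (y powr a * exp (- c * y))" by simp
      also have "\<dots> \<le> exp c * \<tau> powr (- a) * (K2 * (4 powr a * q ^ nat \<bar>k + n\<bar>))"
        by (intro mult_left_mono h) simp
      finally show ?thesis by (simp add: mult_ac)
    qed
    have "(\<Sum>k\<in>F. 2 powr (of_int k * s) * exp (- t * (c * 4 powr of_int k)))
        \<le> (\<Sum>k\<in>F. exp c * (K2 * 4 powr a) * \<tau> powr (- a) * q ^ nat \<bar>k + n\<bar>)"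
      by (rule sum_mono[OF summand])
    also have "\<dots> = exp c * (K2 * 4 powr a) * \<tau> powr (- a) * (\<Sum>k\<in>F. q ^ nat \<bar>k + n\<bar>)"
      by (rule sum_distrib_left[symmetric])
    also have "(\<Sum>k\<in>F. q ^ nat \<bar>k + n\<bar>) = (\<Sum>k\<in>(\<lambda>k. k + n) ` F. q ^ nat \<bar>k\<bar>)"
      by (subst sum.reindex) auto
    also have "exp c * (K2 * 4 powr a) * \<tau> powr (- a) * \<dots> \<le> exp c * (K2 * 4 powr a) * \<tau> powr (- a) * (2 / (1 - q))"
      using K2 F(1) by (intro mult_left_mono sum_geometric_int q) auto
    finally show ?thesis by (simp add: K_def \<tau>_def a_def mult_ac)
  qed
  then show ?thesis using K by blast
qed

lemma powr_superadditive:
  assumes "p \<ge> 1" "0 \<le> x" "0 \<le> (y::real)"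
  shows "x powr p + y powr p \<le> (x + y) powr p"
proof -
  have split: "z powr p = z * z powr (p - 1)" if "z \<ge> 0" for z
    using that powr_mult_base[of z "p - 1"] by simp
  have "x powr p + y powr p \<le> x * (x + y) powr (p - 1) + y * (x + y) powr (p - 1)"
    using assms by (intro add_mono) (auto simp: split intro!: mult_left_mono powr_mono2)
  also have "\<dots> = (x + y) powr p" using assms split[of "x + y"] by (simp add: distrib_right)
  finally show ?thesis .
qed

text \<open>An \<open>\<ell>\<^sup>p\<close> norm is at most the \<open>\<ell>\<^sup>1\<close> norm.\<close>

lemma sum_powr_le_powr_sum:
  assumes p: "p \<ge> 1" and fin: "finite F" and nonneg: "\<And>k. k \<in> F \<Longrightarrow> 0 \<le> x k" and le: "sum x F \<le> (S::real)"
  shows "(\<Sum>k\<in>F. x k powr p) \<le> S powr p"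
proof -
  have "(\<Sum>k\<in>F. x k powr p) \<le> sum x F powr p"
    using fin nonneg
  proof (induction F rule: finite_induct)
    case (insert k F)
    have "(\<Sum>k\<in>insert k F. x k powr p) \<le> x k powr p + sum x F powr p"
      using insert by simp
    also have "\<dots> \<le> (x k + sum x F) powr p"
      using insert.prems by (intro powr_superadditive[OF p] sum_nonneg) auto
    finally show ?case using insert.hyps by simp
  qed simp
  also have "\<dots> \<le> S powr p" using le p nonneg by (intro powr_mono2 sum_nonneg) auto
  finally show ?thesis .
qed

text \<open>The low blocks are estimated in \<open>\<ell>\<^sup>1\<close>, the high ones in \<open>\<ell>\<^sup>p\<close>, and the two parts are put together by
  superadditivity of the \<open>p\<close>-th power.\<close>

lemma lp_sum_low_high_le:
  fixes \<beta> \<alpha> x :: "int \<Rightarrow> real"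
  assumes p: "p \<ge> 1" and fin: "finite F"
    and nonneg: "\<And>k. 0 \<le> \<beta> k" "\<And>k. 0 \<le> \<alpha> k" "\<And>k. 0 \<le> x k" "0 \<le> E" "0 \<le> A" "0 \<le> S"
    and low: "\<And>k. k < 0 \<Longrightarrow> \<beta> k \<le> x k" and high: "\<And>k. k \<ge> 0 \<Longrightarrow> \<beta> k \<le> E * \<alpha> k"
    and S: "\<And>G. finite G \<Longrightarrow> G \<subseteq> {..<0} \<Longrightarrow> sum x G \<le> S"
    and A: "\<And>G. finite G \<Longrightarrow> (\<Sum>k\<in>G. \<alpha> k powr p) \<le> A powr p"
  shows "(\<Sum>k\<in>F. \<beta> k powr p) \<le> (S + E * A) powr p"
proof -
  let ?N = "{k\<in>F. k < 0}" and ?P = "{k\<in>F. k \<ge> 0}"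
  have "(\<Sum>k\<in>F. \<beta> k powr p) = (\<Sum>k\<in>?N. \<beta> k powr p) + (\<Sum>k\<in>?P. \<beta> k powr p)"
    using fin by (subst sum.union_disjoint[symmetric]) (auto intro!: sum.cong)
  also have "(\<Sum>k\<in>?N. \<beta> k powr p) \<le> S powr p"
  proof (rule sum_powr_le_powr_sum[OF p])
    have "sum \<beta> ?N \<le> sum x ?N" using low by (intro sum_mono) auto
    also have "\<dots> \<le> S" using fin by (intro S) auto
    finally show "sum \<beta> ?N \<le> S" .
  qed (use fin nonneg in auto)
  also have "(\<Sum>k\<in>?P. \<beta> k powr p) \<le> (E * A) powr p"
  proof -
    have "(\<Sum>k\<in>?P. \<beta> k powr p) \<le> (\<Sum>k\<in>?P. E powr p * \<alpha> k powr p)"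
    proof (rule sum_mono)
      fix k assume "k \<in> ?P"
      then have "\<beta> k powr p \<le> (E * \<alpha> k) powr p" using high nonneg p by (intro powr_mono2) auto
      then show "\<beta> k powr p \<le> E powr p * \<alpha> k powr p" using nonneg by (simp add: powr_mult)
    qed
    also have "\<dots> = E powr p * (\<Sum>k\<in>?P. \<alpha> k powr p)" by (rule sum_distrib_left[symmetric])
    also have "\<dots> \<le> E powr p * A powr p" using fin by (intro mult_left_mono A) auto
    finally show ?thesis using nonneg by (simp add: powr_mult)
  qed
  also have "S powr p + (E * A) powr p \<le> (S + E * A) powr p"
    using nonneg by (intro powr_superadditive[OF p]) auto
  finally show ?thesis by simp
qed

section \<open>Besov norms and the theorem\<close>

lemma ennreal_powr_ennreal: "x \<ge> 0 \<Longrightarrow> ennreal_powr (ennreal x) p = ennreal (x powr p)"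
  by (simp add: ennreal_powr_def)

lemma ennreal_powr_mono: "p \<ge> 0 \<Longrightarrow> x \<le> y \<Longrightarrow> ennreal_powr x p \<le> ennreal_powr y p"
  by (auto simp: ennreal_powr_def top_unique less_top intro!: ennreal_leI powr_mono2 enn2real_mono)

text \<open>
  A sum of extended nonnegative reals is the supremum of its finite partial sums, so this lemma and the
  next one translate between Besov norms and finite sums of reals.\<close>

lemma besov_norm_le:
  assumes q: "1 \<le> q" "q \<noteq> \<infinity>" and Z: "Z \<ge> 0" and \<beta>: "\<And>k. \<beta> k \<ge> 0"
    and blocks: "\<And>k. ennreal (2 powr (of_int k * s)) * L2_norm (lp_block chi k v) = ennreal (\<beta> k)"
    and le: "\<And>F. finite F \<Longrightarrow> (\<Sum>k\<in>F. \<beta> k powr enn2real q) \<le> Z powr enn2real q"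
  shows "besov_norm chi s q v \<le> ennreal Z"
proof -
  let ?p = "enn2real q"
  have p: "?p \<ge> 1" using enn2real_mono[OF q(1)] q(2) by (simp add: less_top)
  have "(\<Sum>\<^sub>\<infinity>k\<in>UNIV. ennreal (\<beta> k powr ?p)) \<le> ennreal (Z powr ?p)"
    unfolding nonneg_infsum_complete[OF zero_le]
  proof (rule SUP_least)
    fix F :: "int set" assume "F \<in> {F. finite F \<and> F \<subseteq> UNIV}"
    then show "(\<Sum>k\<in>F. ennreal (\<beta> k powr ?p)) \<le> ennreal (Z powr ?p)"
      using le[of F] by (simp add: ennreal_leI)
  qed
  then have "ennreal_powr (\<Sum>\<^sub>\<infinity>k\<in>UNIV. ennreal (\<beta> k powr ?p)) (1 / ?p) \<le> ennreal_powr (ennreal (Z powr ?p)) (1 / ?p)"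
    using p by (intro ennreal_powr_mono) auto
  also have "\<dots> = ennreal Z" using p Z by (simp add: ennreal_powr_ennreal powr_powr)
  finally show ?thesis
    unfolding besov_norm_def using q(2) by (simp add: blocks ennreal_powr_ennreal \<beta>)
qed

lemma sum_blocks_le_besov_norm:
  assumes q: "1 \<le> q" "q \<noteq> \<infinity>" and fin: "besov_norm chi s q v = ennreal A" "A \<ge> 0" and \<alpha>: "\<And>k. \<alpha> k \<ge> 0"
    and blocks: "\<And>k. ennreal (2 powr (of_int k * s)) * L2_norm (lp_block chi k v) = ennreal (\<alpha> k)"
    and F: "finite F"
  shows "(\<Sum>k\<in>F. \<alpha> k powr enn2real q) \<le> A powr enn2real q"
proof -
  let ?p = "enn2real q"
  have p: "?p \<ge> 1" using enn2real_mono[OF q(1)] q(2) by (simp add: less_top)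
  let ?X = "\<Sum>\<^sub>\<infinity>k\<in>UNIV. ennreal (\<alpha> k powr ?p)"
  have A: "ennreal_powr ?X (1 / ?p) = ennreal A"
    using fin(1) q(2) unfolding besov_norm_def by (simp add: blocks ennreal_powr_ennreal \<alpha>)
  then have "?X \<noteq> \<infinity>" by (auto simp: ennreal_powr_def split: if_splits)
  then obtain x where x: "?X = ennreal x" "x \<ge> 0" by (cases ?X) auto
  have "x powr (1 / ?p) = A" using A fin(2) x by (simp add: ennreal_powr_ennreal)
  then have Ap: "A powr ?p = x" using p x(2) by (auto simp: powr_powr)
  have "(\<Sum>k\<in>F. ennreal (\<alpha> k powr ?p)) \<le> ?X"
    unfolding nonneg_infsum_complete[OF zero_le] by (rule SUP_upper) (use F in simp)
  then have "ennreal (\<Sum>k\<in>F. \<alpha> k powr ?p) \<le> ennreal x" by (simp add: x)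
  then show ?thesis using x(2) Ap by (simp add: sum_nonneg)
qed

lemma block_le_besov_norm_infinity:
  "ennreal (2 powr (of_int k * s)) * L2_norm (lp_block chi k v) \<le> besov_norm chi s \<infinity> v"
  unfolding besov_norm_def if_P[OF refl] by (rule SUP_upper) simp

theorem proposition6p1:
  fixes chi :: "real ^ 'n \<Rightarrow> real" and r :: ennreal and \<sigma> d :: real
  assumes d: "d = real CARD('n)"
    and cutoff: "lp_cutoff chi"
    and r: "1 \<le> r"
    and \<sigma>: "\<sigma> > - d / 2 - 1"
  shows "\<exists>lam C. lam > 0 \<and> C > 0 \<and>
    (\<forall>u0 u. u0 \<in> besov_space chi (- d / 2 - 1) \<infinity> \<inter> besov_space chi \<sigma> r \<longrightarrow>
       linear_solution u0 u \<longrightarrow>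
       (\<forall>t\<ge>0. u t \<in> besov_space chi \<sigma> r \<and>
          besov_norm chi \<sigma> r (u t)
            \<le> ennreal (C * (1 + t) powr (- (\<sigma> + d / 2 + 1) / 2)) * besov_norm chi (- d / 2 - 1) \<infinity> u0
             + ennreal (C * exp (- lam * t)) * besov_norm chi \<sigma> r u0))"
proof -
  define s where "s = \<sigma> + d / 2 + 1"
  have s: "s > 0" using \<sigma> by (simp add: s_def)
  obtain K where K: "K > 0" and heat: "\<And>t F. t \<ge> 0 \<Longrightarrow> finite F \<Longrightarrow> F \<subseteq> {..<0::int} \<Longrightarrow>
      (\<Sum>k\<in>F. 2 powr (of_int k * s) * exp (- t * (9 / 73 * 4 powr of_int k))) \<le> K * (1 + t) powr (- s / 2)"
    using dyadic_heat_sum[OF s, of "9 / 73"] by auto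
  \<comment> \<open>The constant must serve both terms: \<open>K\<close> for the low frequencies and 1 for the high ones.\<close>
  let ?lam = "9 / 73 :: real" and ?C = "K + 1"
  have main: "u t \<in> besov_space chi \<sigma> r \<and>
      besov_norm chi \<sigma> r (u t)
        \<le> ennreal (?C * (1 + t) powr (- (\<sigma> + d / 2 + 1) / 2)) * besov_norm chi (- d / 2 - 1) \<infinity> u0
          + ennreal (?C * exp (- ?lam * t)) * besov_norm chi \<sigma> r u0"
    if u0: "u0 \<in> besov_space chi (- d / 2 - 1) \<infinity>" "u0 \<in> besov_space chi \<sigma> r"
      and sol: "linear_solution u0 u" and t: "t \<ge> 0" for u0 u t
  proof -
    have S_h: "u0 \<in> S_h chi" and temp: "tempered u0" using u0(1) by (auto simp: besov_space_def S_h_def)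
    define m where "m = enn2real (besov_norm chi (- d / 2 - 1) \<infinity> u0)"
    define A where "A = enn2real (besov_norm chi \<sigma> r u0)"
    have m: "besov_norm chi (- d / 2 - 1) \<infinity> u0 = ennreal m" "m \<ge> 0"
      and A: "besov_norm chi \<sigma> r u0 = ennreal A" "A \<ge> 0"
      using u0 by (auto simp: besov_space_def m_def A_def less_top)
    define l where "l k = enn2real (L2_norm (lp_block chi k u0))" for k
    define l' where "l' k = enn2real (L2_norm (lp_block chi k (u t)))" for k
    have l0: "l k \<ge> 0" "l' k \<ge> 0" for k by (simp_all add: l_def l'_def)
    have low_block: "ennreal (2 powr (of_int k * (- d / 2 - 1))) * L2_norm (lp_block chi k u0) \<le> ennreal m" for k
      unfolding m(1)[symmetric] by (rule block_le_besov_norm_infinity)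
    have l: "L2_norm (lp_block chi k u0) = ennreal (l k)" for k
    proof -
      have "L2_norm (lp_block chi k u0) \<noteq> \<infinity>"
        using low_block[of k] by (auto simp: ennreal_mult_top top_unique)
      then show ?thesis by (simp add: l_def less_top)
    qed
    have l_le: "l k \<le> 2 powr (of_int k * (d / 2 + 1)) * m" for k
    proof -
      have "2 powr (of_int k * (- d / 2 - 1)) * l k \<le> m"
        using low_block[of k] l0 m(2) unfolding l by (simp add: ennreal_mult[symmetric])
      then have "2 powr (of_int k * (d / 2 + 1)) * (2 powr (of_int k * (- d / 2 - 1)) * l k) \<le> 2 powr (of_int k * (d / 2 + 1)) * m"
        by (intro mult_left_mono) auto
      moreover have "2 powr (of_int k * (d / 2 + 1)) * 2 powr (of_int k * (- d / 2 - 1)) = (1::real)"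
        by (simp add: powr_add[symmetric] algebra_simps)
      ultimately show ?thesis unfolding mult.assoc[symmetric] by (simp only: mult_1_left)
    qed
    have decay: "L2_norm (lp_block chi k (u t)) \<le> ennreal (exp (- t * block_rate k) * l k)" for k
      using lp_block_decay[OF cutoff temp sol t, of k] l0 unfolding l by (simp add: ennreal_mult)
    have l': "L2_norm (lp_block chi k (u t)) = ennreal (l' k)" for k
      using decay[of k] by (cases "L2_norm (lp_block chi k (u t))") (auto simp: l'_def top_unique)
    have l'_le: "l' k \<le> exp (- t * block_rate k) * l k" for k
      using decay[of k] l0 unfolding l' by simp
    define \<alpha> where "\<alpha> k = 2 powr (of_int k * \<sigma>) * l k" for k
    define \<beta> where "\<beta> k = 2 powr (of_int k * \<sigma>) * l' k" for k
    define x where "x k = 2 powr (of_int k * s) * exp (- t * (9 / 73 * 4 powr of_int k)) * m" for k :: int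
    define S where "S = K * (1 + t) powr (- s / 2) * m"
    define E where "E = exp (- ?lam * t)"
    have nonneg: "\<alpha> k \<ge> 0" "\<beta> k \<ge> 0" "x k \<ge> 0" "S \<ge> 0" "E \<ge> 0" for k
      using l0 m(2) K by (auto simp: \<alpha>_def \<beta>_def x_def S_def E_def)
    have \<alpha>: "ennreal (2 powr (of_int k * \<sigma>)) * L2_norm (lp_block chi k u0) = ennreal (\<alpha> k)"
      and \<beta>: "ennreal (2 powr (of_int k * \<sigma>)) * L2_norm (lp_block chi k (u t)) = ennreal (\<beta> k)" for k
      using l0 by (simp_all add: l l' \<alpha>_def \<beta>_def ennreal_mult)
    have \<beta>_le: "\<beta> k \<le> exp (- t * block_rate k) * \<alpha> k" for k
      unfolding \<alpha>_def \<beta>_def using mult_left_mono[OF l'_le[of k], of "2 powr (of_int k * \<sigma>)"] by (simp add: mult_ac)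
    have high: "\<beta> k \<le> E * \<alpha> k" if "k \<ge> 0" for k
    proof -
      have "t * (9 / 73) \<le> t * block_rate k" using block_rate_lower(1)[OF that] t by (rule mult_left_mono)
      then have "exp (- t * block_rate k) \<le> E" by (simp add: E_def mult.commute)
      then have "exp (- t * block_rate k) * \<alpha> k \<le> E * \<alpha> k" using nonneg by (intro mult_right_mono)
      then show ?thesis using \<beta>_le[of k] by linarith
    qed
    have low: "\<beta> k \<le> x k" if "k < 0" for k
    proof -
      have "t * (9 / 73 * 4 powr of_int k) \<le> t * block_rate k" using block_rate_lower(2)[OF that] t by (rule mult_left_mono)
      then have e: "exp (- t * block_rate k) \<le> exp (- t * (9 / 73 * 4 powr of_int k))" by simp
      have "\<alpha> k \<le> 2 powr (of_int k * \<sigma>) * (2 powr (of_int k * (d / 2 + 1)) * m)"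
        unfolding \<alpha>_def by (intro mult_left_mono l_le) simp
      also have "\<dots> = 2 powr (of_int k * s) * m"
        by (simp add: s_def powr_add[symmetric] mult.assoc[symmetric] distrib_left add.assoc)
      finally have "exp (- t * block_rate k) * \<alpha> k
          \<le> exp (- t * (9 / 73 * 4 powr of_int k)) * (2 powr (of_int k * s) * m)"
        using e nonneg by (intro mult_mono) auto
      then show ?thesis using \<beta>_le[of k] by (simp add: x_def mult_ac)
    qed
    have sum_x: "sum x G \<le> S" if "finite G" "G \<subseteq> {..<0}" for G
      unfolding x_def S_def sum_distrib_right[symmetric] by (intro mult_right_mono heat t that m(2))
    have bound: "besov_norm chi \<sigma> r (u t) \<le> ennreal (S + E * A)"
    proof (cases "r = \<infinity>")
      case True
      have "\<beta> k \<le> S + E * A" for k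
      proof (cases "k < 0")
        case True
        then show ?thesis using low[OF True] sum_x[of "{k}"] nonneg A(2) by (simp add: add_increasing2)
      next
        case False
        have "ennreal (\<alpha> k) \<le> ennreal A"
          unfolding \<alpha>[symmetric] A(1)[symmetric] \<open>r = \<infinity>\<close> by (rule block_le_besov_norm_infinity)
        then have "\<alpha> k \<le> A" using A(2) by simp
        then have "E * \<alpha> k \<le> E * A" using nonneg by (intro mult_left_mono)
        then show ?thesis using high[of k] False nonneg(4) by linarith
      qed
      then show ?thesis
        unfolding besov_norm_def using True by (auto simp: \<beta> intro!: SUP_least ennreal_leI)
    next
      case False
      have p: "enn2real r \<ge> 1" using enn2real_mono[OF r] False by (simp add: less_top)
      show ?thesis
      proof (rule besov_norm_le[OF r False _ nonneg(2) \<beta>])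
        show "0 \<le> S + E * A" using nonneg A(2) by simp
        show "(\<Sum>k\<in>F. \<beta> k powr enn2real r) \<le> (S + E * A) powr enn2real r" if "finite F" for F
          by (rule lp_sum_low_high_le[OF p that nonneg(2,1,3,5) A(2) nonneg(4) low high sum_x
                sum_blocks_le_besov_norm[OF r False A nonneg(1) \<alpha>]])
      qed
    qed
    also have "\<dots> \<le> ennreal (?C * (1 + t) powr (- (\<sigma> + d / 2 + 1) / 2) * m + ?C * exp (- ?lam * t) * A)"
    proof (rule ennreal_leI, rule add_mono)
      show "S \<le> ?C * (1 + t) powr (- (\<sigma> + d / 2 + 1) / 2) * m"
        unfolding S_def s_def using m(2) by (intro mult_right_mono) auto
      show "E * A \<le> ?C * exp (- ?lam * t) * A"
        unfolding E_def using A(2) K by (intro mult_right_mono) auto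
    qed
    also have "\<dots> = ennreal (?C * (1 + t) powr (- (\<sigma> + d / 2 + 1) / 2)) * besov_norm chi (- d / 2 - 1) \<infinity> u0
          + ennreal (?C * exp (- ?lam * t)) * besov_norm chi \<sigma> r u0"
      unfolding m(1) A(1) using m(2) A(2) K by (simp add: ennreal_mult ennreal_plus)
    finally have est: "besov_norm chi \<sigma> r (u t) \<le> \<dots>" .
    have "besov_norm chi \<sigma> r (u t) < \<infinity>" using bound by (simp add: le_less_trans)
    then show ?thesis
      using est solution_in_S_h[OF cutoff sol S_h t] by (simp add: besov_space_def)
  qed
  show ?thesis
    by (intro exI[of _ ?lam] exI[of _ ?C] conjI allI impI) (use K main in auto)
qed

end
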